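(* Let $(X,\mathbf h,\Lambda,\widetilde B)$ be a quantum seed. Then every cluster variable of every quantum seed mutation-equivalent to $(X,\mathbf h,\Lambda,\widetilde B)$ lies in $\mathbb{Z}\mathbb{P}[(X'_1)^{\pm1},\dots,(X'_n)^{\pm1}]$ for every quantum seed $(X',\mathbf h,\Lambda',\widetilde B')$ mutation-equivalent to $(X,\mathbf h,\Lambda,\widetilde B)$; that is, $$\mathcal A(X,\mathbf h,\Lambda,\widetilde B)\subseteq \widetilde{\mathcal U}(X,\mathbf h,\Lambda,\widetilde B).$$
   Context: Notation: $[a,b]=\{a,a+1,\dots,b\}$; $[x]_+=\max(x,0)$, applied entrywise to vectors; $e_1,\dots,e_m$ is the standard basis of $\mathbb Z^m$. Fix integers $m\ge n\ge 1$. A compatible pair $(\Lambda,\widetilde B)$ consists of an $m\times n$ integer matrix $\widetilde B=(b_{kl})$ and a skew-symmetric $m\times m$ integer matrix $\Lambda=(\lambda_{kl})$ such that $\Lambda\widetilde B=-\begin{bmatrix}D\\0\end{bmatrix}$ for some $D=\mathrm{diag}(\tilde d_1,\dots,\tilde d_n)$ with all $\tilde d_k\in\mathbb Z_{>0}$ (so $\widetilde B$ has full rank). Write $\Lambda(a,b)=a^T\Lambda b$ for $a,b\in\mathbb Z^m$. Fix positive integers $d_1,\dots,d_n$ such that $d_k$ divides every entry of the $k$-th column $b^k$ of $\widetilde B$ (this divisibility is preserved under mutation), and put $\beta^k=\frac1{d_k}b^k$. The quantum torus $\mathcal T(\Lambda)$ is the $\mathbb Z[q^{\pm1/2}]$-algebra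 with basis $\{X(c)\mid c\in\mathbb Z^m\}$ and multiplication $X(c)X(d)=q^{\frac12\Lambda(c,d)}X(c+d)$; $\mathcal F$ is its skew field of fractions, and $X_k=X(e_k)$. For each $k\in[1,n]$ let $\mathbf h_k=(h_{k,0},\dots,h_{k,d_k})$ with $h_{k,r}\in\mathbb Z[q^{\pm1/2}]$, $h_{k,r}=h_{k,d_k-r}$ and $h_{k,0}=h_{k,d_k}=1$; $\mathbf h=(\mathbf h_1,\dots,\mathbf h_n)$. A quantum seed $(X,\mathbf h,\Lambda,\widetilde B)$ consists of a compatible pair, $\mathbf h$, and a map $X:\mathbb Z^m\to\mathcal F$ with $X(c)X(d)=q^{\frac12\Lambda(c,d)}X(c+d)$ (for the initial seed, the basis of $\mathcal T(\Lambda)$). The mutation in direction $i\in[1,n]$ is $\mu_i(X,\mathbf h,\Lambda,\widetilde B)=(X',\mathbf h,\Lambda',\widetilde B')$ where $\widetilde B'=E\widetilde BF$, $\Lambda'=E^T\Lambda E$, $E$ is the $m\times m$ matrix with $E_{kl}=\delta_{kl}$ for $l\ne i$, $E_{ii}=-1$, $E_{ki}=[-\varepsilon b_{ki}]_+$ for $k\neq i$, and $F$ is the $n\times n$ matrix with $F_{kl}=\delta_{kl}$ for $k\neq i$, $F_{ii}=-1$, $F_{il}=[\varepsilon b_{il}]_+$ for $l\ne i$ (the result is independent of $\varepsilon\in\{\pm1\}$); and $X'$ is the map with $X'(c)X'(d)=q^{\frac12\Lambda'(c,d)}X'(c+d)$ determined by $X'(e_k)=X(e_k)$ for $k\neq i$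 and $X'(e_i)=\sum_{r=0}^{d_i}h_{i,r}X(r[\beta^i]_++(d_i-r)[-\beta^i]_+-e_i)$. Write $X'_k=X'(e_k)$. Seeds obtained by finite sequences of mutations are mutation-equivalent; $X'_1,\dots,X'_n$ are the cluster variables of a seed and $X_{n+1},\dots,X_m$ (unchanged by mutation) are frozen variables. $\mathbb P$ is the multiplicative group generated by $q^{1/2},X_{n+1},\dots,X_m$, and $\mathbb{ZP}$ is the ring of Laurent polynomials in $X_{n+1},\dots,X_m$ with coefficients in $\mathbb Z[q^{\pm1/2}]$. For elements $Y_1,\dots,Y_s\in\mathcal F$, $\mathbb{ZP}[Y_1,\dots,Y_s]$ denotes the subring of $\mathcal F$ generated by $\mathbb{ZP}$ and the $Y_k$ (an exponent $\pm1$ means both $Y$ and $Y^{-1}$ are adjoined). The generalized quantum cluster algebra $\mathcal A(X,\mathbf h,\Lambda,\widetilde B)$ is the $\mathbb Z[q^{\pm1/2}]$-subalgebra of $\mathcal F$ generated by all cluster variables of all seeds mutation-equivalent to the given one together with $X_{n+1}^{\pm1},\dots,X_m^{\pm1}$. The generalized quantum upper cluster algebra is $\widetilde{\mathcal U}(X,\mathbf h,\Lambda,\widetilde B)=\bigcap_{(X',\mathbf h,\Lambda',\widetilde B')\sim(X,\mathbf h,\Lambda,\widetilde B)}\mathbb{ZP}[(X'_1)^{\pm1},\dots,(X'_n)^{\pm1}]$. *)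

theory Defs
  imports Main
begin

definition posp :: "int \<Rightarrow> int" where
  "posp x = max x 0"

definition unitv :: "nat \<Rightarrow> nat \<Rightarrow> int" where
  "unitv k = (\<lambda>j. if j = k then 1 else 0)"

definition vec_on :: "nat \<Rightarrow> (nat \<Rightarrow> int) \<Rightarrow> bool" where
  "vec_on m c \<longleftrightarrow> (\<forall>k. k \<notin> {1..m} \<longrightarrow> c k = 0)"

definition bform :: "nat \<Rightarrow> (nat \<Rightarrow> nat \<Rightarrow> int) \<Rightarrow> (nat \<Rightarrow> int) \<Rightarrow> (nat \<Rightarrow> int) \<Rightarrow> int" where
  "bform m L a b = (\<Sum>k\<in>{1..m}. \<Sum>l\<in>{1..m}. a k * L k l * b l)"

definition lprod :: "(nat \<Rightarrow> 'a::monoid_mult) \<Rightarrow> nat list \<Rightarrow> 'a" where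
  "lprod f ks = foldr (\<lambda>k acc. f k * acc) ks 1"

(* The toric frame X(c) determined by X(e_1),...,X(e_m) and Lambda:
   X(c) = q^(-1/2 sum_{k<l} c_k c_l lambda_kl) X_1^c_1 ... X_m^c_m *)
definition frame :: "nat \<Rightarrow> 'a::division_ring \<Rightarrow> (nat \<Rightarrow> 'a) \<Rightarrow> (nat \<Rightarrow> nat \<Rightarrow> int)
    \<Rightarrow> (nat \<Rightarrow> int) \<Rightarrow> 'a" where
  "frame m v x L c =
     v powi (- (\<Sum>k\<in>{1..m}. \<Sum>l\<in>{k<..m}. c k * c l * L k l))
     * lprod (\<lambda>k. x k powi c k) [1..<m+1]"

definition compatible :: "nat \<Rightarrow> nat \<Rightarrow> (nat \<Rightarrow> nat \<Rightarrow> int) \<Rightarrow> (nat \<Rightarrow> nat \<Rightarrow> int) \<Rightarrow> bool" where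
  "compatible m n L B \<longleftrightarrow>
     (\<forall>k\<in>{1..m}. \<forall>l\<in>{1..m}. L k l = - L l k) \<and>
     (\<exists>dt::nat \<Rightarrow> int. (\<forall>k\<in>{1..n}. dt k > 0) \<and>
        (\<forall>k\<in>{1..m}. \<forall>l\<in>{1..n}.
           (\<Sum>j\<in>{1..m}. L k j * B j l) = (if k = l then - dt l else 0)))"

inductive_set subring_gen :: "'a::ring_1 set \<Rightarrow> 'a set" for S where
  gen: "s \<in> S \<Longrightarrow> s \<in> subring_gen S"
| one: "1 \<in> subring_gen S"
| add: "a \<in> subring_gen S \<Longrightarrow> b \<in> subring_gen S \<Longrightarrow> a + b \<in> subring_gen S"
| neg: "a \<in> subring_gen S \<Longrightarrow> - a \<in> subring_gen S"
| mult: "a \<in> subring_gen S \<Longrightarrow> b \<in> subring_gen S \<Longrightarrow> a * b \<in> subring_gen S"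

definition coeff_ring :: "'a::division_ring \<Rightarrow> 'a set" where
  "coeff_ring v = subring_gen {v, inverse v}"

type_synonym 'a qseed = "(nat \<Rightarrow> 'a) \<times> (nat \<Rightarrow> nat \<Rightarrow> int) \<times> (nat \<Rightarrow> nat \<Rightarrow> int)"
  (* (X(e_1),...,X(e_m)), Lambda, B~ ; h is fixed and not changed by mutation *)

definition mutE :: "(nat \<Rightarrow> nat \<Rightarrow> int) \<Rightarrow> nat \<Rightarrow> nat \<Rightarrow> nat \<Rightarrow> int" where
  "mutE B i k l = (if l \<noteq> i then (if k = l then 1 else 0)
                   else if k = i then -1 else posp (- B k i))"

definition mutF :: "(nat \<Rightarrow> nat \<Rightarrow> int) \<Rightarrow> nat \<Rightarrow> nat \<Rightarrow> nat \<Rightarrow> int" where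
  "mutF B i k l = (if k \<noteq> i then (if k = l then 1 else 0)
                   else if l = i then -1 else posp (B i l))"

definition mutate :: "nat \<Rightarrow> nat \<Rightarrow> 'a::division_ring \<Rightarrow> (nat \<Rightarrow> nat) \<Rightarrow> (nat \<Rightarrow> nat \<Rightarrow> 'a)
    \<Rightarrow> nat \<Rightarrow> 'a qseed \<Rightarrow> 'a qseed" where
  "mutate m n v d h i s = (case s of (x, L, B) \<Rightarrow>
     (let E = mutE B i; F = mutF B i;
          beta = (\<lambda>j. B j i div int (d i));
          x' = (\<lambda>k. if k = i then
                   (\<Sum>r\<in>{0..d i}. h i r * frame m v x L
                      (\<lambda>j. int r * posp (beta j) + int (d i - r) * posp (- beta j) - unitv i j))
                 else x k);
          L' = (\<lambda>k l. \<Sum>a\<in>{1..m}. \<Sum>b\<in>{1..m}. E a k * L a b * E b l);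
          B' = (\<lambda>k l. \<Sum>a\<in>{1..m}. \<Sum>b\<in>{1..n}. E k a * B a b * F b l)
      in (x', L', B')))"

fun mutseq :: "nat \<Rightarrow> nat \<Rightarrow> 'a::division_ring \<Rightarrow> (nat \<Rightarrow> nat) \<Rightarrow> (nat \<Rightarrow> nat \<Rightarrow> 'a)
    \<Rightarrow> nat list \<Rightarrow> 'a qseed \<Rightarrow> 'a qseed" where
  "mutseq m n v d h [] s = s"
| "mutseq m n v d h (i # is) s = mutseq m n v d h is (mutate m n v d h i s)"

definition mut_class :: "nat \<Rightarrow> nat \<Rightarrow> 'a::division_ring \<Rightarrow> (nat \<Rightarrow> nat) \<Rightarrow> (nat \<Rightarrow> nat \<Rightarrow> 'a)
    \<Rightarrow> 'a qseed \<Rightarrow> 'a qseed set" where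
  "mut_class m n v d h s0 = {mutseq m n v d h ks s0 | ks. set ks \<subseteq> {1..n}}"

definition ZP_gens :: "nat \<Rightarrow> nat \<Rightarrow> 'a::division_ring \<Rightarrow> (nat \<Rightarrow> 'a) \<Rightarrow> 'a set" where
  "ZP_gens m n v x = {v, inverse v} \<union> x ` {n+1..m} \<union> (\<lambda>k. inverse (x k)) ` {n+1..m}"

definition gq_cluster_algebra :: "nat \<Rightarrow> nat \<Rightarrow> 'a::division_ring \<Rightarrow> (nat \<Rightarrow> nat) \<Rightarrow> (nat \<Rightarrow> nat \<Rightarrow> 'a)
    \<Rightarrow> 'a qseed \<Rightarrow> 'a set" where
  "gq_cluster_algebra m n v d h s0 =
     subring_gen (ZP_gens m n v (fst s0) \<union>
        {fst s k | s k. s \<in> mut_class m n v d h s0 \<and> k \<in> {1..n}})"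

definition gq_upper_cluster_algebra :: "nat \<Rightarrow> nat \<Rightarrow> 'a::division_ring \<Rightarrow> (nat \<Rightarrow> nat) \<Rightarrow> (nat \<Rightarrow> nat \<Rightarrow> 'a)
    \<Rightarrow> 'a qseed \<Rightarrow> 'a set" where
  "gq_upper_cluster_algebra m n v d h s0 =
     (\<Inter>s\<in>mut_class m n v d h s0.
        subring_gen (ZP_gens m n v (fst s0) \<union> fst s ` {1..n} \<union> (\<lambda>k. inverse (fst s k)) ` {1..n}))"

end

theory Submission
  imports Defs "HOL-Library.Function_Algebras"
begin

text \<open>For a seed \<open>s\<close> let \<open>U(s)\<close> be the intersection of the Laurent rings of \<open>s\<close> and of all seeds
  \<open>\<mu>\<^sub>j s\<close> adjacent to it. Since mutations are involutive, the cluster variables of \<open>s\<close> lie in \<open>U(s)\<close>, so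
  it is enough that \<open>U(\<mu>\<^sub>i s) = U(s)\<close>: then every cluster variable lies in the common upper bound of all
  seeds, hence in every Laurent ring. Invariance reduces to a rank two statement: an element of the
  Laurent rings of \<open>s\<close>, \<open>\<mu>\<^sub>i s\<close> and \<open>\<mu>\<^sub>k s\<close> belongs to that of \<open>\<mu>\<^sub>k \<mu>\<^sub>i s\<close>. If \<open>b\<^sub>i\<^sub>k = 0\<close>, this
  is the coprimality of the two exchange polynomials, which compatibility of \<open>\<Lambda>\<close> and \<open>B\<close> makes visible:
  \<open>\<Lambda>(\<cdot>, e\<^sub>k)\<close> is a grading in which one of them is homogeneous while the other has an invertible initial
  form. If \<open>b\<^sub>i\<^sub>k \<noteq> 0\<close>, it is the argument of Berenstein, Fomin and Zelevinsky: the exchange polynomial in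
  direction \<open>k\<close> has an invertible constant term in the \<open>i\<close>-th variable, and the symmetry of the
  coefficients \<open>h\<close> expresses the new \<open>k\<close>-th variable of \<open>\<mu>\<^sub>k s\<close> as a Laurent polynomial in
  \<open>\<mu>\<^sub>k \<mu>\<^sub>i s\<close>. All divisions are controlled by lowest components for gradings of \<open>\<int>\<^sup>m\<close>.\<close>

section \<open>Vectors, bilinear forms and coefficients\<close>

text \<open>A quantum torus offers no unique factorization to appeal to, so divisibility is replaced
  throughout by comparison of components: a nonzero initial form cancels in a division ring, and an
  element lying in two spans with disjoint sets of exponents is 0. The latter rests on linear
  independence of monomials. Only the initial basis is assumed independent, so independence has to
  be carried through each mutation (\<open>mutated_qtorus\<close>). Rank two is enough because
  \<open>upper (mu i s)\<close> involves only the Laurent rings of \<open>mu i s\<close> and of the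
  seeds \<open>mu j (mu i s)\<close>: for \<open>j = i\<close> the latter is that of
  \<open>s\<close>, and otherwise just the two directions \<open>i\<close> and \<open>j\<close> take
  part. The scalar \<open>v\<close> is the square root of q, and the skew field of fractions is
  represented by a division ring in which the monomials \<open>v powi z * X c\<close> are
  independent over the integers.\<close>

definition smul :: "int \<Rightarrow> (nat \<Rightarrow> int) \<Rightarrow> nat \<Rightarrow> int" where
  "smul k c = (\<lambda>j. k * c j)"

lemma smul_apply: "smul k c j = k * c j"
  by (simp add: smul_def)

text \<open>Higher-order unification eta-expands vectors, and the pointwise rules would then destroy sums
  of vectors; hence they are not simplification rules here.\<close>

declare plus_fun_apply [simp del] zero_fun_apply [simp del] minus_apply [simp del] uminus_apply [simp del]

lemmas vec_apply = plus_fun_apply zero_fun_apply minus_apply uminus_apply smul_apply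

lemma vec_on_closed [simp, intro]:
  "vec_on m 0"
  "vec_on m c \<Longrightarrow> vec_on m e \<Longrightarrow> vec_on m (c + e)"
  "vec_on m c \<Longrightarrow> vec_on m e \<Longrightarrow> vec_on m (c - e)"
  "vec_on m c \<Longrightarrow> vec_on m (- c)"
  "vec_on m c \<Longrightarrow> vec_on m (smul k c)"
  "i \<in> {1..m} \<Longrightarrow> vec_on m (unitv i)"
  by (auto simp: vec_on_def unitv_def vec_apply)

lemma unitv_same [simp]: "unitv i i = 1"
  by (simp add: unitv_def)

lemma unitv_other: "j \<noteq> i \<Longrightarrow> unitv i j = 0"
  by (simp add: unitv_def)

lemma bform_add_left: "bform m L (a + b) c = bform m L a c + bform m L b c"
  by (simp add: bform_def vec_apply algebra_simps sum.distrib)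

lemma bform_add_right: "bform m L c (a + b) = bform m L c a + bform m L c b"
  by (simp add: bform_def vec_apply algebra_simps sum.distrib)

lemma bform_diff_left: "bform m L (a - b) c = bform m L a c - bform m L b c"
  by (simp add: bform_def vec_apply algebra_simps sum_subtractf)

lemma bform_diff_right: "bform m L c (a - b) = bform m L c a - bform m L c b"
  by (simp add: bform_def vec_apply algebra_simps sum_subtractf)

lemma bform_minus_left: "bform m L (- a) c = - bform m L a c"
  by (simp add: bform_def vec_apply sum_negf)

lemma bform_minus_right: "bform m L c (- a) = - bform m L c a"
  by (simp add: bform_def vec_apply sum_negf)

lemma bform_smul_left: "bform m L (smul k a) c = k * bform m L a c"
  by (simp add: bform_def vec_apply algebra_simps sum_distrib_left)

lemma bform_smul_right: "bform m L c (smul k a) = k * bform m L c a"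
  by (simp add: bform_def vec_apply algebra_simps sum_distrib_left)

lemma bform_zero_left: "bform m L 0 c = 0"
  by (simp add: bform_def vec_apply)

lemma bform_zero_right: "bform m L c 0 = 0"
  by (simp add: bform_def vec_apply)

lemmas bform_linear =
  bform_add_left bform_add_right bform_diff_left bform_diff_right bform_minus_left
  bform_minus_right bform_smul_left bform_smul_right bform_zero_left bform_zero_right

lemma bform_cong:
  assumes "\<And>k l. k \<in> {1..m} \<Longrightarrow> l \<in> {1..m} \<Longrightarrow> L k l = L' k l"
    and "\<And>k. k \<in> {1..m} \<Longrightarrow> a k = a' k" and "\<And>k. k \<in> {1..m} \<Longrightarrow> b k = b' k"
  shows "bform m L a b = bform m L' a' b'"
  unfolding bform_def by (intro sum.cong refl) (simp add: assms)

lemma bform_unitv_left: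
  "k \<in> {1..m} \<Longrightarrow> bform m L (unitv k) b = (\<Sum>l\<in>{1..m}. L k l * b l)"
proof -
  assume k: "k \<in> {1..m}"
  have "bform m L (unitv k) b = (\<Sum>k'\<in>{1..m}. if k' = k then \<Sum>l\<in>{1..m}. L k l * b l else 0)"
    unfolding bform_def by (intro sum.cong refl) (auto simp: unitv_def)
  then show ?thesis using k by simp
qed

lemma bform_unitv_right:
  "k \<in> {1..m} \<Longrightarrow> bform m L a (unitv k) = (\<Sum>l\<in>{1..m}. a l * L l k)"
proof -
  assume k: "k \<in> {1..m}"
  have "bform m L a (unitv k) = (\<Sum>l\<in>{1..m}. \<Sum>k'\<in>{1..m}. if k' = k then a l * L l k else 0)"
    unfolding bform_def by (intro sum.cong refl) (auto simp: unitv_def)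
  then show ?thesis using k by simp
qed

lemma bform_unitv_unitv:
  assumes "k \<in> {1..m}" "l \<in> {1..m}"
  shows "bform m L (unitv k) (unitv l) = L k l"
proof -
  have "(\<Sum>j\<in>{1..m}. L k j * unitv l j) = (\<Sum>j\<in>{1..m}. if j = l then L k l else 0)"
    by (intro sum.cong refl) (auto simp: unitv_def)
  then show ?thesis using assms by (simp add: bform_unitv_left)
qed

lemma bform_skew:
  assumes "\<And>k l. k \<in> {1..m} \<Longrightarrow> l \<in> {1..m} \<Longrightarrow> L k l = - L l k"
  shows "bform m L b a = - bform m L a b"
proof -
  have "bform m L b a = (\<Sum>k\<in>{1..m}. \<Sum>l\<in>{1..m}. b l * L l k * a k)"
    unfolding bform_def by (rule sum.swap)
  also have "\<dots> = (\<Sum>k\<in>{1..m}. \<Sum>l\<in>{1..m}. - (a k * L k l * b l))"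
  proof (intro sum.cong refl)
    fix k l assume "k \<in> {1..m}" "l \<in> {1..m}"
    then have "L k l = - L l k" using assms by blast
    then show "b l * L l k * a k = - (a k * L k l * b l)" by simp
  qed
  finally show ?thesis by (simp add: bform_def sum_negf)
qed

lemma subring_gen_zero: "0 \<in> subring_gen S"
  using subring_gen.add[OF subring_gen.one subring_gen.neg[OF subring_gen.one]] by simp

lemma subring_gen_diff: "a \<in> subring_gen S \<Longrightarrow> b \<in> subring_gen S \<Longrightarrow> a - b \<in> subring_gen S"
  using subring_gen.add[of a S "- b"] subring_gen.neg by fastforce

lemma subring_gen_power: "a \<in> subring_gen S \<Longrightarrow> a ^ n \<in> subring_gen S"
  by (induction n) (auto intro: subring_gen.intros)

lemma subring_gen_powi:
  fixes a :: "'a::division_ring"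
  shows "a \<in> subring_gen S \<Longrightarrow> inverse a \<in> subring_gen S \<Longrightarrow> a powi z \<in> subring_gen S"
  by (auto simp: power_int_def intro: subring_gen_power)

lemma subring_gen_least:
  assumes "S \<subseteq> subring_gen R" shows "subring_gen S \<subseteq> subring_gen R"
proof
  fix x assume "x \<in> subring_gen S"
  then show "x \<in> subring_gen R"
    by induction (use assms in \<open>auto intro: subring_gen.intros\<close>)
qed

lemma subring_gen_commute:
  assumes "y \<in> subring_gen S" and "\<And>s. s \<in> S \<Longrightarrow> s * z = z * s"
  shows "y * z = z * y"
  using assms(1)
proof induction
  case (mult a b)
  then show ?case by (metis mult.assoc)
qed (auto simp: assms(2) algebra_simps)

lemma coeff_ring_closed:
  "0 \<in> coeff_ring v" "1 \<in> coeff_ring v" "v \<in> coeff_ring v"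
  "a \<in> coeff_ring v \<Longrightarrow> b \<in> coeff_ring v \<Longrightarrow> a + b \<in> coeff_ring v"
  "a \<in> coeff_ring v \<Longrightarrow> b \<in> coeff_ring v \<Longrightarrow> a - b \<in> coeff_ring v"
  "a \<in> coeff_ring v \<Longrightarrow> b \<in> coeff_ring v \<Longrightarrow> a * b \<in> coeff_ring v"
  "a \<in> coeff_ring v \<Longrightarrow> - a \<in> coeff_ring v"
  "v powi z \<in> coeff_ring v"
  unfolding coeff_ring_def
  by (auto intro: subring_gen.intros subring_gen_zero subring_gen_diff subring_gen_powi)

section \<open>Spans of monomials in a quantum torus\<close>

text \<open>The predicate \<open>P\<close> on exponents plays the role of a graded piece, a half
  space or a filtration level, so that one notion of span covers them all. Repeated exponents are
  allowed, which keeps sums trivial; \<open>tspan_finite_sum\<close> collects them where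
  independence is applied.\<close>

inductive_set tspan for m :: nat and v :: "'a::division_ring" and X :: "(nat \<Rightarrow> int) \<Rightarrow> 'a"
  and P :: "(nat \<Rightarrow> int) \<Rightarrow> bool" where
  zero: "0 \<in> tspan m v X P"
| step: "vec_on m c \<Longrightarrow> P c \<Longrightarrow> k \<in> coeff_ring v \<Longrightarrow> y \<in> tspan m v X P \<Longrightarrow> k * X c + y \<in> tspan m v X P"

lemma tspan_scaled_monom:
  "vec_on m c \<Longrightarrow> P c \<Longrightarrow> k \<in> coeff_ring v \<Longrightarrow> k * X c \<in> tspan m v X P"
  using tspan.step[OF _ _ _ tspan.zero] by (metis add.right_neutral)

lemma tspan_monom: "vec_on m c \<Longrightarrow> P c \<Longrightarrow> X c \<in> tspan m v X P"
  using tspan_scaled_monom[of m c P 1 v X] by (simp add: coeff_ring_closed)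

lemma tspan_add: "y \<in> tspan m v X P \<Longrightarrow> z \<in> tspan m v X P \<Longrightarrow> y + z \<in> tspan m v X P"
  by (induction rule: tspan.induct) (auto simp: add.assoc intro: tspan.intros)

lemma tspan_scale: "y \<in> tspan m v X P \<Longrightarrow> k \<in> coeff_ring v \<Longrightarrow> k * y \<in> tspan m v X P"
proof (induction rule: tspan.induct)
  case (step c k' y)
  then have "(k * k') * X c + k * y \<in> tspan m v X P"
    by (intro tspan.step) (auto simp: coeff_ring_closed)
  then show ?case by (simp add: distrib_left mult.assoc)
qed (simp add: tspan.zero)

lemma tspan_powi_scale: "y \<in> tspan m v X P \<Longrightarrow> v powi z * y \<in> tspan m v X P"
  by (erule tspan_scale) (rule coeff_ring_closed(8))

lemma tspan_neg: "y \<in> tspan m v X P \<Longrightarrow> - y \<in> tspan m v X P"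
  using tspan_scale[of y m v X P "- 1"] by (simp add: coeff_ring_closed)

lemma tspan_diff: "y \<in> tspan m v X P \<Longrightarrow> z \<in> tspan m v X P \<Longrightarrow> y - z \<in> tspan m v X P"
  using tspan_add[OF _ tspan_neg] by (metis diff_conv_add_uminus)

lemma tspan_sum: "(\<And>i. i \<in> I \<Longrightarrow> f i \<in> tspan m v X P) \<Longrightarrow> sum f I \<in> tspan m v X P"
  by (induction I rule: infinite_finite_induct) (auto intro: tspan_add tspan.zero)

lemma tspan_subset:
  assumes "\<And>c. vec_on m c \<Longrightarrow> P c \<Longrightarrow> X c \<in> tspan m v Y Q"
  shows "tspan m v X P \<subseteq> tspan m v Y Q"
proof
  fix y assume "y \<in> tspan m v X P"
  then show "y \<in> tspan m v Y Q"
    by induction (auto intro: tspan_add tspan_scale assms tspan.zero)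
qed

lemma tspan_mono: "y \<in> tspan m v X P \<Longrightarrow> (\<And>c. vec_on m c \<Longrightarrow> P c \<Longrightarrow> Q c) \<Longrightarrow> y \<in> tspan m v X Q"
  using tspan_subset[of m P X v X Q] tspan_monom by blast

lemma tspan_subset_subring:
  assumes "y \<in> tspan m v X P" "v \<in> subring_gen S" "inverse v \<in> subring_gen S"
    and "\<And>c. vec_on m c \<Longrightarrow> P c \<Longrightarrow> X c \<in> subring_gen S"
  shows "y \<in> subring_gen S"
proof -
  have "coeff_ring v \<subseteq> subring_gen S"
    unfolding coeff_ring_def using assms(2,3) by (intro subring_gen_least) auto
  with assms(1) show ?thesis
    by (induction rule: tspan.induct) (use assms(4) in \<open>auto intro: subring_gen.intros subring_gen_zero\<close>)
qed

lemma tspan_split: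
  assumes "y \<in> tspan m v X P"
  obtains y1 y2 where "y = y1 + y2" "y1 \<in> tspan m v X (\<lambda>c. P c \<and> Q c)"
    "y2 \<in> tspan m v X (\<lambda>c. P c \<and> \<not> Q c)"
proof -
  have "\<exists>y1 y2. y = y1 + y2 \<and> y1 \<in> tspan m v X (\<lambda>c. P c \<and> Q c) \<and>
    y2 \<in> tspan m v X (\<lambda>c. P c \<and> \<not> Q c)"
    using assms
  proof induction
    case zero
    show ?case by (rule exI[of _ 0], rule exI[of _ 0]) (simp add: tspan.zero)
  next
    case (step c k y)
    then obtain y1 y2 where y: "y = y1 + y2" "y1 \<in> tspan m v X (\<lambda>c. P c \<and> Q c)"
      "y2 \<in> tspan m v X (\<lambda>c. P c \<and> \<not> Q c)" by blast
    show ?case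
    proof (cases "Q c")
      case True
      have "k * X c + y1 \<in> tspan m v X (\<lambda>c. P c \<and> Q c)"
        using step y True by (intro tspan.step) auto
      then show ?thesis using y
        by (intro exI[of _ "k * X c + y1"] exI[of _ y2]) (simp add: add.assoc)
    next
      case False
      have "k * X c + y2 \<in> tspan m v X (\<lambda>c. P c \<and> \<not> Q c)"
        using step y False by (intro tspan.step) auto
      then show ?thesis using y
        by (intro exI[of _ y1] exI[of _ "k * X c + y2"]) (simp add: add.left_commute)
    qed
  qed
  then show ?thesis using that by blast
qed

text \<open>Only finitely many exponents occur, so any integer function is bounded below on them;
  applied to a negated function this also gives upper bounds.\<close>

lemma tspan_lower_bound:
  fixes \<phi> :: "(nat \<Rightarrow> int) \<Rightarrow> int"
  assumes "y \<in> tspan m v X P"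
  obtains N :: nat where "y \<in> tspan m v X (\<lambda>c. P c \<and> - int N \<le> \<phi> c)"
proof -
  have "\<exists>N::nat. y \<in> tspan m v X (\<lambda>c. P c \<and> - int N \<le> \<phi> c)"
    using assms
  proof induction
    case zero
    show ?case by (auto intro: tspan.zero)
  next
    case (step c k y)
    then obtain N :: nat where N: "y \<in> tspan m v X (\<lambda>c. P c \<and> - int N \<le> \<phi> c)" by blast
    define M where "M = max N (nat (- \<phi> c))"
    have "y \<in> tspan m v X (\<lambda>c. P c \<and> - int M \<le> \<phi> c)"
      by (rule tspan_mono[OF N]) (auto simp: M_def)
    then have "k * X c + y \<in> tspan m v X (\<lambda>c. P c \<and> - int M \<le> \<phi> c)"
      using step by (intro tspan.step) (auto simp: M_def)
    then show ?case by blast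
  qed
  then show ?thesis using that by blast
qed

lemma tspan_finite_sum:
  assumes "y \<in> tspan m v X P"
  obtains S k where "finite S" "\<And>c. c \<in> S \<Longrightarrow> vec_on m c \<and> P c \<and> k c \<in> coeff_ring v"
    "y = (\<Sum>c\<in>S. k c * X c)"
proof -
  have "\<exists>S k. finite S \<and> (\<forall>c\<in>S. vec_on m c \<and> P c \<and> k c \<in> coeff_ring v) \<and> y = (\<Sum>c\<in>S. k c * X c)"
    using assms
  proof induction
    case zero
    show ?case by (rule exI[of _ "{}"]) simp
  next
    case (step c0 k0 y)
    then obtain S k where S: "finite S" "\<forall>c\<in>S. vec_on m c \<and> P c \<and> k c \<in> coeff_ring v"
      "y = (\<Sum>c\<in>S. k c * X c)" by blast
    define k' where "k' c = (if c \<in> S then k c else 0) + (if c = c0 then k0 else 0)" for c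
    have "(\<Sum>c\<in>insert c0 S. k' c * X c) = (\<Sum>c\<in>insert c0 S. (if c \<in> S then k c * X c else 0)) +
        (\<Sum>c\<in>insert c0 S. (if c = c0 then k0 * X c else 0))"
      unfolding k'_def by (subst sum.distrib[symmetric]) (intro sum.cong refl, auto simp: distrib_right)
    also have "(\<Sum>c\<in>insert c0 S. (if c \<in> S then k c * X c else 0)) = (\<Sum>c\<in>S. k c * X c)"
      using S(1) by (intro sum.mono_neutral_cong_right) auto
    also have "(\<Sum>c\<in>insert c0 S. (if c = c0 then k0 * X c else 0)) = k0 * X c0"
      using S(1) by simp
    finally have "k0 * X c0 + y = (\<Sum>c\<in>insert c0 S. k' c * X c)" by (simp add: S(3) add.commute)
    moreover have "finite (insert c0 S)" using S by simp
    moreover have "\<forall>c\<in>insert c0 S. vec_on m c \<and> P c \<and> k' c \<in> coeff_ring v"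
      using S step by (auto simp: k'_def coeff_ring_closed)
    ultimately show ?case by blast
  qed
  then show ?thesis using that by blast
qed

section \<open>Quantum tori and lowest components\<close>

locale central_unit =
  fixes v :: "'a::division_ring"
  assumes v_nz: "v \<noteq> 0" and v_central: "v * y = y * v"
begin

lemma coeff_commute: "k \<in> coeff_ring v \<Longrightarrow> k * y = y * k"
  unfolding coeff_ring_def
proof (rule subring_gen_commute)
  fix s assume "s \<in> {v, inverse v}"
  moreover have "inverse v * y = y * inverse v"
  proof -
    have "y * inverse v = inverse v * (v * y) * inverse v"
      using v_nz by (simp add: mult.assoc[symmetric])
    also have "\<dots> = inverse v * y"
      using v_nz by (simp add: v_central mult.assoc)
    finally show ?thesis by simp
  qed
  ultimately show "s * y = y * s" using v_central by auto
qed

lemma powi_commute: "v powi z * y = y * v powi z"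
  by (rule coeff_commute) (rule coeff_ring_closed)

lemma powi_left_commute: "y * (v powi z * w) = v powi z * (y * w)"
  by (metis mult.assoc powi_commute)

lemma powi_add: "v powi a * v powi b = v powi (a + b)"
  using v_nz by (simp add: power_int_add)

lemma powi_mult: "(v powi a * y) * (v powi b * z) = v powi (a + b) * (y * z)"
  by (metis mult.assoc powi_add powi_commute)

lemma powi_add_left: "v powi a * (v powi b * y) = v powi (a + b) * y"
  by (simp add: powi_add mult.assoc[symmetric])

end

text \<open>The product rule is required for all exponents but independence only for those supported
  on \<open>{1..m}\<close>: a toric frame ignores the other coordinates, so distinct vectors may
  give the same element.\<close>

locale qtorus = central_unit v for v :: "'a::division_ring" +
  fixes m :: nat and L :: "nat \<Rightarrow> nat \<Rightarrow> int" and X :: "(nat \<Rightarrow> int) \<Rightarrow> 'a"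
  assumes X_mult: "X c * X e = v powi bform m L c e * X (c + e)"
    and skew: "a \<in> {1..m} \<Longrightarrow> b \<in> {1..m} \<Longrightarrow> L a b = - L b a"
    and X_indep: "finite S \<Longrightarrow> (\<And>c. c \<in> S \<Longrightarrow> vec_on m c \<and> k c \<in> coeff_ring v) \<Longrightarrow>
      (\<Sum>c\<in>S. k c * X c) = 0 \<Longrightarrow> c \<in> S \<Longrightarrow> k c = 0"
begin

lemma form_skew: "bform m L b a = - bform m L a b"
  by (rule bform_skew) (rule skew)

lemma form_self: "bform m L a a = 0"
  using form_skew[of a a] by simp

lemma X_nonzero_on: "vec_on m c \<Longrightarrow> X c \<noteq> 0"
  using X_indep[of "{c}" "\<lambda>_. 1" c] by (auto simp: coeff_ring_closed)

lemma X_zero: "X 0 = 1"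
  using X_mult[of 0 0] X_nonzero_on[of 0] by (simp add: bform_linear)

lemma X_inverse: "X c * X (- c) = 1"
  using X_mult[of c "- c"] by (simp add: bform_linear form_self X_zero)

lemma X_nonzero: "X c \<noteq> 0"
  using X_inverse[of c] by auto

lemma X_add: "X (c + e) = v powi (- bform m L c e) * (X c * X e)"
  by (simp add: X_mult powi_add_left)

lemma X_commute: "X c * X e = v powi (2 * bform m L c e) * (X e * X c)"
  by (simp add: X_mult powi_add_left form_skew[of c e] add.commute)

lemma X_power: "X c ^ n = X (smul (int n) c)"
proof (induction n)
  case 0
  have "smul 0 c = 0" by (auto simp: vec_apply)
  then show ?case by (simp add: X_zero)
next
  case (Suc n)
  have "smul (int (Suc n)) c = c + smul (int n) c"
    by (auto simp: vec_apply algebra_simps)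
  then show ?case using X_mult[of c "smul (int n) c"] by (simp add: Suc bform_linear form_self)
qed

lemma tspan_mult:
  assumes "y \<in> tspan m v X P" "z \<in> tspan m v X Q"
    and "\<And>c e. vec_on m c \<Longrightarrow> vec_on m e \<Longrightarrow> P c \<Longrightarrow> Q e \<Longrightarrow> R (c + e)"
  shows "y * z \<in> tspan m v X R"
  using assms(1)
proof induction
  case (step c k y)
  have "X c * z \<in> tspan m v X R"
    using assms(2)
  proof induction
    case (step e k' z)
    have "X c * (k' * X e) = k' * v powi bform m L c e * X (c + e)"
      using coeff_commute[OF \<open>k' \<in> _\<close>] by (metis X_mult mult.assoc)
    moreover have "k' * v powi bform m L c e * X (c + e) \<in> tspan m v X R"
      using step \<open>vec_on m c\<close> \<open>P c\<close> by (intro tspan_scaled_monom) (auto simp: coeff_ring_closed assms(3))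
    ultimately show ?case using step by (auto simp: distrib_left intro: tspan_add)
  qed (simp add: tspan.zero)
  then show ?case using step by (auto simp: distrib_right mult.assoc intro: tspan_add tspan_scale)
qed (simp add: tspan.zero)

lemma tspan_one: "P 0 \<Longrightarrow> 1 \<in> tspan m v X P"
  using tspan_monom[of m 0 P X v] by (simp add: X_zero)

text \<open>Two expansions of \<open>y\<close> are subtracted. By independence their coefficients
  agree, so an exponent missing from the second has coefficient 0 in the first.\<close>

lemma tspan_inter:
  assumes "y \<in> tspan m v X P" "y \<in> tspan m v X Q"
  shows "y \<in> tspan m v X (\<lambda>c. P c \<and> Q c)"
proof -
  obtain S k where S: "finite S" "\<And>c. c \<in> S \<Longrightarrow> vec_on m c \<and> P c \<and> k c \<in> coeff_ring v"
    "y = (\<Sum>c\<in>S. k c * X c)" using tspan_finite_sum[OF assms(1)] by metis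
  obtain S' k' where S': "finite S'" "\<And>c. c \<in> S' \<Longrightarrow> vec_on m c \<and> Q c \<and> k' c \<in> coeff_ring v"
    "y = (\<Sum>c\<in>S'. k' c * X c)" using tspan_finite_sum[OF assms(2)] by metis
  define j where "j c = (if c \<in> S then k c else 0) - (if c \<in> S' then k' c else 0)" for c
  have "(\<Sum>c\<in>S \<union> S'. j c * X c) = (\<Sum>c\<in>S \<union> S'. (if c \<in> S then k c * X c else 0)) -
      (\<Sum>c\<in>S \<union> S'. (if c \<in> S' then k' c * X c else 0))"
    unfolding j_def by (subst sum_subtractf[symmetric]) (intro sum.cong refl, auto simp: left_diff_distrib)
  also have "(\<Sum>c\<in>S \<union> S'. (if c \<in> S then k c * X c else 0)) = y"
    unfolding S(3) using S(1) S'(1) by (intro sum.mono_neutral_cong_right) auto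
  also have "(\<Sum>c\<in>S \<union> S'. (if c \<in> S' then k' c * X c else 0)) = y"
    unfolding S'(3) using S(1) S'(1) by (intro sum.mono_neutral_cong_right) auto
  finally have "(\<Sum>c\<in>S \<union> S'. j c * X c) = 0" by simp
  moreover have "vec_on m c \<and> j c \<in> coeff_ring v" if "c \<in> S \<union> S'" for c
    using that S(2)[of c] S'(2)[of c] by (auto simp: j_def coeff_ring_closed)
  ultimately have j0: "j c = 0" if "c \<in> S \<union> S'" for c
    using X_indep[of "S \<union> S'" j c] S(1) S'(1) that by blast
  have "k c * X c \<in> tspan m v X (\<lambda>c. P c \<and> Q c)" if "c \<in> S" for c
  proof (cases "c \<in> S'")
    case True
    then show ?thesis using S(2)[OF that] S'(2)[of c] by (intro tspan_scaled_monom) auto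
  next
    case False
    then have "k c = 0" using j0[of c] that by (simp add: j_def)
    then show ?thesis by (simp add: tspan.zero)
  qed
  then show ?thesis unfolding S(3) by (rule tspan_sum)
qed

text \<open>The device by which a component is shown to vanish: it is computed once in its own
  degree and once from the remaining terms, which lie in other degrees.\<close>

lemma tspan_disjoint:
  assumes "y \<in> tspan m v X P" "y \<in> tspan m v X Q" "\<And>c. P c \<Longrightarrow> Q c \<Longrightarrow> False"
  shows "y = 0"
proof -
  have "y \<in> tspan m v X (\<lambda>c. P c \<and> Q c)" using assms(1,2) by (rule tspan_inter)
  then show ?thesis by cases (use assms(3) in auto)
qed

text \<open>Only the initial form \<open>u0\<close> of the right factor matters: the lowest component of \<open>p * u\<close> is the
  product of the lowest components.\<close>

lemma tspan_cancel_right: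
  fixes \<phi> :: "(nat \<Rightarrow> int) \<Rightarrow> int"
  assumes \<phi>: "\<And>c e. \<phi> (c + e) = \<phi> c + \<phi> e"
    and p: "p \<in> tspan m v X Q"
    and u0: "u0 \<in> tspan m v X (\<lambda>c. \<phi> c = \<gamma>)" "u0 \<noteq> 0"
    and u1: "u1 \<in> tspan m v X (\<lambda>c. \<phi> c > \<gamma>)"
    and pu: "p * (u0 + u1) \<in> tspan m v X (\<lambda>c. \<phi> c \<ge> \<gamma> + k)"
  shows "p \<in> tspan m v X (\<lambda>c. Q c \<and> \<phi> c \<ge> k)"
proof -
  obtain N :: nat where N: "p \<in> tspan m v X (\<lambda>c. Q c \<and> - int N \<le> \<phi> c)"
    using tspan_lower_bound[OF p] by blast
  \<comment> \<open>From the crude bound \<open>- N\<close> the lower bound for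
    \<open>\<phi>\<close> on \<open>p\<close> is raised one unit at a time; the minimum with
    \<open>k\<close> stops it there.\<close>
  have "p \<in> tspan m v X (\<lambda>c. Q c \<and> min k (- int N + int j) \<le> \<phi> c)" for j :: nat
  proof (induction j)
    case 0
    show ?case by (rule tspan_mono[OF N]) auto
  next
    case (Suc j)
    define l where "l = - int N + int j"
    show ?case
    proof (cases "l < k")
      case False
      then show ?thesis by (intro tspan_mono[OF Suc]) (auto simp: l_def)
    next
      case True
      have "p \<in> tspan m v X (\<lambda>c. Q c \<and> l \<le> \<phi> c)"
        using Suc True by (simp add: l_def min_def)
      then obtain p0 p1 where p01: "p = p0 + p1"
        "p0 \<in> tspan m v X (\<lambda>c. (Q c \<and> l \<le> \<phi> c) \<and> \<phi> c = l)"
        "p1 \<in> tspan m v X (\<lambda>c. (Q c \<and> l \<le> \<phi> c) \<and> \<not> \<phi> c = l)"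
        by (rule tspan_split)
      have "p0 * u0 \<in> tspan m v X (\<lambda>c. \<phi> c = l + \<gamma>)"
        by (rule tspan_mult[OF p01(2) u0(1)]) (auto simp: \<phi>)
      \<comment> \<open>The product \<open>p * (u0 + u1)\<close> and all contributions to it other
        than \<open>p0 * u0\<close> lie strictly above \<open>l + \<gamma>\<close>.\<close>
      moreover have "p0 * u0 \<in> tspan m v X (\<lambda>c. \<phi> c > l + \<gamma>)"
      proof -
        have "p * (u0 + u1) \<in> tspan m v X (\<lambda>c. \<phi> c > l + \<gamma>)"
          by (rule tspan_mono[OF pu]) (use True in auto)
        moreover have "p1 * u0 \<in> tspan m v X (\<lambda>c. \<phi> c > l + \<gamma>)"
          by (rule tspan_mult[OF p01(3) u0(1)]) (auto simp: \<phi>)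
        moreover have "p * u1 \<in> tspan m v X (\<lambda>c. \<phi> c > l + \<gamma>)"
          by (rule tspan_mult[OF \<open>p \<in> tspan m v X (\<lambda>c. Q c \<and> l \<le> \<phi> c)\<close> u1]) (auto simp: \<phi>)
        moreover have "p0 * u0 = p * (u0 + u1) - p1 * u0 - p * u1"
          by (simp add: p01(1) algebra_simps)
        ultimately show ?thesis by (auto intro: tspan_diff)
      qed
      ultimately have "p0 * u0 = 0" by (rule tspan_disjoint) auto
      then have "p = p1" using u0(2) p01(1) by simp
      moreover have "p1 \<in> tspan m v X (\<lambda>c. Q c \<and> min k (- int N + int (Suc j)) \<le> \<phi> c)"
        by (rule tspan_mono[OF p01(3)]) (auto simp: l_def)
      ultimately show ?thesis by simp
    qed
  qed
  from this[of "nat (k + int N)"] show ?thesis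
    by (rule tspan_mono) auto
qed

text \<open>With \<open>d\<close> the difference of the \<open>n\<close>-th powers, the next
  difference is \<open>u0 * d + u1 * d + u1 * u0 ^ n\<close>, and each summand lies strictly above
  the lowest degree.\<close>

lemma tspan_power_leading:
  fixes \<phi> :: "(nat \<Rightarrow> int) \<Rightarrow> int"
  assumes \<phi>: "\<And>c e. \<phi> (c + e) = \<phi> c + \<phi> e"
    and u0: "u0 \<in> tspan m v X (\<lambda>c. \<phi> c = \<gamma>)" and u1: "u1 \<in> tspan m v X (\<lambda>c. \<phi> c > \<gamma>)"
  shows "u0 ^ n \<in> tspan m v X (\<lambda>c. \<phi> c = int n * \<gamma>)"
    and "(u0 + u1) ^ n - u0 ^ n \<in> tspan m v X (\<lambda>c. \<phi> c > int n * \<gamma>)"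
proof -
  have \<phi>0: "\<phi> 0 = 0" using \<phi>[of 0 0] by simp
  show A: "u0 ^ n \<in> tspan m v X (\<lambda>c. \<phi> c = int n * \<gamma>)" for n
  proof (induction n)
    case (Suc n)
    show ?case unfolding power_Suc by (rule tspan_mult[OF u0 Suc]) (auto simp: \<phi> algebra_simps)
  qed (auto intro: tspan_one simp: \<phi>0)
  show "(u0 + u1) ^ n - u0 ^ n \<in> tspan m v X (\<lambda>c. \<phi> c > int n * \<gamma>)"
  proof (induction n)
    case (Suc n)
    let ?d = "(u0 + u1) ^ n - u0 ^ n"
    have "(u0 + u1) ^ Suc n - u0 ^ Suc n = u0 * ?d + u1 * ?d + u1 * u0 ^ n"
      by (simp add: algebra_simps)
    moreover have "u0 * ?d \<in> tspan m v X (\<lambda>c. \<phi> c > int (Suc n) * \<gamma>)"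
      by (rule tspan_mult[OF u0 Suc]) (auto simp: \<phi> algebra_simps)
    moreover have "u1 * ?d \<in> tspan m v X (\<lambda>c. \<phi> c > int (Suc n) * \<gamma>)"
      by (rule tspan_mult[OF u1 Suc]) (auto simp: \<phi> algebra_simps)
    moreover have "u1 * u0 ^ n \<in> tspan m v X (\<lambda>c. \<phi> c > int (Suc n) * \<gamma>)"
      by (rule tspan_mult[OF u1 A]) (auto simp: \<phi> algebra_simps)
    ultimately show ?case by (auto intro: tspan_add)
  qed (simp add: tspan.zero)
qed

end

section \<open>Exchange relations between two quantum tori\<close>

abbreviation laurent :: "nat \<Rightarrow> 'a::division_ring \<Rightarrow> ((nat \<Rightarrow> int) \<Rightarrow> 'a) \<Rightarrow> 'a set" where
  "laurent m v X \<equiv> tspan m v X (\<lambda>_. True)"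

lemma tspan_laurent: "y \<in> tspan m v X P \<Longrightarrow> y \<in> laurent m v X"
  by (rule tspan_mono) auto

lemma (in qtorus) laurent_mult: "y \<in> laurent m v X \<Longrightarrow> z \<in> laurent m v X \<Longrightarrow> y * z \<in> laurent m v X"
  by (rule tspan_mult) auto

lemma (in qtorus) laurent_power: "y \<in> laurent m v X \<Longrightarrow> y ^ n \<in> laurent m v X"
  by (induction n) (auto intro: laurent_mult tspan_one)

definition proj :: "nat \<Rightarrow> (nat \<Rightarrow> int) \<Rightarrow> nat \<Rightarrow> int" where
  "proj i c = c(i := 0)"

lemma proj_apply: "proj i c j = (if j = i then 0 else c j)"
  by (simp add: proj_def)

lemma proj_vec_on [simp, intro]: "vec_on m c \<Longrightarrow> vec_on m (proj i c)"
  by (auto simp: vec_on_def proj_def)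

lemma proj_decomp: "c = proj i c + smul (c i) (unitv i)"
  by (auto simp: vec_apply proj_def unitv_def)

text \<open>With \<open>w0 = d[-\<beta>]\<^sub>+\<close> and \<open>bt = \<beta>\<close> the exponent \<open>r[\<beta>]\<^sub>+ + (d-r)[-\<beta>]\<^sub>+ - e\<^sub>i\<close> of an exchange relation is
  \<open>w0 + r bt - e\<^sub>i\<close>. The coefficients being symmetric, the relation has the same form in both directions.\<close>

locale edge = A: qtorus v m L X + B: qtorus v m L' X'
  for v :: "'a::division_ring" and m L X L' X' +
  fixes i :: nat and w0 bt :: "nat \<Rightarrow> int" and D :: nat and h :: "nat \<Rightarrow> 'a"
  assumes i_in: "i \<in> {1..m}"
    and w0_vec: "vec_on m w0" and bt_vec: "vec_on m bt" and w0_i: "w0 i = 0" and bt_i: "bt i = 0"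
    and h_coeff: "r \<le> D \<Longrightarrow> h r \<in> coeff_ring v" and h_first: "h 0 = 1" and h_last: "h D = 1"
    and w_nonneg: "r \<le> D \<Longrightarrow> 0 \<le> w0 j + int r * bt j"
    and X'_i: "X' (unitv i) = (\<Sum>r\<in>{0..D}. h r * X (w0 + smul (int r) bt - unitv i))"
    and X_i: "X (unitv i) = (\<Sum>r\<in>{0..D}. h r * X' (w0 + smul (int r) bt - unitv i))"
    and same: "c i = 0 \<Longrightarrow> X' c = X c"

text \<open>Every expansion of \<open>X'\<close> in \<open>X\<close> obtained below is thereby also
  available from \<open>X\<close> to \<open>X'\<close>.\<close>

lemma edge_sym:
  assumes "edge v m L X L' X' i w0 bt D h" shows "edge v m L' X' L X i w0 bt D h"
proof -
  interpret edge v m L X L' X' i w0 bt D h by (rule assms)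
  show ?thesis
    by unfold_locales
      (fact i_in w0_vec bt_vec w0_i bt_i h_coeff h_first h_last X_i X'_i w_nonneg | simp add: same)+
qed

context edge
begin

abbreviation "w \<equiv> (\<lambda>r. w0 + smul (int r) bt)"

lemma w_i: "w r i = 0"
  by (simp add: vec_apply w0_i bt_i)

lemma w_vec [simp, intro]: "vec_on m (w r - unitv i)"
  using w0_vec bt_vec i_in by auto

lemma X'_i_tspan: "(\<And>r. r \<le> D \<Longrightarrow> P (w r - unitv i)) \<Longrightarrow> X' (unitv i) \<in> tspan m v X P"
  unfolding X'_i by (intro tspan_sum tspan_scaled_monom) (auto intro: h_coeff)

lemma X'_decomp:
  assumes "c i \<ge> 0"
  shows "X' c = v powi (- bform m L' (proj i c) (smul (c i) (unitv i))) *
    (X (proj i c) * X' (unitv i) ^ nat (c i))"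
proof -
  have "X' (unitv i) ^ nat (c i) = X' (smul (c i) (unitv i))"
    using assms by (simp add: B.X_power)
  moreover have "X (proj i c) = X' (proj i c)"
    by (simp add: same proj_def)
  ultimately show ?thesis
    using B.X_add[of "proj i c" "smul (c i) (unitv i)"] by (simp add: proj_decomp[symmetric])
qed

text \<open>\<open>R n\<close> has to contain the exponents reached after \<open>n\<close> factors
  \<open>X' (unitv i)\<close>: the part \<open>proj i c\<close> is a monomial of both tori, and each
  factor adds one of the vectors \<open>w r - unitv i\<close>.\<close>

lemma X'_tspan_general:
  assumes c: "vec_on m c" "c i \<ge> 0" and R0: "R 0 (proj i c)"
    and R: "\<And>n a r. R n a \<Longrightarrow> r \<le> D \<Longrightarrow> R (Suc n) (a + (w r - unitv i))"
  shows "X' c \<in> tspan m v X (R (nat (c i)))"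
proof -
  have "X (proj i c) * X' (unitv i) ^ n \<in> tspan m v X (R n)" for n
  proof (induction n)
    case 0
    show ?case using c R0 by (auto intro: tspan_monom)
  next
    case (Suc n)
    have "X (proj i c) * X' (unitv i) ^ n * X' (unitv i) \<in> tspan m v X (R (Suc n))"
      by (rule A.tspan_mult[OF Suc X'_i_tspan[of "\<lambda>e. \<exists>r\<le>D. e = w r - unitv i"]]) (auto intro: R)
    then show ?case by (simp only: power_Suc2 mult.assoc)
  qed
  then show ?thesis
    unfolding X'_decomp[of c, OF c(2)] by (rule tspan_scale) (rule coeff_ring_closed)
qed

text \<open>By \<open>w_nonneg\<close> a factor \<open>X' (unitv i)\<close> lowers the
  \<open>i\<close>-th exponent by one and lowers no other exponent.\<close>

lemma X'_tspan:
  assumes c: "vec_on m c" "c i \<ge> 0"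
  shows "X' c \<in> tspan m v X (\<lambda>e. e i = - c i \<and> (\<forall>j. j \<noteq> i \<longrightarrow> c j \<le> e j))"
proof -
  have "X' c \<in> tspan m v X (\<lambda>e. e i = - int (nat (c i)) \<and> (\<forall>j. j \<noteq> i \<longrightarrow> c j \<le> e j))"
  proof (rule X'_tspan_general[OF c])
    fix n a r
    assume a: "a i = - int n \<and> (\<forall>j. j \<noteq> i \<longrightarrow> c j \<le> a j)" and r: "r \<le> D"
    show "(a + (w r - unitv i)) i = - int (Suc n) \<and> (\<forall>j. j \<noteq> i \<longrightarrow> c j \<le> (a + (w r - unitv i)) j)"
    proof (intro conjI allI impI)
      show "(a + (w r - unitv i)) i = - int (Suc n)"
        using a w_i[of r] by (simp add: vec_apply)
      fix j assume "j \<noteq> i"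
      then show "c j \<le> (a + (w r - unitv i)) j"
        using a w_nonneg[OF r, of j] by (auto simp: vec_apply unitv_other intro: add_increasing2)
    qed
  qed (auto simp: proj_apply)
  then show ?thesis using c by simp
qed

lemma X'_laurent: "vec_on m c \<Longrightarrow> c i \<ge> 0 \<Longrightarrow> X' c \<in> laurent m v X"
  using X'_tspan tspan_laurent by blast

lemma tspan_X'_laurent: "y \<in> tspan m v X' P \<Longrightarrow> (\<And>c. P c \<Longrightarrow> c i \<ge> 0) \<Longrightarrow> y \<in> laurent m v X"
  using tspan_subset[of m P X' v X "\<lambda>_. True"] X'_laurent by blast

text \<open>Following Berenstein, Fomin and Zelevinsky: an element of two adjacent Laurent rings is
  a sum of monomials in which the old or the new \<open>i\<close>-th variable has a nonnegative
  exponent. The part of \<open>y\<close> with negative exponents in \<open>X'\<close>, cleared by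
  \<open>?u ^ N\<close>, has degree at most \<open>N - 1\<close> in the new variable and hence at
  least \<open>1 - N\<close> in the old one; cancelling \<open>?u ^ N\<close>, of degree
  \<open>- N\<close>, leaves degree at least 1.\<close>

lemma laurent_both:
  assumes "y \<in> laurent m v X" "y \<in> laurent m v X'"
  obtains y1 y2 where "y = y1 + y2" "y1 \<in> tspan m v X (\<lambda>c. c i \<ge> 1)" "y2 \<in> tspan m v X' (\<lambda>c. c i \<ge> 0)"
proof -
  let ?u = "X' (unitv i)"
  obtain y2 y1 where y: "y = y2 + y1" "y2 \<in> tspan m v X' (\<lambda>c. True \<and> c i \<ge> 0)"
    "y1 \<in> tspan m v X' (\<lambda>c. True \<and> \<not> c i \<ge> 0)" by (rule tspan_split[OF assms(2)])
  have "y2 \<in> laurent m v X" by (rule tspan_X'_laurent[OF y(2)]) auto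
  then have y1: "y1 \<in> laurent m v X"
    using tspan_diff[OF assms(1)] y(1) by (metis add_diff_cancel_left')
  obtain N :: nat where N: "y1 \<in> tspan m v X' (\<lambda>c. (True \<and> \<not> c i \<ge> 0) \<and> - int N \<le> c i)"
    by (rule tspan_lower_bound[OF y(3), where \<phi> = "\<lambda>c. c i"])
  have u': "?u ^ N \<in> tspan m v X' (\<lambda>c. c i = int N)"
    unfolding B.X_power using i_in by (intro tspan_monom vec_on_closed) (simp_all add: vec_apply)
  have "?u ^ N \<in> tspan m v X (\<lambda>c. c i = int N * -1)"
    by (rule A.tspan_power_leading(1)[where \<phi> = "\<lambda>c. c i" and ?u1.0 = 0])
      (auto intro!: X'_i_tspan tspan.zero simp: vec_apply w0_i bt_i)
  then have u: "?u ^ N \<in> tspan m v X (\<lambda>c. c i = - int N)" by simp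
  have "y1 * ?u ^ N \<in> tspan m v X' (\<lambda>c. 0 \<le> c i \<and> c i \<le> int N - 1)"
    by (rule B.tspan_mult[OF N u']) (auto simp: vec_apply)
  then have "y1 * ?u ^ N \<in> tspan m v X (\<lambda>c. c i \<ge> - int N + 1)"
    by (rule subsetD[OF tspan_subset, rotated]) (auto intro: tspan_mono[OF X'_tspan])
  then have "y1 \<in> tspan m v X (\<lambda>c. True \<and> c i \<ge> 1)"
    using A.tspan_cancel_right[where \<phi> = "\<lambda>c. c i", OF _ y1 u, of 0 1]
    by (auto simp: vec_apply B.X_nonzero tspan.zero)
  then show ?thesis using that[of y1 y2] y by (simp add: add.commute)
qed

text \<open>In the splitting of \<open>laurent_both\<close> only the terms with positive
  \<open>i\<close>-th exponent in \<open>X'\<close> have negative degree in \<open>X\<close>; all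
  the others have degree at least 0, so their sum vanishes.\<close>

lemma laurent_both_negative:
  assumes "y \<in> tspan m v X (\<lambda>c. c i < 0)" "y \<in> laurent m v X'"
  shows "y \<in> tspan m v X' (\<lambda>c. c i \<ge> 1)"
proof -
  obtain y1 y2 where y: "y = y1 + y2" "y1 \<in> tspan m v X (\<lambda>c. c i \<ge> 1)"
    "y2 \<in> tspan m v X' (\<lambda>c. c i \<ge> 0)"
    using laurent_both[OF tspan_laurent[OF assms(1)] assms(2)] by blast
  obtain a b where ab: "y2 = a + b" "a \<in> tspan m v X' (\<lambda>c. c i \<ge> 0 \<and> c i \<ge> 1)"
    "b \<in> tspan m v X' (\<lambda>c. c i \<ge> 0 \<and> \<not> c i \<ge> 1)" by (rule tspan_split[OF y(3)])
  have a: "a \<in> tspan m v X (\<lambda>c. c i < 0)"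
    by (rule subsetD[OF tspan_subset ab(2)]) (auto intro: tspan_mono[OF X'_tspan])
  have b: "b \<in> tspan m v X (\<lambda>c. c i \<ge> 0)"
    by (rule subsetD[OF tspan_subset ab(3)]) (auto intro: tspan_mono[OF X'_tspan])
  have "y - a = 0"
  proof (rule A.tspan_disjoint)
    show "y - a \<in> tspan m v X (\<lambda>c. c i < 0)" using assms(1) a by (rule tspan_diff)
    have "y1 + b \<in> tspan m v X (\<lambda>c. c i \<ge> 0)"
      using tspan_mono[OF y(2), of "\<lambda>c. c i \<ge> 0"] b by (intro tspan_add) auto
    then show "y - a \<in> tspan m v X (\<lambda>c. c i \<ge> 0)" using y(1) ab(1) by (simp add: algebra_simps)
  qed auto
  then show ?thesis using tspan_mono[OF ab(2)] by simp
qed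

text \<open>By \<open>laurent_both\<close> a common element is a sum of monomials of the two tori,
  and by \<open>hom\<close> each of them lies on one side of \<open>Q\<close>. The part on the side
  of \<open>Q\<close> is thus again a sum of such monomials.\<close>

lemma laurent_component:
  assumes y: "s + t \<in> laurent m v X'" and s: "s \<in> tspan m v X Q" and t: "t \<in> tspan m v X (\<lambda>c. \<not> Q c)"
    and hom: "\<And>c. vec_on m c \<Longrightarrow> c i \<ge> 0 \<Longrightarrow> X' c \<in> tspan m v X Q \<or> X' c \<in> tspan m v X (\<lambda>c. \<not> Q c)"
  shows "s \<in> laurent m v X'"
proof -
  interpret S: edge v m L' X' L X i w0 bt D h by (rule edge_sym) unfold_locales
  have "s + t \<in> laurent m v X" using s t by (blast intro: tspan_add tspan_laurent)
  then obtain y1 y2 where y12: "s + t = y1 + y2" "y1 \<in> tspan m v X (\<lambda>c. c i \<ge> 1)"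
    "y2 \<in> tspan m v X' (\<lambda>c. c i \<ge> 0)"
    using laurent_both[OF _ y] by blast
  obtain a b where ab: "y1 = a + b" "a \<in> tspan m v X (\<lambda>c. c i \<ge> 1 \<and> Q c)"
    "b \<in> tspan m v X (\<lambda>c. c i \<ge> 1 \<and> \<not> Q c)" by (rule tspan_split[OF y12(2)])
  let ?Q' = "\<lambda>c. X' c \<in> tspan m v X Q"
  obtain a' b' where ab': "y2 = a' + b'" "a' \<in> tspan m v X' (\<lambda>c. c i \<ge> 0 \<and> ?Q' c)"
    "b' \<in> tspan m v X' (\<lambda>c. c i \<ge> 0 \<and> \<not> ?Q' c)" by (rule tspan_split[OF y12(3)])
  have a': "a' \<in> tspan m v X Q"
    by (rule subsetD[OF tspan_subset ab'(2)]) auto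
  have b': "b' \<in> tspan m v X (\<lambda>c. \<not> Q c)"
    by (rule subsetD[OF tspan_subset ab'(3)]) (use hom in auto)
  have "s - a - a' = 0"
  proof (rule A.tspan_disjoint)
    show "s - a - a' \<in> tspan m v X Q"
      using s a' tspan_mono[OF ab(2), of Q] by (auto intro: tspan_diff)
    have "b + b' - t \<in> tspan m v X (\<lambda>c. \<not> Q c)"
      using t b' tspan_mono[OF ab(3), of "\<lambda>c. \<not> Q c"] by (auto intro: tspan_diff tspan_add)
    moreover have "b + b' - t = s - a - a'"
      using y12(1) ab(1) ab'(1) by (simp add: algebra_simps)
    ultimately show "s - a - a' \<in> tspan m v X (\<lambda>c. \<not> Q c)" by simp
  qed auto
  moreover have "a \<in> laurent m v X'"
    by (rule S.tspan_X'_laurent[OF ab(2)]) auto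
  moreover have "a' \<in> laurent m v X'" using ab'(2) by (rule tspan_laurent)
  ultimately show ?thesis
    using tspan_add[of a m v X' _ a'] by (simp add: algebra_simps)
qed

end

section \<open>Coprimality in a quantum torus\<close>

context qtorus
begin

text \<open>If \<open>f\<close> is homogeneous and quasi-commutes with \<open>g\<close>, whose initial form is invertible, then
  \<open>f\<close> and \<open>g\<close> are coprime; the quotient is found one component at a time, from the lowest one up.\<close>

lemma coprime_quotient_bounded:
  fixes \<phi> :: "(nat \<Rightarrow> int) \<Rightarrow> int"
  assumes \<phi>: "\<And>c e. \<phi> (c + e) = \<phi> c + \<phi> e"
    and f: "f \<in> tspan m v X (\<lambda>c. \<phi> c = \<gamma>')" "f \<noteq> 0"
    and g0: "g0 \<in> tspan m v X (\<lambda>c. \<phi> c = \<gamma>)" "g0 \<noteq> 0"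
    and g1: "g1 \<in> tspan m v X (\<lambda>c. \<phi> c > \<gamma>)"
    and fg: "f * (g0 + g1) = v powi z * ((g0 + g1) * f)"
    and PR: "\<And>s. s \<in> tspan m v X P \<Longrightarrow> s * inverse g0 \<in> tspan m v X R"
    and RP: "\<And>s. s \<in> tspan m v X R \<Longrightarrow> s * (g0 + g1) \<in> tspan m v X P"
    and "t \<in> tspan m v X (\<lambda>c. k \<le> \<phi> c \<and> \<phi> c < k + int N)"
    and "p \<in> tspan m v X P" and "t * (g0 + g1) = p * f"
  shows "\<exists>q\<in>tspan m v X R. t = q * f"
  using assms(10-12)
proof (induction N arbitrary: k t p)
  case 0
  have "t = 0" by (rule tspan_disjoint[OF 0(1) 0(1)]) auto
  then show ?case by (intro bexI[of _ 0]) (auto intro: tspan.zero)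
next
  case (Suc N)
  let ?g = "g0 + g1"
  have g: "?g \<in> tspan m v X (\<lambda>c. \<phi> c \<ge> \<gamma>)"
    using tspan_mono[OF g0(1), of "\<lambda>c. \<phi> c \<ge> \<gamma>"] tspan_mono[OF g1, of "\<lambda>c. \<phi> c \<ge> \<gamma>"]
    by (auto intro: tspan_add)
  \<comment> \<open>Comparison of lowest components in \<open>fg\<close> shows that \<open>f\<close>
    quasi-commutes already with the initial form \<open>g0\<close>.\<close>
  have commute: "f * g0 = v powi z * (g0 * f)"
  proof -
    have "f * g0 - v powi z * (g0 * f) = 0"
    proof (rule tspan_disjoint)
      have "f * g0 \<in> tspan m v X (\<lambda>c. \<phi> c = \<gamma> + \<gamma>')" "g0 * f \<in> tspan m v X (\<lambda>c. \<phi> c = \<gamma> + \<gamma>')"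
        by (rule tspan_mult[OF f(1) g0(1)] tspan_mult[OF g0(1) f(1)], simp add: \<phi>)+
      then show "f * g0 - v powi z * (g0 * f) \<in> tspan m v X (\<lambda>c. \<phi> c = \<gamma> + \<gamma>')"
        by (intro tspan_diff tspan_powi_scale)
      have "f * g1 \<in> tspan m v X (\<lambda>c. \<phi> c > \<gamma> + \<gamma>')" "g1 * f \<in> tspan m v X (\<lambda>c. \<phi> c > \<gamma> + \<gamma>')"
        by (rule tspan_mult[OF f(1) g1] tspan_mult[OF g1 f(1)], simp add: \<phi>)+
      then have "v powi z * (g1 * f) - f * g1 \<in> tspan m v X (\<lambda>c. \<phi> c > \<gamma> + \<gamma>')"
        by (intro tspan_diff tspan_powi_scale)
      moreover have "v powi z * (g1 * f) - f * g1 = f * g0 - v powi z * (g0 * f)"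
        using fg by (simp add: algebra_simps)
      ultimately show "f * g0 - v powi z * (g0 * f) \<in> tspan m v X (\<lambda>c. \<phi> c > \<gamma> + \<gamma>')" by simp
    qed auto
    then show ?thesis by simp
  qed
  have t_ge: "t \<in> tspan m v X (\<lambda>c. \<phi> c \<ge> k)" by (rule tspan_mono[OF Suc(2)]) auto
  have "t * ?g \<in> tspan m v X (\<lambda>c. \<phi> c \<ge> \<gamma>' + (k + \<gamma> - \<gamma>'))"
    by (rule tspan_mult[OF t_ge g]) (simp add: \<phi>)
  \<comment> \<open>As \<open>f\<close> is homogeneous it is its own initial form, so the lowest
    degree of \<open>p\<close> is controlled by that of \<open>t * ?g\<close>.\<close>
  then have p: "p \<in> tspan m v X (\<lambda>c. P c \<and> \<phi> c \<ge> k + \<gamma> - \<gamma>')"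
    using tspan_cancel_right[OF \<phi> Suc(3) f tspan.zero, of "k + \<gamma> - \<gamma>'"] Suc(4) by simp
  obtain t0 t1 where t: "t = t0 + t1"
    "t0 \<in> tspan m v X (\<lambda>c. (k \<le> \<phi> c \<and> \<phi> c < k + int (Suc N)) \<and> \<phi> c = k)"
    "t1 \<in> tspan m v X (\<lambda>c. (k \<le> \<phi> c \<and> \<phi> c < k + int (Suc N)) \<and> \<phi> c \<noteq> k)"
    by (rule tspan_split[OF Suc(2), of "\<lambda>c. \<phi> c = k"])
  obtain p0 p1 where p01: "p = p0 + p1"
    "p0 \<in> tspan m v X (\<lambda>c. (P c \<and> \<phi> c \<ge> k + \<gamma> - \<gamma>') \<and> \<phi> c = k + \<gamma> - \<gamma>')"
    "p1 \<in> tspan m v X (\<lambda>c. (P c \<and> \<phi> c \<ge> k + \<gamma> - \<gamma>') \<and> \<phi> c \<noteq> k + \<gamma> - \<gamma>')"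
    by (rule tspan_split[OF p, of "\<lambda>c. \<phi> c = k + \<gamma> - \<gamma>'"])
  have "p0 * f - t0 * g0 = 0"
  proof (rule tspan_disjoint)
    show "p0 * f - t0 * g0 \<in> tspan m v X (\<lambda>c. \<phi> c = k + \<gamma>)"
      by (rule tspan_diff, rule tspan_mult[OF p01(2) f(1)], simp add: \<phi>,
          rule tspan_mult[OF t(2) g0(1)], simp add: \<phi>)
    have "t0 * g1 + t1 * ?g - p1 * f \<in> tspan m v X (\<lambda>c. \<phi> c > k + \<gamma>)"
      by (rule tspan_diff, rule tspan_add, rule tspan_mult[OF t(2) g1], simp add: \<phi>,
          rule tspan_mult[OF t(3) g], simp add: \<phi>, rule tspan_mult[OF p01(3) f(1)], simp add: \<phi>)
    moreover have "t0 * g1 + t1 * ?g - p1 * f = p0 * f - t0 * g0"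
      using Suc(4) by (simp add: t(1) p01(1) algebra_simps)
    ultimately show "p0 * f - t0 * g0 \<in> tspan m v X (\<lambda>c. \<phi> c > k + \<gamma>)" by simp
  qed auto
  then have p0f: "p0 * f = t0 * g0" by simp
  \<comment> \<open>The lowest component of the quotient; \<open>v powi (- z)\<close> undoes the
    scalar that arises when \<open>inverse g0\<close> moves past \<open>f\<close>.\<close>
  define q0 where "q0 = v powi (- z) * (p0 * inverse g0)"
  have "p0 \<in> tspan m v X P" by (rule tspan_mono[OF p01(2)]) auto
  then have q0: "q0 \<in> tspan m v X R"
    unfolding q0_def by (intro tspan_powi_scale PR)
  have g0_f: "inverse g0 * f = v powi z * (f * inverse g0)"
  proof -
    have "inverse g0 * f = inverse g0 * (f * g0) * inverse g0"
      using g0(2) by (simp add: mult.assoc)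
    also have "\<dots> = v powi z * (f * inverse g0)"
      using g0(2) by (simp add: commute powi_left_commute mult.assoc[symmetric])
        (simp add: powi_commute[symmetric] mult.assoc)
    finally show ?thesis .
  qed
  have "q0 * f = v powi (- z) * (p0 * (v powi z * (f * inverse g0)))"
    by (simp only: q0_def mult.assoc g0_f)
  also have "\<dots> = p0 * f * inverse g0"
    by (subst powi_left_commute) (simp add: powi_add_left mult.assoc)
  also have "\<dots> = t0" using g0(2) by (simp add: p0f mult.assoc)
  finally have t0: "t0 = q0 * f" by simp
  \<comment> \<open>The same problem remains for \<open>t1\<close>, whose range of degrees is
    shorter by one.\<close>
  have "t1 * ?g = (p - v powi z * (q0 * ?g)) * f"
  proof -
    have "t1 * ?g = t * ?g - q0 * (f * ?g)" by (simp add: t(1) t0 algebra_simps)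
    also have "\<dots> = p * f - v powi z * (q0 * ?g) * f"
      by (simp only: Suc(4) fg powi_left_commute mult.assoc)
    finally show ?thesis by (simp add: left_diff_distrib)
  qed
  moreover have "p - v powi z * (q0 * ?g) \<in> tspan m v X P"
    by (intro tspan_diff Suc(3) tspan_powi_scale RP q0)
  moreover have "t1 \<in> tspan m v X (\<lambda>c. k + 1 \<le> \<phi> c \<and> \<phi> c < k + 1 + int N)"
    by (rule tspan_mono[OF t(3)]) auto
  ultimately obtain q1 where "q1 \<in> tspan m v X R" "t1 = q1 * f"
    using Suc.IH by blast
  then show ?case
    using t(1) t0 q0 by (intro bexI[of _ "q0 + q1"]) (auto simp: distrib_right intro: tspan_add)
qed

lemma coprime_quotient:
  fixes \<phi> :: "(nat \<Rightarrow> int) \<Rightarrow> int"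
  assumes \<phi>: "\<And>c e. \<phi> (c + e) = \<phi> c + \<phi> e"
    and "f \<in> tspan m v X (\<lambda>c. \<phi> c = \<gamma>')" "f \<noteq> 0"
    and "g0 \<in> tspan m v X (\<lambda>c. \<phi> c = \<gamma>)" "g0 \<noteq> 0"
    and "g1 \<in> tspan m v X (\<lambda>c. \<phi> c > \<gamma>)"
    and "f * (g0 + g1) = v powi z * ((g0 + g1) * f)"
    and "\<And>s. s \<in> tspan m v X P \<Longrightarrow> s * inverse g0 \<in> tspan m v X R"
    and "\<And>s. s \<in> tspan m v X R \<Longrightarrow> s * (g0 + g1) \<in> tspan m v X P"
    and t: "t \<in> laurent m v X" and "p \<in> tspan m v X P" and "t * (g0 + g1) = p * f"
  obtains q where "q \<in> tspan m v X R" "t = q * f"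
proof -
  obtain N :: nat where N: "t \<in> tspan m v X (\<lambda>c. True \<and> - int N \<le> \<phi> c)"
    by (rule tspan_lower_bound[OF t])
  obtain M :: nat where M: "t \<in> tspan m v X (\<lambda>c. (True \<and> - int N \<le> \<phi> c) \<and> - int M \<le> - \<phi> c)"
    by (rule tspan_lower_bound[OF N])
  \<comment> \<open>The extra 1 turns the upper bound \<open>M\<close> into a strict one.\<close>
  have "t \<in> tspan m v X (\<lambda>c. - int N \<le> \<phi> c \<and> \<phi> c < - int N + int (N + M + 1))"
    by (rule tspan_mono[OF M]) auto
  then show ?thesis
    using coprime_quotient_bounded[OF assms(1-9) _ assms(11,12)] that by blast
qed

end

section \<open>Leading terms and factors of the exchanged variable\<close>

context edge
begin

text \<open>At either end of the exchange relation the coefficient is 1. If one end is strictly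
  lowest for \<open>\<phi>\<close>, the initial form is therefore a single invertible
  monomial.\<close>

lemma X'_i_leading:
  fixes \<phi> :: "(nat \<Rightarrow> int) \<Rightarrow> int"
  assumes "r0 = 0 \<or> r0 = D" and "\<And>r. r \<le> D \<Longrightarrow> r \<noteq> r0 \<Longrightarrow> \<phi> (w r - unitv i) > \<gamma>"
  shows "X' (unitv i) - X (w r0 - unitv i) \<in> tspan m v X (\<lambda>c. \<phi> c > \<gamma>)"
proof -
  have "r0 \<in> {0..D}" "h r0 = 1" using assms(1) h_first h_last by auto
  then have "X' (unitv i) - X (w r0 - unitv i) = (\<Sum>r\<in>{0..D} - {r0}. h r * X (w r - unitv i))"
    unfolding X'_i by (subst sum.remove[of _ r0]) auto
  also have "\<dots> \<in> tspan m v X (\<lambda>c. \<phi> c > \<gamma>)"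
    by (intro tspan_sum tspan_scaled_monom) (auto intro: h_coeff assms(2))
  finally show ?thesis .
qed

lemma X'_tspan_fix:
  assumes "j \<noteq> i" "w0 j = 0" "bt j = 0" "vec_on m c" "c i \<ge> 0"
  shows "X' c \<in> tspan m v X (\<lambda>e. e i = - c i \<and> e j = c j)"
proof -
  have "X' c \<in> tspan m v X (\<lambda>e. e i = - int (nat (c i)) \<and> e j = c j)"
    by (rule X'_tspan_general) (use assms w0_i bt_i in \<open>auto simp: vec_apply unitv_other proj_apply\<close>)
  then show ?thesis using assms by simp
qed

text \<open>Passing from \<open>X'\<close> to \<open>X\<close> negates the \<open>i\<close>-th
  exponent and keeps the \<open>j\<close>-th, so the terms of another bidegree in \<open>X'\<close>
  form an element of \<open>X\<close> without terms of bidegree \<open>(a, b)\<close>, and this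
  element has to vanish.\<close>

lemma laurent_both_negative_fix:
  assumes j: "j \<noteq> i" "w0 j = 0" "bt j = 0" and "a < 0"
    and s: "s \<in> tspan m v X (\<lambda>c. c i = a \<and> c j = b)" "s \<in> laurent m v X'"
  shows "s \<in> tspan m v X' (\<lambda>c. c i = - a \<and> c j = b)"
proof -
  let ?Q = "\<lambda>c. c i = - a \<and> c j = b"
  have "s \<in> tspan m v X' (\<lambda>c. c i \<ge> 1)"
    using laurent_both_negative[OF tspan_mono[OF s(1)] s(2)] \<open>a < 0\<close> by auto
  then obtain s1 s2 where s12: "s = s1 + s2" "s1 \<in> tspan m v X' (\<lambda>c. c i \<ge> 1 \<and> ?Q c)"
    "s2 \<in> tspan m v X' (\<lambda>c. c i \<ge> 1 \<and> \<not> ?Q c)" by (rule tspan_split)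
  have "s2 = 0"
  proof (rule A.tspan_disjoint)
    show "s2 \<in> tspan m v X (\<lambda>c. \<not> (c i = a \<and> c j = b))"
      by (rule subsetD[OF tspan_subset s12(3)], rule tspan_mono[OF X'_tspan_fix[OF j]]) auto
    have "s1 \<in> tspan m v X (\<lambda>c. c i = a \<and> c j = b)"
      by (rule subsetD[OF tspan_subset s12(2)], rule tspan_mono[OF X'_tspan_fix[OF j]]) auto
    then have "s - s1 \<in> tspan m v X (\<lambda>c. c i = a \<and> c j = b)" using s(1) by (intro tspan_diff)
    then show "s2 \<in> tspan m v X (\<lambda>c. c i = a \<and> c j = b)" using s12(1) by simp
  qed auto
  then show ?thesis using s12 by (auto intro: tspan_mono)
qed

text \<open>Monomials of degree \<open>n\<close> in the new variable share the right factor
  \<open>X' (unitv i) ^ n\<close>; what precedes it avoids direction \<open>i\<close> and so belongs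
  to both tori.\<close>

lemma tspan_X'_factor:
  assumes "s \<in> tspan m v X' (\<lambda>c. c i = int n \<and> Q (proj i c))"
  obtains p where "p \<in> tspan m v X (\<lambda>c. c i = 0 \<and> Q c)" "s = p * X' (unitv i) ^ n"
proof -
  have "\<exists>p\<in>tspan m v X (\<lambda>c. c i = 0 \<and> Q c). s = p * X' (unitv i) ^ n"
    using assms
  proof induction
    case zero
    show ?case by (intro bexI[of _ 0]) (auto intro: tspan.zero)
  next
    case (step c k s)
    then obtain p where p: "p \<in> tspan m v X (\<lambda>c. c i = 0 \<and> Q c)" "s = p * X' (unitv i) ^ n" by blast
    define z where "z = - bform m L' (proj i c) (smul (c i) (unitv i))"
    have "X' c = v powi z * (X (proj i c) * X' (unitv i) ^ n)"
      unfolding z_def using X'_decomp[of c] step(2) by simp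
    then have "k * X' c + s = ((k * v powi z) * X (proj i c) + p) * X' (unitv i) ^ n"
      by (simp add: p(2) distrib_right mult.assoc)
    moreover have "(k * v powi z) * X (proj i c) + p \<in> tspan m v X (\<lambda>c. c i = 0 \<and> Q c)"
    proof (rule tspan.step)
      show "proj i c i = 0 \<and> Q (proj i c)" using step(2) by (simp add: proj_apply)
    qed (use step(1,3) p(1) in \<open>auto intro: coeff_ring_closed\<close>)
    ultimately show ?case by blast
  qed
  then show ?thesis using that by blast
qed

end

section \<open>Rank two: the commuting case\<close>

text \<open>\<open>X\<close>, \<open>X'\<close>, \<open>Y\<close> and \<open>W\<close> are the toric frames of \<open>s\<close>, \<open>\<mu>\<^sub>i s\<close>, \<open>\<mu>\<^sub>k s\<close> and \<open>\<mu>\<^sub>k \<mu>\<^sub>i s\<close>.\<close>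

locale square =
  E1: edge v m L X L' X' i w1 b1 D1 h1 + E2: edge v m L X LY Y k w2 b2 D2 h2 +
  E3: edge v m L' X' LW W k w3 b3 D2 h2
  for v :: "'a::division_ring" and m L X L' X' LY Y LW W and i w1 b1 D1 h1 and k w2 b2 D2 h2 and w3 b3 +
  assumes ik: "i \<noteq> k"
begin

lemma S1: "edge v m L' X' L X i w1 b1 D1 h1"
  by (rule edge_sym) (rule E1.edge_axioms)

lemma S2: "edge v m LY Y L X k w2 b2 D2 h2"
  by (rule edge_sym) (rule E2.edge_axioms)

lemma S3: "edge v m LW W L' X' k w3 b3 D2 h2"
  by (rule edge_sym) (rule E3.edge_axioms)

lemma X'_tspan_laurent_W: "y \<in> tspan m v X' P \<Longrightarrow> (\<And>c. P c \<Longrightarrow> c k \<ge> 0) \<Longrightarrow> y \<in> laurent m v W"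
  by (rule edge.tspan_X'_laurent[OF S3])

lemma X_tspan_X':
  assumes "y \<in> tspan m v X P" "\<And>c. P c \<Longrightarrow> c i \<ge> 0 \<and> c k \<ge> l"
  shows "y \<in> tspan m v X' (\<lambda>c. c k \<ge> l)"
proof (rule subsetD[OF tspan_subset assms(1)])
  fix c assume c: "vec_on m c" "P c"
  then have "X c \<in> tspan m v X' (\<lambda>e. e i = - c i \<and> (\<forall>j. j \<noteq> i \<longrightarrow> c j \<le> e j))"
    by (intro edge.X'_tspan[OF S1]) (auto simp: assms(2))
  then show "X c \<in> tspan m v X' (\<lambda>c. c k \<ge> l)"
    by (rule tspan_mono) (use c assms(2)[of c] ik in force)
qed

lemma X_tspan_laurent_W:
  assumes "y \<in> tspan m v X P" "\<And>c. P c \<Longrightarrow> c i \<ge> 0 \<and> c k \<ge> 0"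
  shows "y \<in> laurent m v W"
  using X'_tspan_laurent_W[OF X_tspan_X'[OF assms]] by blast

lemma Y_tspan_laurent_W:
  assumes y: "y \<in> tspan m v Y P" and P: "\<And>c. P c \<Longrightarrow> c i \<ge> 0 \<and> c k \<ge> 0"
    and Y: "Y (unitv k) \<in> laurent m v W"
  shows "y \<in> laurent m v W"
proof (rule subsetD[OF tspan_subset y])
  fix c assume c: "vec_on m c" "P c"
  have "X (proj k c) \<in> laurent m v W"
  proof (rule X_tspan_laurent_W[where P = "\<lambda>e. e = proj k c"])
    show "X (proj k c) \<in> tspan m v X (\<lambda>e. e = proj k c)"
      using proj_vec_on[OF c(1)] by (rule tspan_monom) simp
  qed (use P[OF c(2)] ik in \<open>auto simp: proj_apply\<close>)
  then show "Y c \<in> laurent m v W"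
    unfolding E2.X'_decomp[of c, OF conjunct2[OF P[OF c(2)]]]
    by (intro tspan_powi_scale E3.B.laurent_mult E3.B.laurent_power Y)
qed

text \<open>Unless both degrees are negative, rewriting \<open>s\<close> in one of \<open>X\<close>,
  \<open>Y\<close>, \<open>X'\<close> makes them nonnegative. If both are negative, \<open>s\<close>
  is divisible by a power of the new \<open>i\<close>-th variable and by one of the new
  \<open>k\<close>-th variable; coprimality makes it divisible by their product, and both powers are
  monomials of \<open>W\<close>.\<close>

lemma laurent_W_bihomogeneous:
  assumes w1_k: "w1 k = 0" "b1 k = 0" and w2_i: "w2 i = 0" "b2 i = 0" and w3: "w3 = w2" "b3 = b2"
    and form1: "\<And>c. bform m L c b1 = - c i * \<delta>1"
    and form2: "\<And>c. bform m L c b2 = - c k * \<delta>2" and \<delta>2: "\<delta>2 > 0"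
    and s: "s \<in> tspan m v X (\<lambda>c. c i = a \<and> c k = b)" "s \<in> laurent m v X'" "s \<in> laurent m v Y"
  shows "s \<in> laurent m v W"
proof -
  \<comment> \<open>The relation in direction \<open>k\<close> does not involve the
    \<open>i\<close>-th variable and so is not affected by the mutation in direction
    \<open>i\<close>.\<close>
  have Y_W: "Y (unitv k) = W (unitv k)"
  proof -
    have "X' (w3 + smul (int r) b3 - unitv k) = X (w2 + smul (int r) b2 - unitv k)" for r
      unfolding w3 by (rule E1.same) (simp add: vec_apply w2_i unitv_other ik)
    then show ?thesis by (simp add: E2.X'_i E3.X'_i)
  qed
  have W_k: "W (unitv k) \<in> laurent m v W" using E2.i_in by (intro tspan_monom) auto
  consider "a \<ge> 0" "b \<ge> 0" | "a \<ge> 0" "b < 0" | "a < 0" "b \<ge> 0" | "a < 0" "b < 0" by linarith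
  then show ?thesis
  proof cases
    case 1
    then show ?thesis by (intro X_tspan_laurent_W[OF s(1)]) auto
  next
    case 2
    have "s \<in> tspan m v X (\<lambda>c. c k = b \<and> c i = a)" by (rule tspan_mono[OF s(1)]) auto
    then have "s \<in> tspan m v Y (\<lambda>c. c k = - b \<and> c i = a)"
      using ik w2_i 2 s(3) by (intro E2.laurent_both_negative_fix) auto
    then show ?thesis
      by (rule Y_tspan_laurent_W) (use 2 Y_W W_k in auto)
  next
    case 3
    have "s \<in> tspan m v X' (\<lambda>c. c i = - a \<and> c k = b)"
      using ik w1_k 3 s by (intro E1.laurent_both_negative_fix) auto
    then show ?thesis by (rule X'_tspan_laurent_W) (use 3 in auto)
  next
    case 4
    define M N where "M = nat (- a)" and "N = nat (- b)"
    have MN: "a = - int M" "b = - int N" using 4 by (auto simp: M_def N_def)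
    let ?f = "X' (unitv i) ^ M" and ?u = "Y (unitv k)"
    have "s \<in> tspan m v X' (\<lambda>c. c i = - a \<and> c k = b)"
      using ik w1_k 4 s by (intro E1.laurent_both_negative_fix) auto
    then have "s \<in> tspan m v X' (\<lambda>c. c i = int M \<and> proj i c k = b)"
      by (rule tspan_mono) (use ik MN in \<open>auto simp: proj_apply\<close>)
    then obtain p where p: "p \<in> tspan m v X (\<lambda>c. c i = 0 \<and> c k = b)" "s = p * ?f"
      by (rule E1.tspan_X'_factor)
    have "s \<in> tspan m v X (\<lambda>c. c k = b \<and> c i = a)" by (rule tspan_mono[OF s(1)]) auto
    then have "s \<in> tspan m v Y (\<lambda>c. c k = - b \<and> c i = a)"
      using ik w2_i 4 s(3) by (intro E2.laurent_both_negative_fix) auto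
    then have "s \<in> tspan m v Y (\<lambda>c. c k = int N \<and> proj k c i = a)"
      by (rule tspan_mono) (use ik MN in \<open>auto simp: proj_apply\<close>)
    then obtain t where t: "t \<in> tspan m v X (\<lambda>c. c k = 0 \<and> c i = a)" "s = t * ?u ^ N"
      by (rule E2.tspan_X'_factor)
    \<comment> \<open>In this grading \<open>b1\<close> has degree 0, so \<open>?f\<close> is
      homogeneous, while \<open>b2\<close> has degree \<open>\<delta>2 > 0\<close>, so the term
      \<open>r = 0\<close> of the \<open>k\<close>-th exchange relation is strictly lowest.\<close>
    define \<phi> where "\<phi> c = bform m L c (unitv k)" for c
    have \<phi>_add: "\<phi> (c + e) = \<phi> c + \<phi> e" for c e by (simp add: \<phi>_def bform_linear)
    have \<phi>_b1: "\<phi> b1 = 0"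
      using form1[of "unitv k"] E1.A.form_skew[of b1 "unitv k"] ik by (simp add: \<phi>_def unitv_other)
    have \<phi>_b2: "\<phi> b2 = \<delta>2"
      using form2[of "unitv k"] E1.A.form_skew[of b2 "unitv k"] by (simp add: \<phi>_def)
    have \<phi>_f: "?f \<in> tspan m v X (\<lambda>c. \<phi> c = int M * \<phi> (w1 - unitv i))"
    proof (rule E1.A.tspan_power_leading(1)[where \<phi> = \<phi> and ?u1.0 = 0, OF \<phi>_add _ tspan.zero])
      show "X' (unitv i) \<in> tspan m v X (\<lambda>c. \<phi> c = \<phi> (w1 - unitv i))"
        using \<phi>_b1 by (intro E1.X'_i_tspan) (simp add: \<phi>_def bform_linear)
    qed
    let ?x = "X (w2 - unitv k)"
    let ?\<gamma> = "\<phi> (w2 - unitv k)"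
    have u0_vec: "vec_on m (w2 - unitv k)" using E2.w0_vec E2.i_in by (intro vec_on_closed)
    have lead: "?u - ?x \<in> tspan m v X (\<lambda>c. \<phi> c > ?\<gamma>)"
    proof -
      have "smul (int 0) b2 = 0" by (simp add: fun_eq_iff vec_apply)
      moreover have "?u - X (w2 + smul (int 0) b2 - unitv k) \<in> tspan m v X (\<lambda>c. \<phi> c > ?\<gamma>)"
        using \<phi>_b2 \<delta>2 by (intro E2.X'_i_leading) (auto simp: \<phi>_def bform_linear)
      ultimately show ?thesis by simp
    qed
    have u0: "?x \<in> tspan m v X (\<lambda>c. \<phi> c = ?\<gamma>)" by (rule tspan_monom[OF u0_vec]) simp
    let ?g0 = "?x ^ N"
    have g0: "?g0 \<in> tspan m v X (\<lambda>c. \<phi> c = int N * ?\<gamma>)"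
      using E1.A.tspan_power_leading(1)[OF \<phi>_add u0 lead] .
    have g1: "?u ^ N - ?g0 \<in> tspan m v X (\<lambda>c. \<phi> c > int N * ?\<gamma>)"
      using E1.A.tspan_power_leading(2)[OF \<phi>_add u0 lead] by simp
    have f_W: "?f = W (smul (int M) (unitv i))"
      using E3.same[of "unitv i"] ik by (simp add: unitv_other E3.B.X_power[symmetric])
    have g_W: "?u ^ N = W (smul (int N) (unitv k))"
      by (simp add: Y_W E3.B.X_power)
    \<comment> \<open>Both powers are monomials of \<open>W\<close>, hence they
      quasi-commute.\<close>
    obtain z where z: "?f * ?u ^ N = v powi z * (?u ^ N * ?f)"
      unfolding f_W g_W using E3.B.X_commute by blast
    have g_tspan: "?u ^ N \<in> tspan m v X (\<lambda>c. c i = 0 \<and> c k = b)"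
    proof -
      have "Y (smul (int N) (unitv k)) \<in>
          tspan m v X (\<lambda>e. e k = - (smul (int N) (unitv k)) k \<and> e i = smul (int N) (unitv k) i)"
        using ik w2_i E2.i_in
        by (intro E2.X'_tspan_fix vec_on_closed) (simp_all add: vec_apply)
      then show ?thesis
        unfolding E2.B.X_power by (rule tspan_mono) (use ik MN in \<open>auto simp: vec_apply unitv_other\<close>)
    qed
    have g0_inv: "inverse ?g0 = X (- smul (int N) (w2 - unitv k))"
      using E1.A.X_inverse[of "smul (int N) (w2 - unitv k)"]
      by (simp add: E1.A.X_power inverse_unique)
    have g0_inv_tspan: "inverse ?g0 \<in> tspan m v X (\<lambda>c. c i = 0 \<and> c k = int N)"
      unfolding g0_inv
      by (intro tspan_monom vec_on_closed(4,5) u0_vec)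
        (use ik w2_i E2.w0_i in \<open>simp add: vec_apply unitv_other\<close>)
    \<comment> \<open>The quotient is sought in bidegree \<open>(0, 0)\<close> and \<open>p\<close>
      has bidegree \<open>(0, b)\<close>: dividing by \<open>?g0\<close> removes the degree
      \<open>b = - N\<close> in direction \<open>k\<close>.\<close>
    obtain q where q: "q \<in> tspan m v X (\<lambda>c. c i = 0 \<and> c k = 0)" "t = q * ?f"
    proof (rule E1.A.coprime_quotient[OF \<phi>_add \<phi>_f _ g0 _ g1])
      show "?f \<noteq> 0" "?g0 \<noteq> 0" by (simp_all add: E1.A.X_nonzero E1.B.X_nonzero)
      show "?f * (?g0 + (?u ^ N - ?g0)) = v powi z * ((?g0 + (?u ^ N - ?g0)) * ?f)"
        using z by simp
      show "s * inverse ?g0 \<in> tspan m v X (\<lambda>c. c i = 0 \<and> c k = 0)"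
        if "s \<in> tspan m v X (\<lambda>c. c i = 0 \<and> c k = b)" for s
        by (rule E1.A.tspan_mult[OF that g0_inv_tspan]) (simp add: vec_apply MN)
      show "s * (?g0 + (?u ^ N - ?g0)) \<in> tspan m v X (\<lambda>c. c i = 0 \<and> c k = b)"
        if "s \<in> tspan m v X (\<lambda>c. c i = 0 \<and> c k = 0)" for s
        using E1.A.tspan_mult[OF that g_tspan, of "\<lambda>c. c i = 0 \<and> c k = b"] by (simp add: vec_apply)
      show "t \<in> laurent m v X" using t(1) by (rule tspan_laurent)
      show "p \<in> tspan m v X (\<lambda>c. c i = 0 \<and> c k = b)" by (rule p(1))
      show "t * (?g0 + (?u ^ N - ?g0)) = p * ?f" using t(2) p(2) by simp
    qed blast
    have "q \<in> laurent m v W" by (rule X_tspan_laurent_W[OF q(1)]) auto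
    moreover have "?f \<in> laurent m v W" unfolding f_W using E1.i_in by (intro tspan_monom vec_on_closed) auto
    moreover have "?u ^ N \<in> laurent m v W"
      unfolding Y_W by (rule E3.B.laurent_power[OF W_k])
    moreover have "s = q * ?f * ?u ^ N" using t(2) q(2) by simp
    ultimately show ?thesis by (auto intro: E3.B.laurent_mult)
  qed
qed

text \<open>Neither exchange polynomial involves the variable of the other direction, so both
  adjacent Laurent rings respect the bigrading by the \<open>i\<close>-th and \<open>k\<close>-th
  exponents, and one bidegree can be treated at a time.\<close>

lemma laurent_W_commuting:
  assumes w1_k: "w1 k = 0" "b1 k = 0" and w2_i: "w2 i = 0" "b2 i = 0" and w3: "w3 = w2" "b3 = b2"
    and form1: "\<And>c. bform m L c b1 = - c i * \<delta>1"
    and form2: "\<And>c. bform m L c b2 = - c k * \<delta>2" and \<delta>2: "\<delta>2 > 0"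
    and y: "y \<in> laurent m v X" "y \<in> laurent m v X'" "y \<in> laurent m v Y"
  shows "y \<in> laurent m v W"
proof -
  obtain S a where S: "finite S" "\<And>c. c \<in> S \<Longrightarrow> vec_on m c \<and> True \<and> a c \<in> coeff_ring v"
    "y = (\<Sum>c\<in>S. a c * X c)" by (rule tspan_finite_sum[OF y(1)]) blast
  define \<pi> where "\<pi> c = (c i, c k)" for c :: "nat \<Rightarrow> int"
  define s where "s q = (\<Sum>c\<in>{c\<in>S. \<pi> c = q}. a c * X c)" for q
  have "(\<Sum>q\<in>\<pi> ` S. s q) = y"
    unfolding S(3) s_def by (rule sum.group) (auto simp: S(1))
  moreover have "s q \<in> laurent m v W" for q
  proof -
    define t where "t = (\<Sum>c\<in>{c\<in>S. \<pi> c \<noteq> q}. a c * X c)"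
    have y_st: "y = s q + t"
    proof -
      have "S = {c\<in>S. \<pi> c = q} \<union> {c\<in>S. \<pi> c \<noteq> q}" by blast
      then have "y = (\<Sum>c\<in>{c\<in>S. \<pi> c = q} \<union> {c\<in>S. \<pi> c \<noteq> q}. a c * X c)" using S(3) by simp
      also have "\<dots> = s q + t"
        unfolding s_def t_def using S(1) by (intro sum.union_disjoint) auto
      finally show ?thesis .
    qed
    have s: "s q \<in> tspan m v X (\<lambda>c. \<pi> c = q)"
      unfolding s_def by (intro tspan_sum tspan_scaled_monom) (use S(2) in auto)
    have t: "t \<in> tspan m v X (\<lambda>c. \<not> \<pi> c = q)"
      unfolding t_def by (intro tspan_sum tspan_scaled_monom) (use S(2) in auto)
    have hom: "z \<in> tspan m v X (\<lambda>c. \<pi> c = q) \<or> z \<in> tspan m v X (\<lambda>c. \<not> \<pi> c = q)"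
      if "z \<in> tspan m v X (\<lambda>c. \<pi> c = q')" for z q'
    proof (cases "q' = q")
      case False
      then show ?thesis using tspan_mono[OF that, of "\<lambda>c. \<not> \<pi> c = q"] by auto
    qed (use that in auto)
    have "s q \<in> laurent m v X'"
    proof (rule E1.laurent_component[OF _ s t])
      show "s q + t \<in> laurent m v X'" using y(2) y_st by simp
      fix c assume "vec_on m c" "c i \<ge> 0"
      then have "X' c \<in> tspan m v X (\<lambda>e. e i = - c i \<and> e k = c k)"
        using ik w1_k by (intro E1.X'_tspan_fix) auto
      then show "X' c \<in> tspan m v X (\<lambda>c. \<pi> c = q) \<or> X' c \<in> tspan m v X (\<lambda>c. \<not> \<pi> c = q)"
        by (intro hom[where q' = "(- c i, c k)"]) (simp add: \<pi>_def)
    qed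
    moreover have "s q \<in> laurent m v Y"
    proof (rule E2.laurent_component[OF _ s t])
      show "s q + t \<in> laurent m v Y" using y(3) y_st by simp
      fix c assume "vec_on m c" "c k \<ge> 0"
      then have "Y c \<in> tspan m v X (\<lambda>e. e k = - c k \<and> e i = c i)"
        using ik w2_i by (intro E2.X'_tspan_fix) auto
      then show "Y c \<in> tspan m v X (\<lambda>c. \<pi> c = q) \<or> Y c \<in> tspan m v X (\<lambda>c. \<not> \<pi> c = q)"
        by (intro hom[where q' = "(c i, - c k)"]) (simp add: \<pi>_def conj_commute)
    qed
    moreover have "s q \<in> tspan m v X (\<lambda>c. c i = fst q \<and> c k = snd q)"
      by (rule tspan_mono[OF s]) (auto simp: \<pi>_def)
    ultimately show ?thesis
      using laurent_W_bihomogeneous[OF w1_k w2_i w3 form1 form2 \<delta>2] by blast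
  qed
  ultimately show ?thesis using tspan_sum[of "\<pi> ` S" s m v W] by metis
qed

end

section \<open>Rank two: the noncommuting case\<close>

text \<open>Here \<open>\<tau>\<close> is the tropical transformation attached to the mutation in direction \<open>i\<close>: to lowest order
  in the \<open>k\<close>-th variable, \<open>X c\<close> is \<open>X' (\<tau> c)\<close>.\<close>

locale noncommuting_square = square +
  fixes r1 r2 :: nat and \<tau> :: "(nat \<Rightarrow> int) \<Rightarrow> nat \<Rightarrow> int"
  assumes r1: "r1 = 0 \<or> r1 = D1" and r1_k: "E1.w r1 k = 0"
    and r1_other: "r \<le> D1 \<Longrightarrow> r \<noteq> r1 \<Longrightarrow> E1.w r k > 0"
    and r2: "r2 = 0 \<or> r2 = D2" and r2_i: "E2.w r2 i = 0"
    and r2_other: "r \<le> D2 \<Longrightarrow> r \<noteq> r2 \<Longrightarrow> E2.w r i > 0"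
    and \<tau>: "\<tau> c = c + smul (c i) (E1.w r1 - smul 2 (unitv i))"
    and \<tau>_form: "bform m L' (\<tau> a) (\<tau> b) = bform m L a b"
    and \<tau>_b2: "\<tau> b2 = b3"
    and form3: "c k = 0 \<Longrightarrow> bform m L' c b3 = 0"
begin

lemma \<tau>_add: "\<tau> (a + b) = \<tau> a + \<tau> b"
  by (simp add: \<tau> fun_eq_iff vec_apply algebra_simps)

lemma \<tau>_diff: "\<tau> (a - b) = \<tau> a - \<tau> b"
  by (simp add: \<tau> fun_eq_iff vec_apply algebra_simps)

lemma \<tau>_smul: "\<tau> (smul z a) = smul z (\<tau> a)"
  by (simp add: \<tau> fun_eq_iff vec_apply algebra_simps)

lemma \<tau>_fixed: "c i = 0 \<Longrightarrow> \<tau> c = c"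
  by (simp add: \<tau> fun_eq_iff vec_apply)

lemma \<tau>_i: "\<tau> (unitv i) = E1.w r1 - unitv i"
  by (simp add: \<tau> fun_eq_iff vec_apply)

lemma \<tau>_k: "\<tau> c k = c k"
  using r1_k ik by (simp add: \<tau> vec_apply unitv_other)

lemma \<tau>_vec: "vec_on m c \<Longrightarrow> vec_on m (\<tau> c)"
  unfolding \<tau> using E1.i_in E1.w0_vec E1.bt_vec by (intro vec_on_closed)

text \<open>Induction on the \<open>i\<close>-th exponent: \<open>\<tau>\<close> is additive and
  carries one form to the other, so the leading monomials multiply with the same powers of
  \<open>v\<close> on both sides.\<close>

lemma X_leading:
  assumes "vec_on m c" "c i \<ge> 0"
  shows "X c - X' (\<tau> c) \<in> tspan m v X' (\<lambda>e. e k > c k)"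
  using assms
proof (induction "nat (c i)" arbitrary: c)
  case 0
  then have "c i = 0" by simp
  then show ?case by (simp add: \<tau>_fixed E1.same tspan.zero)
next
  case (Suc n)
  let ?e = "unitv i"
  define c' where "c' = c - ?e"
  have c': "vec_on m c'" "c' i \<ge> 0" "n = nat (c' i)" "c' k = c k"
    using Suc(2,3,4) E1.i_in ik by (auto simp: c'_def vec_apply unitv_other)
  have c: "c = c' + ?e" by (simp add: c'_def)
  define \<rho> where "\<rho> = X ?e - X' (\<tau> ?e)"
  define \<sigma> where "\<sigma> = X c' - X' (\<tau> c')"
  have \<sigma>: "\<sigma> \<in> tspan m v X' (\<lambda>e. e k > c k)"
    using Suc(1)[OF c'(3,1,2)] by (simp add: \<sigma>_def c'(4))
  have \<rho>: "\<rho> \<in> tspan m v X' (\<lambda>e. e k > 0)"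
    unfolding \<rho>_def \<tau>_i
    by (rule edge.X'_i_leading[OF S1, where \<phi> = "\<lambda>c. c k", OF r1])
      (use r1_other ik in \<open>simp add: vec_apply unitv_other\<close>)
  have Xc': "X' (\<tau> c') \<in> tspan m v X' (\<lambda>e. e k = c k)"
    using c' by (intro tspan_monom \<tau>_vec) (auto simp: \<tau>_k)
  have Xe: "X' (\<tau> ?e) \<in> tspan m v X' (\<lambda>e. e k = 0)"
    using E1.i_in ik by (intro tspan_monom \<tau>_vec) (auto simp: \<tau>_k unitv_other)
  let ?z = "- bform m L c' ?e"
  have "X c = v powi ?z * (X c' * X ?e)" unfolding c by (rule E1.A.X_add)
  moreover have "X' (\<tau> c) = v powi ?z * (X' (\<tau> c') * X' (\<tau> ?e))"
    unfolding c \<tau>_add using E1.B.X_add[of "\<tau> c'" "\<tau> ?e"] by (simp add: \<tau>_form)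
  ultimately have "X c - X' (\<tau> c) =
      v powi ?z * (X' (\<tau> c') * \<rho> + \<sigma> * X' (\<tau> ?e) + \<sigma> * \<rho>)"
    by (simp add: \<rho>_def \<sigma>_def algebra_simps)
  moreover have "X' (\<tau> c') * \<rho> \<in> tspan m v X' (\<lambda>e. e k > c k)"
    by (rule E1.B.tspan_mult[OF Xc' \<rho>]) (simp add: vec_apply)
  moreover have "\<sigma> * X' (\<tau> ?e) \<in> tspan m v X' (\<lambda>e. e k > c k)"
    by (rule E1.B.tspan_mult[OF \<sigma> Xe]) (simp add: vec_apply)
  moreover have "\<sigma> * \<rho> \<in> tspan m v X' (\<lambda>e. e k > c k)"
    by (rule E1.B.tspan_mult[OF \<sigma> \<rho>]) (simp add: vec_apply)
  ultimately show ?case by (auto intro: tspan_add tspan_powi_scale)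
qed

text \<open>Modulo terms without negative \<open>k\<close>-th exponent in \<open>X'\<close>, each
  term of \<open>Y (unitv k)\<close> may be replaced by its leading monomial. What results is a
  monomial of \<open>W\<close> times \<open>W (unitv k)\<close>.\<close>

lemma Y_k_laurent_W: "Y (unitv k) \<in> laurent m v W"
proof -
  let ?a = "\<lambda>r. w3 + smul (int r) b3 - unitv k"
  \<comment> \<open>The vector by which the leading exponents of the two relations differ. It is the
    same for all \<open>r\<close> because \<open>\<tau>\<close> carries \<open>b2\<close> to
    \<open>b3\<close>, and it avoids direction \<open>k\<close>, so \<open>X' \<kappa>\<close> is
    also a monomial of \<open>W\<close>.\<close>
  define \<kappa> where "\<kappa> = \<tau> w2 - w3"
  have \<kappa>_k: "\<kappa> k = 0" by (simp add: \<kappa>_def vec_apply \<tau>_k E2.w0_i E3.w0_i)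
  have \<kappa>_vec: "vec_on m \<kappa>"
    unfolding \<kappa>_def using E2.w0_vec E3.w0_vec by (intro vec_on_closed \<tau>_vec)
  have lead: "X (E2.w r - unitv k) - X' (\<kappa> + ?a r) \<in> tspan m v X' (\<lambda>e. e k \<ge> 0)" if "r \<le> D2" for r
  proof -
    have "\<tau> (E2.w r - unitv k) = \<kappa> + ?a r"
      using ik by (simp add: \<tau>_diff \<tau>_add \<tau>_smul \<tau>_b2 \<kappa>_def \<tau>_fixed[of "unitv k"] unitv_other)
    moreover have "X (E2.w r - unitv k) - X' (\<tau> (E2.w r - unitv k)) \<in>
        tspan m v X' (\<lambda>e. e k > (E2.w r - unitv k) k)"
      using E2.w_nonneg[OF that, of i] ik
      by (intro X_leading E2.w_vec) (simp add: vec_apply unitv_other)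
    \<comment> \<open>The leading exponent is -1 in direction \<open>k\<close>, so the strict bound
      means nonnegative exponents.\<close>
    then have "X (E2.w r - unitv k) - X' (\<tau> (E2.w r - unitv k)) \<in> tspan m v X' (\<lambda>e. e k \<ge> 0)"
      by (rule tspan_mono) (simp add: vec_apply E2.w0_i E2.bt_i)
    ultimately show ?thesis by simp
  qed
  \<comment> \<open>By \<open>form3\<close> the power of \<open>v\<close> does not depend on
    \<open>r\<close>, which lets \<open>X' \<kappa>\<close> be taken out of the whole sum.\<close>
  have "h2 r * X' (\<kappa> + ?a r) = v powi (- bform m L' \<kappa> (w3 - unitv k)) * (X' \<kappa> * (h2 r * X' (?a r)))"
    if "r \<le> D2" for r
  proof -
    have "X' (\<kappa> + ?a r) = v powi (- bform m L' \<kappa> (w3 - unitv k)) * (X' \<kappa> * X' (?a r))"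
      by (simp add: E1.B.X_add bform_linear form3 \<kappa>_k)
    then show ?thesis
      using E1.A.coeff_commute[OF E2.h_coeff[OF that]] by (metis mult.assoc)
  qed
  then have "(\<Sum>r\<in>{0..D2}. h2 r * X' (\<kappa> + ?a r)) =
      v powi (- bform m L' \<kappa> (w3 - unitv k)) * (X' \<kappa> * W (unitv k))"
    unfolding E3.X'_i sum_distrib_left
    by (intro sum.cong refl) simp
  moreover have "X' \<kappa> * W (unitv k) \<in> laurent m v W"
  proof (rule E3.B.laurent_mult)
    show "X' \<kappa> \<in> laurent m v W"
      using tspan_monom[OF \<kappa>_vec, of "\<lambda>_. True" W v] E3.same[of \<kappa>, OF \<kappa>_k] by simp
    show "W (unitv k) \<in> laurent m v W" using E2.i_in by (intro tspan_monom) auto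
  qed
  ultimately have 1: "(\<Sum>r\<in>{0..D2}. h2 r * X' (\<kappa> + ?a r)) \<in> laurent m v W"
    by (simp add: tspan_powi_scale)
  have "(\<Sum>r\<in>{0..D2}. h2 r * (X (E2.w r - unitv k) - X' (\<kappa> + ?a r))) \<in> tspan m v X' (\<lambda>e. e k \<ge> 0)"
    by (intro tspan_sum tspan_scale lead) (auto intro: E2.h_coeff)
  then have 2: "(\<Sum>r\<in>{0..D2}. h2 r * (X (E2.w r - unitv k) - X' (\<kappa> + ?a r))) \<in> laurent m v W"
    by (rule X'_tspan_laurent_W)
  have "Y (unitv k) = (\<Sum>r\<in>{0..D2}. h2 r * (X (E2.w r - unitv k) - X' (\<kappa> + ?a r))) +
      (\<Sum>r\<in>{0..D2}. h2 r * X' (\<kappa> + ?a r))"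
    unfolding E2.X'_i by (simp add: right_diff_distrib sum_subtractf)
  then show ?thesis using tspan_add[OF 2 1] by simp
qed

section \<open>Reduction to nonnegative exponents in direction \<open>i\<close>\<close>

definition core :: "'a set" where
  "core = laurent m v Y \<inter> laurent m v W"

lemma core_closed: "y \<in> core \<Longrightarrow> z \<in> core \<Longrightarrow> y + z \<in> core" "y \<in> core \<Longrightarrow> z \<in> core \<Longrightarrow> y * z \<in> core"
  "y \<in> core \<Longrightarrow> y ^ n \<in> core" "0 \<in> core"
  unfolding core_def
  by (auto intro: tspan_add E2.B.laurent_mult E3.B.laurent_mult E2.B.laurent_power E3.B.laurent_power tspan.zero)

lemma core_X: "y \<in> tspan m v X P \<Longrightarrow> (\<And>c. P c \<Longrightarrow> c i \<ge> 0 \<and> c k \<ge> 0) \<Longrightarrow> y \<in> core"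
  unfolding core_def using X_tspan_laurent_W edge.tspan_X'_laurent[OF S2] by blast

lemma core_Y_k: "Y (unitv k) \<in> core"
  unfolding core_def using Y_k_laurent_W E2.i_in by (auto intro: tspan_monom)

lemma core_X'_i: "X' (unitv i) \<in> core"
proof -
  have "X' (unitv i) \<in> tspan m v X (\<lambda>c. c k \<ge> 0)"
    by (rule E1.X'_i_tspan) (use E1.w_nonneg[of _ k] ik in \<open>simp add: vec_apply unitv_other\<close>)
  then have "X' (unitv i) \<in> laurent m v Y" by (rule edge.tspan_X'_laurent[OF S2])
  moreover have "X' (unitv i) \<in> tspan m v X' (\<lambda>c. c k \<ge> 0)"
    using E1.i_in ik by (intro tspan_monom) (auto simp: unitv_other)
  then have "X' (unitv i) \<in> laurent m v W" by (rule X'_tspan_laurent_W)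
  ultimately show ?thesis by (simp add: core_def)
qed

text \<open>Elements of \<open>core\<close> satisfy the hypothesis on \<open>Y\<close> as well as
  the conclusion on \<open>W\<close>, so they may be subtracted freely. Modulo them only terms
  without negative powers of the \<open>i\<close>-th variable are to remain.\<close>

definition half :: "'a set" where
  "half = {a + b | a b. a \<in> core \<and> b \<in> tspan m v X (\<lambda>c. c i \<ge> 0)}"

lemma half_core: "a \<in> core \<Longrightarrow> a \<in> half"
  unfolding half_def using tspan.zero by force

lemma half_X: "a \<in> tspan m v X (\<lambda>c. c i \<ge> 0) \<Longrightarrow> a \<in> half"
  unfolding half_def using core_closed(4) by force

lemma half_add:
  assumes "a \<in> half" "b \<in> half" shows "a + b \<in> half"
proof -
  obtain a1 a2 b1 b2 where "a = a1 + a2" "b = b1 + b2" "a1 \<in> core" "b1 \<in> core"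
    "a2 \<in> tspan m v X (\<lambda>c. c i \<ge> 0)" "b2 \<in> tspan m v X (\<lambda>c. c i \<ge> 0)"
    using assms unfolding half_def by blast
  then have "a + b = (a1 + b1) + (a2 + b2)" "a1 + b1 \<in> core" "a2 + b2 \<in> tspan m v X (\<lambda>c. c i \<ge> 0)"
    by (auto intro: core_closed tspan_add simp: algebra_simps)
  then show ?thesis unfolding half_def by blast
qed

lemma half_scale:
  assumes "z \<in> coeff_ring v" "a \<in> half" shows "z * a \<in> half"
proof -
  obtain a1 a2 where "a = a1 + a2" "a1 \<in> core" "a2 \<in> tspan m v X (\<lambda>c. c i \<ge> 0)"
    using assms unfolding half_def by blast
  then have "z * a = z * a1 + z * a2" "z * a1 \<in> core" "z * a2 \<in> tspan m v X (\<lambda>c. c i \<ge> 0)"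
    using assms(1) by (auto intro: tspan_scale simp: algebra_simps core_def)
  then show ?thesis unfolding half_def by blast
qed

text \<open>A negative power of the \<open>k\<close>-th variable is traded for a power of \<open>Y (unitv k)\<close> at the price of terms
  divisible by \<open>X (unitv i)\<close>, which cancel a factor \<open>X' (unitv i)\<close>.\<close>

lemma half_power_mult:
  "y \<in> tspan m v X (\<lambda>c. c i \<ge> 0) \<Longrightarrow> X' (unitv i) ^ a * y \<in> half"
proof (induction a arbitrary: y)
  case 0
  then show ?case by (simp add: half_X)
next
  case (Suc a)
  let ?u = "X' (unitv i)" and ?g = "Y (unitv k)"
  \<comment> \<open>One factor \<open>?u\<close> is absorbed: its degree -1 in direction
    \<open>i\<close> is compensated by the positive exponents of \<open>y\<close>.\<close>
  have pos: "?u ^ Suc a * y \<in> half" if "y \<in> tspan m v X (\<lambda>c. c i \<ge> 1)" for y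
  proof -
    have "?u \<in> tspan m v X (\<lambda>c. c i = - 1)"
      by (rule E1.X'_i_tspan) (simp add: vec_apply E1.w0_i E1.bt_i)
    then have "?u * y \<in> tspan m v X (\<lambda>c. c i \<ge> 0)"
      by (rule E1.A.tspan_mult[OF _ that]) (simp add: vec_apply)
    from Suc.IH[OF this] show ?thesis by (simp only: power_Suc2 mult.assoc)
  qed
  have monom: "?u ^ Suc a * X c \<in> half" if c: "vec_on m c" "c i \<ge> 0" for c
  proof -
    consider "c i \<ge> 1" | "c i = 0" "c k \<ge> 0" | "c i = 0" "c k < 0" using c(2) by linarith
    then show ?thesis
    proof cases
      case 1
      then show ?thesis using c by (intro pos tspan_monom) auto
    next
      case 2
      have "X c \<in> tspan m v X (\<lambda>e. e = c)" using c by (intro tspan_monom) auto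
      then have "X c \<in> core" by (rule core_X) (use 2 in auto)
      then show ?thesis using core_X'_i by (intro half_core core_closed)
    next
      case 3
      define N where "N = nat (- c k)"
      \<comment> \<open>The end \<open>r2\<close> of the \<open>k\<close>-th relation avoids the
        \<open>i\<close>-th variable, so \<open>?x\<close> is the initial form of \<open>?g\<close>
        with respect to the \<open>i\<close>-th exponent.\<close>
      let ?f = "E2.w r2 - unitv k"
      let ?x = "X ?f"
      have f: "vec_on m ?f" "?f i = 0" "?f k = -1"
        using r2_i ik E2.w_i[of r2] by (auto simp: vec_apply unitv_other)
      have x: "?x \<in> tspan m v X (\<lambda>c. c i = 0)" using f by (intro tspan_monom) auto
      have "?g - ?x \<in> tspan m v X (\<lambda>c. c i > 0)"
        by (rule E2.X'_i_leading[where \<phi> = "\<lambda>c. c i", OF r2])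
          (use r2_other ik in \<open>simp add: vec_apply unitv_other\<close>)
      then have "(?x + (?g - ?x)) ^ N - ?x ^ N \<in> tspan m v X (\<lambda>c. c i > int N * 0)"
        by (intro E1.A.tspan_power_leading(2)[where \<phi> = "\<lambda>c. c i"] x) (auto simp: vec_apply)
      then have lead: "?g ^ N - ?x ^ N \<in> tspan m v X (\<lambda>c. c i \<ge> 1)"
        by (simp, elim tspan_mono) auto
      \<comment> \<open>Up to a scalar, \<open>X c\<close> stripped of its negative power in
        direction \<open>k\<close>.\<close>
      let ?q = "X c * X (- smul (int N) ?f)"
      have q: "?q \<in> tspan m v X (\<lambda>e. e i = 0 \<and> e k = 0)"
      proof (rule E1.A.tspan_mult)
        show "X c \<in> tspan m v X (\<lambda>e. e i = 0 \<and> e k = - int N)"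
          using 3 by (intro tspan_monom c(1)) (simp add: N_def)
        have "(- smul (int N) ?f) i = - int N * ?f i" "(- smul (int N) ?f) k = - int N * ?f k"
          by (simp_all add: uminus_apply smul_apply)
        then show "X (- smul (int N) ?f) \<in> tspan m v X (\<lambda>e. e i = 0 \<and> e k = int N)"
          unfolding f(2,3) by (intro tspan_monom vec_on_closed(4,5) f(1)) simp
      qed (simp add: plus_fun_apply)
      have "?q * ?x ^ N = X c"
      proof -
        have "X (- smul (int N) ?f) * ?x ^ N = 1"
          using E1.A.X_inverse[of "- smul (int N) ?f"] by (simp add: E1.A.X_power)
        then show ?thesis by (simp add: mult.assoc)
      qed
      \<comment> \<open>Replacing \<open>?x ^ N\<close> by \<open>?g ^ N\<close> costs only terms
        with positive \<open>i\<close>-th exponent, to which \<open>pos\<close> applies.\<close>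
      then have Xc: "X c = ?q * ?g ^ N - ?q * (?g ^ N - ?x ^ N)" by (simp add: right_diff_distrib)
      have "?q \<in> core" by (rule core_X[OF q]) auto
      then have 1: "?u ^ Suc a * (?q * ?g ^ N) \<in> half"
        by (rule half_core[OF core_closed(2)[OF core_closed(3)[OF core_X'_i] core_closed(2)[OF _ core_closed(3)[OF core_Y_k]]]])
      have "- (?q * (?g ^ N - ?x ^ N)) \<in> tspan m v X (\<lambda>c. c i \<ge> 1)"
        by (intro tspan_neg E1.A.tspan_mult[OF q lead]) (simp add: vec_apply)
      then have 2: "?u ^ Suc a * (- (?q * (?g ^ N - ?x ^ N))) \<in> half" by (rule pos)
      have "?u ^ Suc a * X c = ?u ^ Suc a * (?q * ?g ^ N) + ?u ^ Suc a * (- (?q * (?g ^ N - ?x ^ N)))"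
        by (subst Xc) (simp only: distrib_left[symmetric] diff_conv_add_uminus)
      then show ?thesis using half_add[OF 1 2] by simp
    qed
  qed
  from Suc.prems show ?case
  proof induction
    case zero
    show ?case by (simp add: half_core core_closed)
  next
    case (step c z y)
    have "?u ^ Suc a * (z * X c + y) = z * (?u ^ Suc a * X c) + ?u ^ Suc a * y"
      using E1.A.coeff_commute[OF step(3), of "?u ^ Suc a"] by (simp only: distrib_left mult.assoc[symmetric])
    then show ?case using step monom by (auto intro: half_add half_scale)
  qed
qed

lemma laurent_both_half:
  assumes "y \<in> laurent m v X" "y \<in> laurent m v X'"
  shows "y \<in> half"
proof -
  obtain y1 y2 where y: "y = y1 + y2" "y1 \<in> tspan m v X (\<lambda>c. c i \<ge> 1)"
    "y2 \<in> tspan m v X' (\<lambda>c. c i \<ge> 0)" using E1.laurent_both[OF assms] by blast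
  have "X' c \<in> half" if c: "vec_on m c" "c i \<ge> 0" for c
  proof -
    let ?n = "nat (c i)"
    let ?e = "smul (c i) (unitv i)"
    \<comment> \<open>The power of the new variable is placed on the left, as
      \<open>half_power_mult\<close> expects.\<close>
    have "X' c = v powi (- bform m L' ?e (proj i c)) * (X' ?e * X' (proj i c))"
      using E1.B.X_add[of ?e "proj i c"] by (simp add: add.commute[of ?e] proj_decomp[symmetric])
    also have "X' (proj i c) = X (proj i c)" by (simp add: E1.same proj_apply)
    also have "X' ?e = X' (unitv i) ^ ?n" using c by (simp add: E1.B.X_power)
    finally have "X' c = v powi (- bform m L' ?e (proj i c)) * (X' (unitv i) ^ ?n * X (proj i c))" .
    moreover have "X (proj i c) \<in> tspan m v X (\<lambda>c. c i \<ge> 0)"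
      using proj_vec_on[OF c(1)] by (rule tspan_monom) (simp add: proj_apply)
    ultimately show ?thesis
      by (simp add: half_scale half_power_mult coeff_ring_closed)
  qed
  with y(3) have "y2 \<in> half"
    by (induction rule: tspan.induct) (auto intro: half_add half_scale half_core core_closed)
  moreover have "y1 \<in> half"
    by (intro half_X tspan_mono[OF y(2)]) auto
  ultimately show ?thesis unfolding y(1) by (intro half_add)
qed

text \<open>Nonnegativity of the \<open>i\<close>-th exponents passes from \<open>X\<close> to
  \<open>Y\<close>: the old \<open>k\<close>-th variable has in \<open>Y\<close> an initial form
  free of the \<open>i\<close>-th variable, so its powers cancel. Splitting by the sign of the
  \<open>k\<close>-th exponent in \<open>Y\<close> then gives one part polynomial in the new
  \<open>k\<close>-th variable and one polynomial in the old one.\<close>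

lemma X_nonneg_laurent_Y:
  assumes t: "t \<in> tspan m v X (\<lambda>c. c i \<ge> 0)" "t \<in> laurent m v Y"
  shows "t \<in> laurent m v W"
proof -
  let ?x = "Y (E2.w r2 - unitv k)" and ?u = "X (unitv k)"
  obtain N :: nat where N: "t \<in> tspan m v X (\<lambda>c. c i \<ge> 0 \<and> - int N \<le> c k)"
    by (rule tspan_lower_bound[OF t(1)])
  have X_Y: "y \<in> tspan m v Y (\<lambda>c. c i \<ge> 0)" if "y \<in> tspan m v X (\<lambda>c. c i \<ge> 0 \<and> c k \<ge> 0)" for y
  proof (rule subsetD[OF tspan_subset that])
    fix c assume c: "vec_on m c" "c i \<ge> 0 \<and> c k \<ge> 0"
    then have "X c \<in> tspan m v Y (\<lambda>e. e k = - c k \<and> (\<forall>j. j \<noteq> k \<longrightarrow> c j \<le> e j))"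
      by (intro edge.X'_tspan[OF S2]) auto
    then show "X c \<in> tspan m v Y (\<lambda>c. c i \<ge> 0)"
      by (rule tspan_mono) (use c ik in force)
  qed
  have Y_X: "y \<in> tspan m v X (\<lambda>c. c i \<ge> 0)" if "y \<in> tspan m v Y (\<lambda>c. c i \<ge> 0 \<and> c k \<ge> 0)" for y
  proof (rule subsetD[OF tspan_subset that])
    fix c assume c: "vec_on m c" "c i \<ge> 0 \<and> c k \<ge> 0"
    then have "Y c \<in> tspan m v X (\<lambda>e. e k = - c k \<and> (\<forall>j. j \<noteq> k \<longrightarrow> c j \<le> e j))"
      by (intro E2.X'_tspan) auto
    then show "Y c \<in> tspan m v X (\<lambda>c. c i \<ge> 0)"
      by (rule tspan_mono) (use c ik in force)
  qed
  have x: "?x \<in> tspan m v Y (\<lambda>c. c i = 0)"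
    using r2_i ik by (intro tspan_monom E2.w_vec) (simp add: vec_apply unitv_other)
  have lead: "?u - ?x \<in> tspan m v Y (\<lambda>c. c i > 0)"
    by (rule edge.X'_i_leading[OF S2, where \<phi> = "\<lambda>c. c i", OF r2])
      (use r2_other ik in \<open>simp add: vec_apply unitv_other\<close>)
  have x_N: "?x ^ N \<in> tspan m v Y (\<lambda>c. c i = 0)"
    using E2.B.tspan_power_leading(1)[where \<phi> = "\<lambda>c. c i", OF _ x lead, of N] by (simp add: vec_apply)
  have lead_N: "?u ^ N - ?x ^ N \<in> tspan m v Y (\<lambda>c. c i > 0)"
    using E2.B.tspan_power_leading(2)[where \<phi> = "\<lambda>c. c i", OF _ x lead, of N] by (simp add: vec_apply)
  \<comment> \<open>This factor clears the negative \<open>k\<close>-th exponents of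
    \<open>t\<close>, so that the product can be expanded in \<open>Y\<close>.\<close>
  have "?u ^ N \<in> tspan m v X (\<lambda>c. c i = 0 \<and> c k = int N)"
    unfolding E1.A.X_power using E2.i_in ik
    by (intro tspan_monom vec_on_closed) (auto simp: vec_apply unitv_other)
  then have "t * ?u ^ N \<in> tspan m v X (\<lambda>c. c i \<ge> 0 \<and> c k \<ge> 0)"
    by (rule E1.A.tspan_mult[OF N]) (auto simp: vec_apply)
  then have "t * (?x ^ N + (?u ^ N - ?x ^ N)) \<in> tspan m v Y (\<lambda>c. c i \<ge> 0)"
    using X_Y by simp
  then have tY: "t \<in> tspan m v Y (\<lambda>c. True \<and> c i \<ge> 0)"
    using E2.B.tspan_cancel_right[where \<phi> = "\<lambda>c. c i", OF _ t(2) x_N _ lead_N, of 0]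
    by (simp add: vec_apply E2.B.X_nonzero)
  obtain t1 t2 where t12: "t = t1 + t2" "t1 \<in> tspan m v Y (\<lambda>c. (True \<and> c i \<ge> 0) \<and> c k \<ge> 0)"
    "t2 \<in> tspan m v Y (\<lambda>c. (True \<and> c i \<ge> 0) \<and> \<not> c k \<ge> 0)" by (rule tspan_split[OF tY])
  have t1: "t1 \<in> laurent m v W"
    by (rule Y_tspan_laurent_W[OF t12(2) _ Y_k_laurent_W]) auto
  have "t1 \<in> tspan m v X (\<lambda>c. c i \<ge> 0)"
    by (rule Y_X, rule tspan_mono[OF t12(2)]) auto
  then have t2: "t2 \<in> tspan m v X (\<lambda>c. c i \<ge> 0)"
    using tspan_diff[OF t(1), of t1] t12(1) by simp
  have "t2 \<in> tspan m v X (\<lambda>c. c k \<ge> 1)"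
    by (rule edge.laurent_both_negative[OF S2 _ tspan_laurent[OF t2]], rule tspan_mono[OF t12(3)]) auto
  then have "t2 \<in> tspan m v X (\<lambda>c. c i \<ge> 0 \<and> c k \<ge> 1)" using t2 by (intro E1.A.tspan_inter)
  then have "t2 \<in> laurent m v W" by (rule X_tspan_laurent_W) auto
  then show ?thesis unfolding t12(1) using t1 by (intro tspan_add)
qed

lemma laurent_W_noncommuting:
  assumes "y \<in> laurent m v X" "y \<in> laurent m v X'" "y \<in> laurent m v Y"
  shows "y \<in> laurent m v W"
proof -
  obtain a b where ab: "y = a + b" "a \<in> core" "b \<in> tspan m v X (\<lambda>c. c i \<ge> 0)"
    using laurent_both_half[OF assms(1,2)] unfolding half_def by blast
  have a: "a \<in> laurent m v Y" "a \<in> laurent m v W" using ab(2) by (auto simp: core_def)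
  have "b \<in> laurent m v Y" using tspan_diff[OF assms(3) a(1)] ab(1) by simp
  then have "b \<in> laurent m v W" by (rule X_nonneg_laurent_Y[OF ab(3)])
  then show ?thesis unfolding ab(1) using a(2) by (intro tspan_add)
qed

end

section \<open>Toric frames\<close>

lemma lprod_Nil [simp]: "lprod f [] = 1"
  by (simp add: lprod_def)

lemma lprod_Cons [simp]: "lprod f (k # ks) = f k * lprod f ks"
  by (simp add: lprod_def)

lemma lprod_append: "lprod f (ks @ ls) = lprod f ks * lprod f ls"
  by (induction ks) (simp_all add: mult.assoc)

lemma lprod_cong: "(\<And>k. k \<in> set ks \<Longrightarrow> f k = g k) \<Longrightarrow> lprod f ks = lprod g ks"
  by (induction ks) simp_all

lemma lprod_one: "(\<And>k. k \<in> set ks \<Longrightarrow> f k = 1) \<Longrightarrow> lprod f ks = 1"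
  by (induction ks) simp_all

text \<open>Agreement is demanded only on the support of \<open>c\<close>; this is why a mutation in
  direction \<open>i\<close> keeps the monomials with \<open>c i = 0\<close>.\<close>

lemma frame_cong:
  assumes "\<And>k. k \<in> {1..m} \<Longrightarrow> c k \<noteq> 0 \<Longrightarrow> x k = x' k" and "\<And>k. k \<in> {1..m} \<Longrightarrow> c k = c' k"
    and "\<And>k l. k \<in> {1..m} \<Longrightarrow> l \<in> {1..m} \<Longrightarrow> c k \<noteq> 0 \<Longrightarrow> c l \<noteq> 0 \<Longrightarrow> L k l = L' k l"
  shows "frame m v x L c = frame m v x' L' c'"
proof -
  have "(\<Sum>k\<in>{1..m}. \<Sum>l\<in>{k<..m}. c k * c l * L k l) =
      (\<Sum>k\<in>{1..m}. \<Sum>l\<in>{k<..m}. c' k * c' l * L' k l)"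
  proof (intro sum.cong refl)
    fix k l assume "k \<in> {1..m}" "l \<in> {k<..m}"
    then have kl: "k \<in> {1..m}" "l \<in> {1..m}" by auto
    then show "c k * c l * L k l = c' k * c' l * L' k l"
      using assms(2)[OF kl(1)] assms(2)[OF kl(2)] assms(3)[OF kl] by auto
  qed
  moreover have "lprod (\<lambda>k. x k powi c k) [1..<m+1] = lprod (\<lambda>k. x' k powi c' k) [1..<m+1]"
  proof (rule lprod_cong)
    fix k assume "k \<in> set [1..<m+1]"
    then have k: "k \<in> {1..m}" by auto
    then show "x k powi c k = x' k powi c' k"
      using assms(1,2)[OF k] by (cases "c k = 0") auto
  qed
  ultimately show ?thesis by (simp add: frame_def)
qed

lemma frame_unitv:
  assumes "k \<in> {1..m}" shows "frame m v x L (unitv k) = x k"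
proof -
  have "(\<Sum>a\<in>{1..m}. \<Sum>b\<in>{a<..m}. unitv k a * unitv k b * L a b) = 0"
    by (intro sum.neutral ballI) (auto simp: unitv_def)
  moreover have "[1..<m+1] = [1..<k] @ k # [k+1..<m+1]"
    using assms upt_add_eq_append[of 1 k "m + 1 - k"] upt_conv_Cons[of k "m+1"] by auto
  then have "lprod (\<lambda>l. x l powi unitv k l) [1..<m+1] = x k"
    by (simp only: lprod_append lprod_Cons) (subst lprod_one, force simp: unitv_def, subst lprod_one, auto simp: unitv_def)
  ultimately show ?thesis by (simp add: frame_def)
qed

lemma bform_Suc:
  "bform (Suc m) L c e = bform m L c e + (\<Sum>k\<in>{1..m}. c k * L k (Suc m)) * e (Suc m) +
    c (Suc m) * (\<Sum>k\<in>{1..m}. L (Suc m) k * e k) + c (Suc m) * L (Suc m) (Suc m) * e (Suc m)"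
  by (simp add: bform_def sum.distrib sum_distrib_left sum_distrib_right mult.assoc)

context central_unit
begin

lemma frame_Suc:
  "frame (Suc m) v x L c =
    v powi (- (\<Sum>k\<in>{1..m}. c k * c (Suc m) * L k (Suc m))) * (frame m v x L c * x (Suc m) powi c (Suc m))"
proof -
  have "(\<Sum>k\<in>{1..Suc m}. \<Sum>l\<in>{k<..Suc m}. c k * c l * L k l) =
      (\<Sum>k\<in>{1..m}. \<Sum>l\<in>{k<..Suc m}. c k * c l * L k l)"
    by simp
  also have "\<dots> = (\<Sum>k\<in>{1..m}. (\<Sum>l\<in>{k<..m}. c k * c l * L k l) + c k * c (Suc m) * L k (Suc m))"
  proof (intro sum.cong refl)
    fix k assume k: "k \<in> {1..m}"
    then have "{k<..Suc m} = insert (Suc m) {k<..m}" by auto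
    then show "(\<Sum>l\<in>{k<..Suc m}. c k * c l * L k l) =
        (\<Sum>l\<in>{k<..m}. c k * c l * L k l) + c k * c (Suc m) * L k (Suc m)"
      by (simp add: add.commute)
  qed
  finally have "(\<Sum>k\<in>{1..Suc m}. \<Sum>l\<in>{k<..Suc m}. c k * c l * L k l) =
      (\<Sum>k\<in>{1..m}. c k * c (Suc m) * L k (Suc m)) + (\<Sum>k\<in>{1..m}. \<Sum>l\<in>{k<..m}. c k * c l * L k l)"
    by (simp add: sum.distrib add.commute)
  moreover have "lprod (\<lambda>k. x k powi c k) [1..<Suc m + 1] =
      lprod (\<lambda>k. x k powi c k) [1..<m + 1] * x (Suc m) powi c (Suc m)"
    by (simp add: lprod_append)
  ultimately show ?thesis
    by (simp only: frame_def minus_add_distrib powi_add[symmetric] mult.assoc)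
qed


lemma quasi_commute_powi:
  assumes "x \<noteq> 0" "y \<noteq> 0" "x * y = v powi z * (y * x)"
  shows "x powi a * y powi b = v powi (a * b * z) * (y powi b * x powi a)"
proof -
  have inv: "x * inverse y = v powi (- z) * (inverse y * x)"
    if "y \<noteq> 0" "x * y = v powi z * (y * x)" for x y z
  proof -
    have "inverse y * x = inverse y * (x * y) * inverse y"
      using that(1) by (simp add: mult.assoc)
    also have "\<dots> = v powi z * (inverse y * (y * x)) * inverse y"
      by (simp only: that(2) powi_left_commute)
    also have "inverse y * (y * x) = x" using that(1) by (simp flip: mult.assoc)
    also have "v powi z * x * inverse y = v powi z * (x * inverse y)" by (rule mult.assoc)
    finally show ?thesis by (simp add: powi_add_left)
  qed
  have pow: "x * y ^ n = v powi (int n * z) * (y ^ n * x)"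
    if "x * y = v powi z * (y * x)" for x y z and n :: nat
  proof (induction n)
    case (Suc n)
    have "x * y ^ Suc n = x * y * y ^ n" by (simp add: mult.assoc)
    also have "\<dots> = v powi z * (y * (x * y ^ n))" by (simp add: that mult.assoc)
    also have "\<dots> = v powi z * (v powi (int n * z) * (y * (y ^ n * x)))"
      unfolding Suc powi_left_commute[of y] ..
    finally show ?case by (simp add: powi_add_left mult.assoc algebra_simps)
  qed simp
  have powi: "x * y powi b = v powi (b * z) * (y powi b * x)"
    if "y \<noteq> 0" "x * y = v powi z * (y * x)" for x y z b
  proof (cases "b \<ge> 0")
    case True
    then show ?thesis using pow[OF that(2), of "nat b"] by (simp add: power_int_def)
  next
    case False
    then show ?thesis using pow[OF inv[OF that], of "nat (- b)"] by (simp add: power_int_def)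
  qed
  have swap: "y * x = v powi (- z) * (x * y)" if "x * y = v powi z * (y * x)" for x y z
    using that by (simp add: powi_add_left)
  have "y powi b * x = v powi (- (b * z)) * (x * y powi b)"
    using swap[OF powi[OF assms(2,3)]] .
  from swap[OF powi[OF assms(1) this]] show ?thesis by (simp add: algebra_simps)
qed

text \<open>Induction on the number of variables: in the product only a power of the last variable
  has to pass the earlier ones, and the scalar gained there combines with the normalizing exponents
  of the frames to the value of the form.\<close>

lemma frame_mult:
  assumes x_nz: "\<And>k. k \<in> {1..m} \<Longrightarrow> x k \<noteq> 0"
    and skew: "\<And>k l. k \<in> {1..m} \<Longrightarrow> l \<in> {1..m} \<Longrightarrow> L k l = - L l k"
    and comm: "\<And>k l. k \<in> {1..m} \<Longrightarrow> l \<in> {1..m} \<Longrightarrow> x k * x l = v powi (2 * L k l) * (x l * x k)"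
  shows "frame m v x L c * frame m v x L e = v powi bform m L c e * frame m v x L (c + e)"
  using assms
proof (induction m)
  case 0
  show ?case by (simp add: frame_def bform_def)
next
  case (Suc m)
  let ?F = "frame m v x L" and ?y = "x (Suc m)" and ?a = "c (Suc m)" and ?b = "e (Suc m)"
  let ?S = "\<lambda>c. \<Sum>k\<in>{1..m}. c k * L k (Suc m)"
  have IH: "?F c * ?F e = v powi bform m L c e * ?F (c + e)"
    by (rule Suc.IH) (rule Suc.prems; simp)+
  have frame: "frame (Suc m) v x L c = v powi (- c (Suc m) * ?S c) * (?F c * ?y powi c (Suc m))" for c
    by (simp add: frame_Suc sum_distrib_left sum_distrib_right sum_negf mult.commute mult.left_commute)
  have comm_y: "?y powi ?a * lprod (\<lambda>k. x k powi e k) ks =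
      v powi (\<Sum>k\<leftarrow>ks. 2 * ?a * e k * L (Suc m) k) * (lprod (\<lambda>k. x k powi e k) ks * ?y powi ?a)"
    if "set ks \<subseteq> {1..m}" for ks
    using that
  proof (induction ks)
    case (Cons k ks)
    let ?P = "lprod (\<lambda>k. x k powi e k) ks" and ?s = "\<Sum>k\<leftarrow>ks. 2 * ?a * e k * L (Suc m) k"
    have k: "k \<in> {1..Suc m}" using Cons.prems by auto
    have "?y powi ?a * (x k powi e k * ?P) = ?y powi ?a * x k powi e k * ?P" by (simp add: mult.assoc)
    also have "?y powi ?a * x k powi e k = v powi (?a * e k * (2 * L (Suc m) k)) * (x k powi e k * ?y powi ?a)"
      using k by (intro quasi_commute_powi Suc.prems) auto
    also have "\<dots> * ?P = v powi (?a * e k * (2 * L (Suc m) k)) * (x k powi e k * (?y powi ?a * ?P))"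
      by (simp add: mult.assoc)
    also have "?y powi ?a * ?P = v powi ?s * (?P * ?y powi ?a)" using Cons by simp
    also have "x k powi e k * \<dots> = v powi ?s * (x k powi e k * (?P * ?y powi ?a))"
      by (rule powi_left_commute)
    finally show ?case by (simp add: powi_add_left mult.assoc algebra_simps)
  qed simp
  have "(\<Sum>k\<leftarrow>[1..<m+1]. 2 * ?a * e k * L (Suc m) k) = (\<Sum>k\<in>{1..m}. 2 * ?a * e k * L (Suc m) k)"
    by (subst sum_list_distinct_conv_sum_set) (auto intro!: sum.cong)
  also have "\<dots> = - 2 * ?a * ?S e"
  proof -
    have "(\<Sum>k\<in>{1..m}. 2 * ?a * e k * L (Suc m) k) = (\<Sum>k\<in>{1..m}. - 2 * ?a * (e k * L k (Suc m)))"
      by (intro sum.cong refl) (use Suc.prems(2)[of "Suc m"] in \<open>simp add: mult.assoc\<close>)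
    then show ?thesis by (simp only: sum_distrib_left)
  qed
  finally have exponent: "(\<Sum>k\<leftarrow>[1..<m+1]. 2 * ?a * e k * L (Suc m) k) = - 2 * ?a * ?S e" .
  have "?y powi ?a * ?F e = v powi (- 2 * ?a * ?S e) * (?F e * ?y powi ?a)"
  proof -
    let ?P = "lprod (\<lambda>k. x k powi e k) [1..<m+1]"
    define s where "s = - (\<Sum>k\<in>{1..m}. \<Sum>l\<in>{k<..m}. e k * e l * L k l)"
    have F: "?F e = v powi s * ?P" by (simp only: frame_def s_def)
    have "?y powi ?a * ?F e = v powi s * (?y powi ?a * ?P)"
      unfolding F by (rule powi_left_commute)
    also have "?y powi ?a * ?P = v powi (- 2 * ?a * ?S e) * (?P * ?y powi ?a)"
    proof -
      have "set [1..<m+1] \<subseteq> {1..m}" by auto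
      from comm_y[OF this] show ?thesis unfolding exponent .
    qed
    also have "v powi s * \<dots> = v powi (- 2 * ?a * ?S e) * (?F e * ?y powi ?a)"
      unfolding F by (simp only: powi_add_left mult.assoc add.commute)
    finally show ?thesis .
  qed
  then have "?F c * ?y powi ?a * (?F e * ?y powi ?b) =
      ?F c * (v powi (- 2 * ?a * ?S e) * (?F e * ?y powi ?a)) * ?y powi ?b"
    by (simp add: mult.assoc) (simp add: mult.assoc[symmetric])
  also have "\<dots> = v powi (- 2 * ?a * ?S e) * (?F c * ?F e) * (?y powi ?a * ?y powi ?b)"
    by (simp add: powi_left_commute[of "?F c"] mult.assoc)
  also have "\<dots> = v powi (- 2 * ?a * ?S e + bform m L c e) * (?F (c + e) * ?y powi (?a + ?b))"
    using Suc.prems(1)[of "Suc m"] by (simp add: IH power_int_add mult.assoc powi_add_left)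
  finally have prod: "?F c * ?y powi ?a * (?F e * ?y powi ?b) =
    v powi (- 2 * ?a * ?S e + bform m L c e) * (?F (c + e) * ?y powi (?a + ?b))" .
  have "frame (Suc m) v x L c * frame (Suc m) v x L e =
      v powi (- ?a * ?S c + - ?b * ?S e) * (?F c * ?y powi ?a * (?F e * ?y powi ?b))"
    unfolding frame by (rule powi_mult)
  also have "\<dots> = v powi (- ?a * ?S c + - ?b * ?S e + (- 2 * ?a * ?S e + bform m L c e) +
      (?a + ?b) * (?S c + ?S e)) * frame (Suc m) v x L (c + e)"
  proof -
    have S_ce: "?S (c + e) = ?S c + ?S e" "(c + e) (Suc m) = ?a + ?b"
      by (simp_all add: plus_fun_apply distrib_right sum.distrib)
    have ce: "frame (Suc m) v x L (c + e) =
        v powi (- ((?a + ?b) * (?S c + ?S e))) * (?F (c + e) * ?y powi (?a + ?b))"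
      by (simp only: frame[of "c + e"] S_ce minus_mult_left)
    show ?thesis unfolding prod ce powi_add_left by (simp only: add.assoc right_minus add_0_right)
  qed
  also have "- ?a * ?S c + - ?b * ?S e + (- 2 * ?a * ?S e + bform m L c e) + (?a + ?b) * (?S c + ?S e) =
      bform (Suc m) L c e"
  proof -
    have "L (Suc m) (Suc m) = 0" using Suc.prems(2)[of "Suc m" "Suc m"] by simp
    moreover have "(\<Sum>k\<in>{1..m}. L (Suc m) k * e k) = - ?S e"
      unfolding sum_negf[symmetric]
      by (intro sum.cong refl) (use Suc.prems(2)[of "Suc m"] in simp)
    ultimately show ?thesis by (simp add: bform_Suc algebra_simps)
  qed
  finally show ?case .
qed

end

section \<open>Mutation of a toric frame\<close>

lemma bform_expand_left:
  "bform m L c b = (\<Sum>k\<in>{1..m}. c k * bform m L (unitv k) b)"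
proof -
  have "bform m L c b = (\<Sum>k\<in>{1..m}. c k * (\<Sum>l\<in>{1..m}. L k l * b l))"
    by (simp add: bform_def sum_distrib_left mult.assoc)
  also have "\<dots> = (\<Sum>k\<in>{1..m}. c k * bform m L (unitv k) b)"
    by (intro sum.cong refl) (simp add: bform_unitv_left)
  finally show ?thesis .
qed

lemma bform_expand_right:
  "bform m L b c = (\<Sum>k\<in>{1..m}. c k * bform m L b (unitv k))"
proof -
  have "bform m L b c = (\<Sum>k\<in>{1..m}. c k * (\<Sum>l\<in>{1..m}. b l * L l k))"
    unfolding bform_def by (subst sum.swap) (simp add: sum_distrib_left mult.assoc mult.commute mult.left_commute)
  also have "\<dots> = (\<Sum>k\<in>{1..m}. c k * bform m L b (unitv k))"
    by (intro sum.cong refl) (simp add: bform_unitv_right)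
  finally show ?thesis .
qed

text \<open>For \<open>g = E e\<^sub>i\<close> this is multiplication by the matrix \<open>E\<close> of the mutation in direction \<open>i\<close>.\<close>

definition subst_vec :: "nat \<Rightarrow> (nat \<Rightarrow> int) \<Rightarrow> (nat \<Rightarrow> int) \<Rightarrow> nat \<Rightarrow> int" where
  "subst_vec i g c = c + smul (c i) (g - unitv i)"

lemma bform_subst_vec:
  assumes i: "i \<in> {1..m}"
    and L': "\<And>k l. k \<in> {1..m} \<Longrightarrow> l \<in> {1..m} \<Longrightarrow>
      L' k l = bform m L (if k = i then g else unitv k) (if l = i then g else unitv l)"
  shows "bform m L' a b = bform m L (subst_vec i g a) (subst_vec i g b)"
proof -
  have left: "bform m L (subst_vec i g a) b =
      (\<Sum>k\<in>{1..m}. a k * bform m L (if k = i then g else unitv k) b)" for a b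
  proof -
    have "(\<Sum>k\<in>{1..m}. a k * bform m L (if k = i then g else unitv k) b) =
        (\<Sum>k\<in>{1..m}. a k * bform m L (unitv k) b +
          (if k = i then a i * (bform m L g b - bform m L (unitv i) b) else 0))"
      by (intro sum.cong refl) (simp add: algebra_simps)
    also have "\<dots> = bform m L a b + a i * (bform m L g b - bform m L (unitv i) b)"
      using i by (simp add: sum.distrib bform_expand_left[of m L a b])
    finally show ?thesis by (simp add: subst_vec_def bform_linear)
  qed
  have right: "bform m L a (subst_vec i g b) =
      (\<Sum>k\<in>{1..m}. b k * bform m L a (if k = i then g else unitv k))" for a b
  proof -
    have "(\<Sum>k\<in>{1..m}. b k * bform m L a (if k = i then g else unitv k)) =
        (\<Sum>k\<in>{1..m}. b k * bform m L a (unitv k) +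
          (if k = i then b i * (bform m L a g - bform m L a (unitv i)) else 0))"
      by (intro sum.cong refl) (simp add: algebra_simps)
    also have "\<dots> = bform m L a b + b i * (bform m L a g - bform m L a (unitv i))"
      using i by (simp add: sum.distrib bform_expand_right[of m L a b])
    finally show ?thesis by (simp add: subst_vec_def bform_linear)
  qed
  have "bform m L' a b = (\<Sum>k\<in>{1..m}. a k * (\<Sum>l\<in>{1..m}. b l * L' k l))"
    by (simp add: bform_def sum_distrib_left algebra_simps)
  also have "\<dots> = (\<Sum>k\<in>{1..m}. a k * (\<Sum>l\<in>{1..m}. b l *
      bform m L (if k = i then g else unitv k) (if l = i then g else unitv l)))"
    by (intro sum.cong refl arg_cong2[of _ _ _ _ "(*)"]) (simp add: L')
  finally show ?thesis unfolding left[of a "subst_vec i g b"] unfolding right .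
qed

text \<open>A relation among monomials of \<open>X'\<close> is multiplied by a power of
  \<open>X' (unitv i)\<close> that clears negative \<open>i\<close>-th exponents. Its parts of
  different \<open>i\<close>-th exponent have different degrees in \<open>X\<close> and vanish
  separately; within one part the power of \<open>X' (unitv i)\<close> cancels and a relation in
  \<open>X\<close> remains.\<close>

lemma (in qtorus) mutated_qtorus:
  assumes X'_mult: "\<And>c e. X' c * X' e = v powi bform m L' c e * X' (c + e)"
    and skew': "\<And>k l. k \<in> {1..m} \<Longrightarrow> l \<in> {1..m} \<Longrightarrow> L' k l = - L' l k"
    and i: "i \<in> {1..m}" and same: "\<And>c. c i = 0 \<Longrightarrow> X' c = X c"
    and u: "X' (unitv i) \<in> tspan m v X (\<lambda>e. e i = -1)" "X' (unitv i) \<noteq> 0"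
  shows "qtorus v m L' X'"
proof unfold_locales
  show "X' c * X' e = v powi bform m L' c e * X' (c + e)" for c e by (rule X'_mult)
  show "L' k l = - L' l k" if "k \<in> {1..m}" "l \<in> {1..m}" for k l by (rule skew'[OF that])
  fix S and \<kappa> :: "(nat \<Rightarrow> int) \<Rightarrow> 'a" and c0
  assume S: "finite S" and \<kappa>: "\<And>c. c \<in> S \<Longrightarrow> vec_on m c \<and> \<kappa> c \<in> coeff_ring v"
    and sum0: "(\<Sum>c\<in>S. \<kappa> c * X' c) = 0" and c0: "c0 \<in> S"
  let ?u = "X' (unitv i)"
  have form_ii: "bform m L' (unitv i) (unitv i) = 0"
    using bform_skew[of m L' "unitv i" "unitv i", OF skew'] by simp
  have u_power: "?u ^ n = X' (smul (int n) (unitv i))" for n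
  proof (induction n)
    case 0
    have "smul (int 0) (unitv i) = 0" by (simp add: fun_eq_iff vec_apply)
    moreover have "X' 0 = 1" using same[of 0] by (simp add: X_zero zero_fun_apply)
    ultimately show ?case by (simp only: power_0)
  next
    case (Suc n)
    have "smul (int (Suc n)) (unitv i) = unitv i + smul (int n) (unitv i)"
      by (simp add: fun_eq_iff vec_apply algebra_simps)
    then show ?case
      using X'_mult[of "unitv i" "smul (int n) (unitv i)"] by (simp add: Suc bform_linear form_ii)
  qed
  define N where "N = nat (Max ((\<lambda>c. \<bar>c i\<bar>) ` S))"
  have N: "c i + int N \<ge> 0" if "c \<in> S" for c
  proof -
    have "\<bar>c i\<bar> \<le> Max ((\<lambda>c. \<bar>c i\<bar>) ` S)" using S that by (intro Max_ge) auto
    then show ?thesis by (auto simp: N_def)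
  qed
  define \<alpha> where "\<alpha> c = bform m L' c (smul (int N) (unitv i)) -
    bform m L' (proj i c) (smul (c i + int N) (unitv i))" for c
  have shift: "X' c * ?u ^ N = v powi \<alpha> c * (X (proj i c) * ?u ^ nat (c i + int N))" if "c \<in> S" for c
  proof -
    have "X' c * ?u ^ N = v powi bform m L' c (smul (int N) (unitv i)) * X' (c + smul (int N) (unitv i))"
      unfolding u_power by (rule X'_mult)
    moreover have "c + smul (int N) (unitv i) = proj i c + smul (c i + int N) (unitv i)"
      by (simp add: fun_eq_iff vec_apply proj_apply unitv_def)
    moreover have "X (proj i c) * ?u ^ nat (c i + int N) =
        v powi bform m L' (proj i c) (smul (c i + int N) (unitv i)) * X' (proj i c + smul (c i + int N) (unitv i))"
      using X'_mult[of "proj i c" "smul (c i + int N) (unitv i)"] N[OF that]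
      by (simp add: u_power same proj_apply)
    ultimately show ?thesis by (simp add: \<alpha>_def powi_add_left)
  qed
  define s where "s j = (\<Sum>c\<in>{c\<in>S. c i = j}. (\<kappa> c * v powi \<alpha> c) * X (proj i c))" for j
  define t where "t j = s j * ?u ^ nat (j + int N)" for j
  let ?J = "(\<lambda>c. c i) ` S"
  have "(\<Sum>j\<in>?J. t j) = (\<Sum>j\<in>?J. \<Sum>c\<in>{c\<in>S. c i = j}. \<kappa> c * (X' c * ?u ^ N))"
    unfolding t_def s_def sum_distrib_right
    by (intro sum.cong refl) (simp add: shift mult.assoc)
  also have "\<dots> = (\<Sum>c\<in>S. \<kappa> c * (X' c * ?u ^ N))"
    by (rule sum.group) (use S in auto)
  also have "\<dots> = (\<Sum>c\<in>S. \<kappa> c * X' c) * ?u ^ N"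
    by (simp add: sum_distrib_right mult.assoc)
  finally have t0: "(\<Sum>j\<in>?J. t j) = 0" by (simp add: sum0)
  have u_span: "?u ^ n \<in> tspan m v X (\<lambda>c. c i = - int n)" for n
    using tspan_power_leading(1)[where \<phi> = "\<lambda>c. c i", OF _ u(1) tspan.zero, of n]
    by (simp add: plus_fun_apply)
  have t_span: "t j \<in> tspan m v X (\<lambda>e. e i = - (j + int N))" if "j \<in> ?J" for j
  proof -
    have "s j \<in> tspan m v X (\<lambda>e. e i = 0)"
      unfolding s_def
      by (intro tspan_sum tspan_scaled_monom proj_vec_on coeff_ring_closed(6,8)) (use \<kappa> in \<open>auto simp: proj_apply\<close>)
    then have "t j \<in> tspan m v X (\<lambda>e. e i = - int (nat (j + int N)))"
      unfolding t_def by (rule tspan_mult[OF _ u_span]) (simp add: plus_fun_apply)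
    then show ?thesis using N that by auto
  qed
  let ?j = "c0 i"
  have "t ?j = 0"
  proof (rule tspan_disjoint)
    show "t ?j \<in> tspan m v X (\<lambda>e. e i = - (?j + int N))" using c0 by (intro t_span) auto
    have "t ?j = - (\<Sum>j\<in>?J - {?j}. t j)"
      using t0 sum.remove[of ?J ?j t] S c0 by (simp add: eq_neg_iff_add_eq_0)
    also have "\<dots> \<in> tspan m v X (\<lambda>e. e i \<noteq> - (?j + int N))"
      by (intro tspan_neg tspan_sum tspan_mono[OF t_span]) auto
    finally show "t ?j \<in> tspan m v X (\<lambda>e. e i \<noteq> - (?j + int N))" .
  qed simp
  then have "s ?j = 0" using u(2) by (simp add: t_def)
  let ?S = "{c\<in>S. c i = ?j}"
  \<comment> \<open>On one slice the \<open>i\<close>-th coordinate is constant, so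
    \<open>proj i\<close> loses no information.\<close>
  have upd: "(proj i c)(i := ?j) = c" if "c \<in> ?S" for c
    using that by (auto simp: proj_def)
  have inj: "inj_on (proj i) ?S"
    by (rule inj_on_inverseI[where g = "\<lambda>c. c(i := ?j)"]) (rule upd)
  define \<kappa>' where "\<kappa>' e = \<kappa> (e(i := ?j)) * v powi \<alpha> (e(i := ?j))" for e
  have "(\<Sum>e\<in>proj i ` ?S. \<kappa>' e * X e) = s ?j"
    unfolding s_def sum.reindex[OF inj] comp_def by (intro sum.cong refl) (simp add: \<kappa>'_def upd)
  then have sum': "(\<Sum>e\<in>proj i ` ?S. \<kappa>' e * X e) = 0" using \<open>s ?j = 0\<close> by simp
  have "\<kappa>' (proj i c0) = 0"
  proof (rule X_indep[OF _ _ sum'])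
    show "finite (proj i ` ?S)" using S by simp
    show "proj i c0 \<in> proj i ` ?S" using c0 by simp
    fix e assume "e \<in> proj i ` ?S"
    then obtain c where c: "c \<in> ?S" "e = proj i c" by blast
    then show "vec_on m e \<and> \<kappa>' e \<in> coeff_ring v"
      using \<kappa>[of c] upd[of c] by (auto simp: \<kappa>'_def intro: coeff_ring_closed(6,8))
  qed
  then show "\<kappa> c0 = 0" using upd[of c0] c0 v_nz by (simp add: \<kappa>'_def)
qed

text \<open>Only the original frame is assumed to be a quantum torus; the mutated torus and the
  reverse relation needed for \<open>edge\<close> are derived. Positivity of \<open>\<delta>\<close>
  makes the pairing with \<open>unitv i\<close> a grading that separates the terms of the exchange
  polynomial.\<close>

locale exchange = qtorus v m L "frame m v x L" for v :: "'a::division_ring" and m L x +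
  fixes i :: nat and w0 bt :: "nat \<Rightarrow> int" and \<delta> :: int and D :: nat and h :: "nat \<Rightarrow> 'a"
    and x' :: "nat \<Rightarrow> 'a" and L' :: "nat \<Rightarrow> nat \<Rightarrow> int"
  assumes i_in: "i \<in> {1..m}"
    and w0_vec: "vec_on m w0" and bt_vec: "vec_on m bt" and w0_i: "w0 i = 0" and bt_i: "bt i = 0"
    and h_coeff: "r \<le> D \<Longrightarrow> h r \<in> coeff_ring v" and h_sym: "r \<le> D \<Longrightarrow> h r = h (D - r)"
    and h_first: "h 0 = 1"
    and w_nonneg: "r \<le> D \<Longrightarrow> 0 \<le> w0 j + int r * bt j"
    and form_bt: "bform m L c bt = - c i * \<delta>" and \<delta>_pos: "\<delta> > 0"
    and x'_i: "x' i = (\<Sum>r\<in>{0..D}. h r * frame m v x L (w0 + smul (int r) bt - unitv i))"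
    and x'_other: "j \<noteq> i \<Longrightarrow> x' j = x j"
    and L': "k \<in> {1..m} \<Longrightarrow> l \<in> {1..m} \<Longrightarrow>
      L' k l = bform m L (if k = i then w0 - unitv i else unitv k) (if l = i then w0 - unitv i else unitv l)"
begin

abbreviation "X \<equiv> frame m v x L"
abbreviation "X' \<equiv> frame m v x' L'"
abbreviation "w \<equiv> (\<lambda>r. w0 + smul (int r) bt)"

lemma form': "bform m L' a b = bform m L (subst_vec i (w0 - unitv i) a) (subst_vec i (w0 - unitv i) b)"
  by (rule bform_subst_vec[OF i_in L'])

lemma skew': assumes "k \<in> {1..m}" "l \<in> {1..m}" shows "L' k l = - L' l k"
  unfolding L'[OF assms] L'[OF assms(2,1)] by (rule form_skew)

lemma form_bt_left: "bform m L bt c = c i * \<delta>"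
  using form_skew[of bt c] by (simp add: form_bt)

lemma X_unitv: "k \<in> {1..m} \<Longrightarrow> X (unitv k) = x k"
  by (rule frame_unitv)

lemma X'_unitv: "k \<in> {1..m} \<Longrightarrow> X' (unitv k) = x' k"
  by (rule frame_unitv)

lemma same: "c i = 0 \<Longrightarrow> X' c = X c"
proof (rule frame_cong)
  fix k l assume "k \<in> {1..m}" "l \<in> {1..m}" "c i = 0" "c k \<noteq> 0" "c l \<noteq> 0"
  then show "L' k l = L k l" by (auto simp: L' bform_unitv_unitv)
qed (metis x'_other, simp)

lemma x'_i_tspan: "x' i \<in> tspan m v X (\<lambda>e. e i = -1)"
  unfolding x'_i using w0_vec bt_vec i_in
  by (intro tspan_sum tspan_scaled_monom vec_on_closed)
    (auto simp: vec_apply w0_i bt_i h_coeff)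

text \<open>In the grading by the pairing with \<open>unitv i\<close> the term \<open>r = 0\<close>
  is strictly lowest, so the other terms cannot cancel it.\<close>

lemma x'_i_nonzero: "x' i \<noteq> 0"
proof
  assume x'_0: "x' i = 0"
  let ?\<phi> = "\<lambda>c. bform m L c (unitv i)"
  let ?l = "X (w0 - unitv i)"
  have "smul (int 0) bt = 0" by (simp add: fun_eq_iff vec_apply)
  then have "x' i = ?l + (\<Sum>r\<in>{0..D} - {0}. h r * X (w r - unitv i))"
    unfolding x'_i by (subst sum.remove[of _ 0]) (auto simp: h_first)
  then have "?l = - (\<Sum>r\<in>{0..D} - {0}. h r * X (w r - unitv i))"
    using x'_0 by (simp add: eq_neg_iff_add_eq_0)
  also have "\<dots> \<in> tspan m v X (\<lambda>c. ?\<phi> c > ?\<phi> (w0 - unitv i))"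
    using w0_vec bt_vec i_in \<delta>_pos
    by (intro tspan_neg tspan_sum tspan_scaled_monom vec_on_closed)
      (auto simp: bform_linear form_bt_left h_coeff)
  finally have "?l \<in> tspan m v X (\<lambda>c. ?\<phi> c > ?\<phi> (w0 - unitv i))" .
  moreover have "?l \<in> tspan m v X (\<lambda>c. c = w0 - unitv i)"
    using w0_vec i_in by (intro tspan_monom vec_on_closed) auto
  ultimately have "?l = 0" by (rule tspan_disjoint) auto
  then show False by (simp add: X_nonzero)
qed

text \<open>As \<open>bt\<close> pairs to 0 with \<open>unitv k\<close>, all terms of
  \<open>x' i\<close> quasi-commute with \<open>x k\<close> by the same power of
  \<open>v\<close>.\<close>

lemma x_commute_x'_i:
  assumes k: "k \<in> {1..m}" "k \<noteq> i"
  shows "x k * x' i = v powi (2 * L' k i) * (x' i * x k)"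
proof -
  have "X (unitv k) * (h r * X (w r - unitv i)) =
      v powi (2 * L' k i) * (h r * X (w r - unitv i) * X (unitv k))" if "r \<le> D" for r
  proof -
    have "bform m L (unitv k) (w r - unitv i) = L' k i"
      using k i_in by (simp add: L' bform_linear form_bt unitv_other)
    then have "X (unitv k) * X (w r - unitv i) = v powi (2 * L' k i) * (X (w r - unitv i) * X (unitv k))"
      using X_commute[of "unitv k" "w r - unitv i"] by simp
    moreover have "X (unitv k) * (h r * X (w r - unitv i)) = h r * (X (unitv k) * X (w r - unitv i))"
      using coeff_commute[OF h_coeff[OF that], of "X (unitv k)"] by (simp add: mult.assoc[symmetric])
    ultimately show ?thesis by (simp only: powi_left_commute mult.assoc)
  qed
  then show ?thesis
    unfolding x'_i X_unitv[OF k(1), symmetric] sum_distrib_left sum_distrib_right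
    by (intro sum.cong refl) simp
qed

lemma x'_commute:
  assumes k: "k \<in> {1..m}" and l: "l \<in> {1..m}"
  shows "x' k * x' l = v powi (2 * L' k l) * (x' l * x' k)"
proof -
  consider "k = i" "l = i" | "k \<noteq> i" "l = i" | "k = i" "l \<noteq> i" | "k \<noteq> i" "l \<noteq> i" by blast
  then show ?thesis
  proof cases
    case 1
    then show ?thesis using skew'[of i i] i_in by simp
  next
    case 2
    then show ?thesis using x_commute_x'_i[OF k] by (simp add: x'_other)
  next
    case 3
    then have "x l * x' i = v powi (- (2 * L' k l)) * (x' i * x l)"
      using x_commute_x'_i[OF l] skew'[OF k l] by simp
    then show ?thesis using 3 by (simp add: x'_other powi_add_left)
  next
    case 4
    then show ?thesis
      using X_commute[of "unitv k" "unitv l"] k l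
      by (simp add: X_unitv x'_other L' bform_unitv_unitv)
  qed
qed

lemma qtorus': "qtorus v m L' X'"
proof (rule mutated_qtorus[OF _ skew' i_in same])
  show "X' c * X' e = v powi bform m L' c e * X' (c + e)" for c e
  proof (rule frame_mult)
    show "x' k \<noteq> 0" if "k \<in> {1..m}" for k
      using x'_i_nonzero X_nonzero[of "unitv k"] X_unitv[OF that] by (cases "k = i") (auto simp: x'_other)
  qed (fact skew' x'_commute)+
  show "X' (unitv i) \<in> tspan m v X (\<lambda>e. e i = -1)" "X' (unitv i) \<noteq> 0"
    using x'_i_tspan x'_i_nonzero by (simp_all add: X'_unitv[OF i_in])
qed

sublocale T': qtorus v m L' X'
  by (rule qtorus')

text \<open>After right multiplication by \<open>X' (unitv i)\<close> both sides become the same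
  combination of the monomials \<open>X (w r)\<close>, which the two frames share.\<close>

lemma exchange_reverse: "X (unitv i) = (\<Sum>r\<in>{0..D}. h r * X' (w r - unitv i))"
proof -
  let ?e = "unitv i"
  have wi: "w r i = 0" for r by (simp add: vec_apply w0_i bt_i)
  have form_w: "bform m L' (w r) ?e = bform m L ?e (w r)" for r
  proof -
    have "subst_vec i (w0 - ?e) (w r) = w r" "subst_vec i (w0 - ?e) ?e = w0 - ?e"
      unfolding subst_vec_def wi by (simp_all add: fun_eq_iff vec_apply)
    then show ?thesis
      using form_skew[of "w r" ?e]
      by (simp add: form') (simp add: bform_linear form_bt_left form_self w0_i)
  qed
  have "(\<Sum>r\<in>{0..D}. h r * X' (w r - ?e)) * X' ?e = (\<Sum>r\<in>{0..D}. h r * (v powi bform m L ?e (w r) * X (w r)))"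
    unfolding sum_distrib_right
  proof (intro sum.cong refl)
    fix r
    have "X' (w r - ?e) * X' ?e = v powi bform m L' (w r - ?e) ?e * X' (w r - ?e + ?e)"
      by (rule T'.X_mult)
    also have "bform m L' (w r - ?e) ?e = bform m L' (w r) ?e"
      using T'.form_self[of ?e] by (simp add: bform_diff_left)
    finally show "h r * X' (w r - ?e) * X' ?e = h r * (v powi bform m L ?e (w r) * X (w r))"
      unfolding form_w using same[of "w r", OF wi] by (simp add: mult.assoc)
  qed
  also have "\<dots> = X ?e * X' ?e"
    unfolding X'_unitv[OF i_in] x'_i sum_distrib_left
  proof (intro sum.cong refl)
    fix r assume "r \<in> {0..D}"
    then have hr: "h r \<in> coeff_ring v" using h_coeff by simp
    have "X ?e * X (w r - ?e) = v powi bform m L ?e (w r - ?e) * X (?e + (w r - ?e))"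
      by (rule X_mult)
    also have "bform m L ?e (w r - ?e) = bform m L ?e (w r)"
      using form_self[of ?e] by (simp add: bform_diff_right)
    finally have "X ?e * X (w r - ?e) = v powi bform m L ?e (w r) * X (w r)" by simp
    moreover have "X ?e * (h r * X (w r - ?e)) = h r * (X ?e * X (w r - ?e))"
      using coeff_commute[OF hr, of "X ?e"] by (simp add: mult.assoc[symmetric])
    ultimately show "h r * (v powi bform m L ?e (w r) * X (w r)) = X ?e * (h r * X (w r - ?e))"
      by simp
  qed
  finally show ?thesis using T'.X_nonzero[of ?e] by simp
qed

lemma edge: "edge v m L X L' X' i w0 bt D h"
proof unfold_locales
  show "X' (unitv i) = (\<Sum>r = 0..D. h r * X (w0 + smul (int r) bt - unitv i))"
    using x'_i by (simp add: X'_unitv[OF i_in])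
  show "h D = 1" using h_sym[of D] h_first by simp
qed (fact i_in w0_vec bt_vec w0_i bt_i h_coeff h_first w_nonneg exchange_reverse same)+

text \<open>Followed by the mutation matrix, \<open>\<tau>\<close> becomes
  \<open>c + smul (int r * c i) bt\<close>; the two cross terms of the form cancel by skew-symmetry.
  The values \<open>r = 0\<close> and \<open>r = D\<close> correspond to the two signs in the
  definition of mutation.\<close>

lemma form_tropical:
  fixes r :: nat
  defines "\<tau> \<equiv> subst_vec i (w r - unitv i)"
  shows "bform m L' (\<tau> a) (\<tau> b) = bform m L a b"
proof -
  have "subst_vec i (w0 - unitv i) (\<tau> c) = c + smul (int r * c i) bt" for c
    by (simp add: \<tau>_def subst_vec_def fun_eq_iff vec_apply w0_i bt_i algebra_simps)
  then show ?thesis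
    by (simp add: form' bform_linear form_bt form_bt_left bt_i algebra_simps)
qed

end

section \<open>Mutation of seeds\<close>

lemma posp_diff: "posp a - posp (- a) = a"
  by (simp add: posp_def max_def)

lemma posp_zero [simp]: "posp 0 = 0"
  by (simp add: posp_def)

lemma posp_mult: "c \<ge> 0 \<Longrightarrow> posp (a * c) = posp a * c"
  by (cases "a \<ge> 0") (auto simp: posp_def max_def mult_le_0_iff zero_le_mult_iff)

definition column :: "nat \<Rightarrow> (nat \<Rightarrow> nat \<Rightarrow> int) \<Rightarrow> nat \<Rightarrow> nat \<Rightarrow> int" where
  "column m B l = (\<lambda>j. if j \<in> {1..m} then B j l else 0)"

text \<open>When \<open>d l\<close> divides the column, this is \<open>d l\<close> times the
  positive part of \<open>- beta m d B l\<close>, the vector \<open>w0\<close> of the exchange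
  relation.\<close>

definition neg_column :: "nat \<Rightarrow> (nat \<Rightarrow> nat \<Rightarrow> int) \<Rightarrow> nat \<Rightarrow> nat \<Rightarrow> int" where
  "neg_column m B l = (\<lambda>j. if j \<in> {1..m} then posp (- B j l) else 0)"

definition beta :: "nat \<Rightarrow> (nat \<Rightarrow> nat) \<Rightarrow> (nat \<Rightarrow> nat \<Rightarrow> int) \<Rightarrow> nat \<Rightarrow> nat \<Rightarrow> int" where
  "beta m d B l = (\<lambda>j. if j \<in> {1..m} then B j l div int (d l) else 0)"

lemma column_vec_on: "vec_on m (column m B l)" "vec_on m (neg_column m B l)" "vec_on m (beta m d B l)"
  by (simp_all add: vec_on_def column_def neg_column_def beta_def)

lemma subst_vec_involutive: "g i = -1 \<Longrightarrow> subst_vec i g (subst_vec i g c) = c"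
  by (simp add: subst_vec_def fun_eq_iff vec_apply algebra_simps)

lemma subst_vec_fixed: "c i = 0 \<Longrightarrow> subst_vec i g c = c"
  by (simp add: subst_vec_def fun_eq_iff vec_apply)

lemma subst_vec_unitv: "subst_vec i g (unitv k) = (if k = i then g else unitv k)"
  by (simp add: subst_vec_def fun_eq_iff vec_apply unitv_def)

text \<open>The diagonal \<open>dt\<close> is placed here and not in a seed because compatibility
  holds with the same diagonal after every mutation.\<close>

locale cluster_data = central_unit v for v :: "'a::division_ring" +
  fixes m n :: nat and d :: "nat \<Rightarrow> nat" and h :: "nat \<Rightarrow> nat \<Rightarrow> 'a" and dt :: "nat \<Rightarrow> int"
  assumes nm: "n \<le> m"
    and d_pos: "k \<in> {1..n} \<Longrightarrow> d k > 0" and dt_pos: "k \<in> {1..n} \<Longrightarrow> dt k > 0"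
    and h_coeff: "k \<in> {1..n} \<Longrightarrow> r \<le> d k \<Longrightarrow> h k r \<in> coeff_ring v"
    and h_sym: "k \<in> {1..n} \<Longrightarrow> r \<le> d k \<Longrightarrow> h k r = h k (d k - r)"
    and h_first: "k \<in> {1..n} \<Longrightarrow> h k 0 = 1"

locale seed = cluster_data v m n d h dt for v :: "'a::division_ring" and m n d h dt +
  fixes x :: "nat \<Rightarrow> 'a" and L B :: "nat \<Rightarrow> nat \<Rightarrow> int"
  assumes torus: "qtorus v m L (frame m v x L)"
    and LB: "k \<in> {1..m} \<Longrightarrow> l \<in> {1..n} \<Longrightarrow> (\<Sum>j\<in>{1..m}. L k j * B j l) = (if k = l then - dt l else 0)"
    and dvd: "k \<in> {1..n} \<Longrightarrow> j \<in> {1..m} \<Longrightarrow> int (d k) dvd B j k"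
begin

sublocale T: qtorus v m L "frame m v x L"
  by (rule torus)

abbreviation "mut i \<equiv> mutate m n v d h i (x, L, B)"
abbreviation "mutx i \<equiv> fst (mut i)"
abbreviation "mutL i \<equiv> fst (snd (mut i))"
abbreviation "mutB i \<equiv> snd (snd (mut i))"
abbreviation "col l \<equiv> column m B l"
abbreviation "neg l \<equiv> neg_column m B l"
abbreviation "bet l \<equiv> beta m d B l"

lemma in_m: "k \<in> {1..n} \<Longrightarrow> k \<in> {1..m}"
  using nm by auto

lemma form_col:
  assumes l: "l \<in> {1..n}" shows "bform m L c (col l) = - c l * dt l"
proof -
  have "bform m L c (col l) = (\<Sum>k\<in>{1..m}. c k * bform m L (unitv k) (col l))"
    by (rule bform_expand_left)
  also have "\<dots> = (\<Sum>k\<in>{1..m}. if k = l then - c l * dt l else 0)"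
  proof (intro sum.cong refl)
    fix k assume k: "k \<in> {1..m}"
    have "bform m L (unitv k) (col l) = (\<Sum>j\<in>{1..m}. L k j * B j l)"
      unfolding bform_unitv_left[OF k] by (intro sum.cong refl) (simp add: column_def)
    then show "c k * bform m L (unitv k) (col l) = (if k = l then - c l * dt l else 0)"
      using LB[OF k l] by simp
  qed
  finally show ?thesis using in_m[OF l] by simp
qed

text \<open>The form is evaluated on two columns in both orders; compatibility turns each value into
  a matrix entry times an entry of \<open>dt\<close>.\<close>

lemma B_skew:
  assumes "k \<in> {1..n}" "l \<in> {1..n}" shows "B k l * dt k = - (B l k * dt l)"
  using T.form_skew[of "col l" "col k"] in_m[OF assms(1)] in_m[OF assms(2)]
  unfolding form_col[OF assms(1)] form_col[OF assms(2)] by (simp add: column_def)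

lemma B_diag: "k \<in> {1..n} \<Longrightarrow> B k k = 0"
  using B_skew[of k k] dt_pos[of k] by simp

lemma B_sign:
  assumes "k \<in> {1..n}" "l \<in> {1..n}"
  shows "B k l = 0 \<longleftrightarrow> B l k = 0" "B k l > 0 \<longleftrightarrow> B l k < 0"
proof -
  have e: "B k l * dt k = - (B l k * dt l)" "dt k > 0" "dt l > 0"
    using B_skew[OF assms] dt_pos assms by auto
  show "B k l = 0 \<longleftrightarrow> B l k = 0" using e by auto
  have "B k l > 0 \<longleftrightarrow> B k l * dt k > 0" using e(2) by (simp add: zero_less_mult_iff)
  also have "\<dots> \<longleftrightarrow> B l k * dt l < 0" using e(1) by linarith
  also have "\<dots> \<longleftrightarrow> B l k < 0" using e(3) by (simp add: mult_less_0_iff)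
  finally show "B k l > 0 \<longleftrightarrow> B l k < 0" .
qed

lemma smul_bet: "i \<in> {1..n} \<Longrightarrow> smul (int (d i)) (bet i) = col i"
  using dvd[of i] by (auto simp: fun_eq_iff vec_apply beta_def column_def)

lemma bet_i: "i \<in> {1..n} \<Longrightarrow> bet i i = 0"
  by (simp add: beta_def B_diag)

lemma neg_i: "i \<in> {1..n} \<Longrightarrow> neg i i = 0"
  by (simp add: neg_column_def B_diag)

text \<open>The quotient of \<open>dt i\<close> by \<open>d i\<close>; as a value of the form it is
  an integer from the outset.\<close>

definition \<delta> :: "nat \<Rightarrow> int" where
  "\<delta> i = - bform m L (unitv i) (bet i)"

lemma d_\<delta>: "i \<in> {1..n} \<Longrightarrow> int (d i) * \<delta> i = dt i"
  using form_col[of i "unitv i"] smul_bet[of i]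
  by (simp add: \<delta>_def bform_smul_right[symmetric])

lemma \<delta>_pos:
  assumes "i \<in> {1..n}" shows "\<delta> i > 0"
  using d_\<delta>[OF assms] dt_pos[OF assms] d_pos[OF assms] by (metis of_nat_0_less_iff zero_less_mult_pos)

lemma form_bet:
  assumes i: "i \<in> {1..n}" shows "bform m L c (bet i) = - c i * \<delta> i"
proof -
  have "int (d i) * bform m L c (bet i) = int (d i) * (- c i * \<delta> i)"
    using form_col[OF i, of c] smul_bet[OF i] d_\<delta>[OF i, symmetric]
    by (simp add: bform_smul_right[symmetric])
  moreover have "int (d i) \<noteq> 0" using d_pos[OF i] by simp
  ultimately show ?thesis by (simp only: mult_cancel_left) blast
qed

text \<open>For a nonzero entry of column \<open>i\<close> the exponent vanishes at exactly one end
  of the relation: at \<open>r = 0\<close> for a positive entry and at \<open>r = d i\<close> for a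
  negative one.\<close>

lemma w_cases:
  assumes i: "i \<in> {1..n}" and j: "j \<in> {1..m}"
  shows "B j i \<ge> 0 \<Longrightarrow> neg i j + int r * bet i j = int r * bet i j"
    and "B j i < 0 \<Longrightarrow> neg i j + int r * bet i j = (int r - int (d i)) * bet i j"
    and "B j i > 0 \<Longrightarrow> bet i j > 0" and "B j i < 0 \<Longrightarrow> bet i j < 0" and "B j i = 0 \<Longrightarrow> bet i j = 0"
proof -
  have dB: "int (d i) * bet i j = B j i" using smul_bet[OF i] j
    by (simp add: fun_eq_iff vec_apply column_def)
  show "B j i \<ge> 0 \<Longrightarrow> neg i j + int r * bet i j = int r * bet i j"
    using j by (simp add: neg_column_def posp_def)
  show "B j i < 0 \<Longrightarrow> neg i j + int r * bet i j = (int r - int (d i)) * bet i j"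
    using j dB by (simp add: neg_column_def posp_def algebra_simps)
  show "B j i > 0 \<Longrightarrow> bet i j > 0" "B j i < 0 \<Longrightarrow> bet i j < 0" "B j i = 0 \<Longrightarrow> bet i j = 0"
    using dB d_pos[OF i] by (auto simp: zero_less_mult_iff mult_less_0_iff)
      (metis dB zero_less_mult_iff mult_less_0_iff of_nat_0_less_iff not_less_iff_gr_or_eq)+
qed

lemma w_nonneg:
  assumes i: "i \<in> {1..n}" and r: "r \<le> d i"
  shows "0 \<le> neg i j + int r * bet i j"
proof (cases "j \<in> {1..m}")
  case True
  note w = w_cases[OF i True]
  consider "B j i > 0" | "B j i = 0" | "B j i < 0" by linarith
  then show ?thesis
    by cases (use w r in \<open>auto intro: mult_nonneg_nonneg mult_nonpos_nonpos\<close>)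
qed (auto simp: neg_column_def beta_def)

lemma mutx_other: "j \<noteq> i \<Longrightarrow> mutx i j = x j"
  by (simp add: mutate_def Let_def)

lemma mutx_i:
  assumes i: "i \<in> {1..n}"
  shows "mutx i i = (\<Sum>r\<in>{0..d i}. h i r * frame m v x L (neg i + smul (int r) (bet i) - unitv i))"
proof -
  have "mutx i i = (\<Sum>r\<in>{0..d i}. h i r * frame m v x L
      (\<lambda>j. int r * posp (B j i div int (d i)) + int (d i - r) * posp (- (B j i div int (d i))) - unitv i j))"
    by (simp add: mutate_def Let_def)
  also have "\<dots> = (\<Sum>r\<in>{0..d i}. h i r * frame m v x L (neg i + smul (int r) (bet i) - unitv i))"
  proof (intro sum.cong refl arg_cong2[of _ _ _ _ "(*)"] frame_cong)
    fix r j assume r: "r \<in> {0..d i}" and j: "j \<in> {1..m}"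
    define b where "b = B j i div int (d i)"
    have Bb: "B j i = b * int (d i)" using dvd[OF i j] by (simp add: b_def)
    then have "posp (- B j i) = posp (- b) * int (d i)"
      using posp_mult[of "int (d i)" "- b"] by simp
    moreover have "int (d i - r) = int (d i) - int r" using r by simp
    moreover have "int r * b = int r * posp b - int r * posp (- b)"
      by (simp add: posp_diff right_diff_distrib[symmetric])
    moreover have "neg i j = posp (- B j i)" "bet i j = b"
      using j by (simp_all add: neg_column_def beta_def b_def)
    ultimately show "int r * posp (B j i div int (d i)) + int (d i - r) * posp (- (B j i div int (d i))) -
        unitv i j = (neg i + smul (int r) (bet i) - unitv i) j"
      by (simp add: vec_apply b_def[symmetric] algebra_simps)
  qed
  finally show ?thesis .
qed

lemma mutL_entry:
  assumes i: "i \<in> {1..n}" and kl: "k \<in> {1..m}" "l \<in> {1..m}"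
  shows "mutL i k l = bform m L (if k = i then neg i - unitv i else unitv k)
    (if l = i then neg i - unitv i else unitv l)"
proof -
  have E: "mutE B i a k = (if k = i then neg i - unitv i else unitv k) a" if "a \<in> {1..m}" for a k
    using that B_diag[OF i] by (auto simp: mutE_def vec_apply neg_column_def unitv_def)
  have "mutL i k l = bform m L (\<lambda>a. mutE B i a k) (\<lambda>b. mutE B i b l)"
    by (simp add: mutate_def Let_def bform_def)
  also have "\<dots> = bform m L (if k = i then neg i - unitv i else unitv k)
    (if l = i then neg i - unitv i else unitv l)"
    by (rule bform_cong) (simp_all only: E)
  finally show ?thesis .
qed

lemma mutB_entry:
  assumes i: "i \<in> {1..n}" and k: "k \<in> {1..m}" and l: "l \<in> {1..n}"
  shows "mutB i k l = (if k = i \<or> l = i then - B k l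
    else B k l + B k i * posp (B i l) + posp (- B k i) * B i l)"
proof -
  define Z where "Z a = (if l = i then - B a i else B a l + B a i * posp (B i l))" for a
  have inner: "(\<Sum>b\<in>{1..n}. B a b * mutF B i b l) = Z a" for a
  proof -
    have "(\<Sum>b\<in>{1..n}. B a b * mutF B i b l) =
        (\<Sum>b\<in>{1..n}. (if b = i then B a i * (if l = i then -1 else posp (B i l)) else 0) +
          (if b = l then (if l = i then 0 else B a l) else 0))"
      by (intro sum.cong refl) (auto simp: mutF_def)
    also have "\<dots> = Z a" using i l by (simp add: sum.distrib Z_def)
    finally show ?thesis .
  qed
  have "mutB i k l = (\<Sum>a\<in>{1..m}. mutE B i k a * (\<Sum>b\<in>{1..n}. B a b * mutF B i b l))"
    by (simp add: mutate_def Let_def sum_distrib_left mult.assoc)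
  also have "\<dots> = (\<Sum>a\<in>{1..m}. (if a = i then (if k = i then -1 else posp (- B k i)) * Z i else 0) +
      (if a = k then (if k = i then 0 else Z k) else 0))"
    unfolding inner by (intro sum.cong refl) (auto simp: mutE_def)
  also have "\<dots> = (if k = i then - Z i else Z k + posp (- B k i) * Z i)"
    using in_m[OF i] k by (simp add: sum.distrib)
  finally show ?thesis using B_diag[OF i] by (auto simp: Z_def)
qed

lemma exchange:
  assumes i: "i \<in> {1..n}"
  shows "exchange v m L x i (neg i) (bet i) (\<delta> i) (d i) (h i) (mutx i) (mutL i)"
proof unfold_locales
  show "vec_on m (neg i)" "vec_on m (bet i)" by (rule column_vec_on)+
  show "bform m L c (bet i) = - c i * \<delta> i" for c by (rule form_bet[OF i])
  show "mutx i i = (\<Sum>r = 0..d i. h i r * frame m v x L (neg i + smul (int r) (bet i) - unitv i))"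
    by (rule mutx_i[OF i])
  show "mutx i j = x j" if "j \<noteq> i" for j using that by (rule mutx_other)
qed (fact in_m[OF i] neg_i[OF i] bet_i[OF i] h_coeff[OF i] h_sym[OF i] h_first[OF i] w_nonneg[OF i]
    \<delta>_pos[OF i] mutL_entry[OF i])+

text \<open>For \<open>l\<close> other than \<open>i\<close>, the new column is the image under
  \<open>subst_vec\<close> of the old one plus a multiple of column \<open>i\<close>. Since
  \<open>subst_vec\<close> is an involution and carries the new form to the old, compatibility is
  pulled back to the old seed.\<close>

lemma mutated_seed:
  assumes i: "i \<in> {1..n}" shows "seed v m n d h dt (mutx i) (mutL i) (mutB i)"
proof -
  interpret E: exchange v m L x i "neg i" "bet i" "\<delta> i" "d i" "h i" "mutx i" "mutL i"
    by (rule exchange[OF i])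
  have im: "i \<in> {1..m}" by (rule in_m[OF i])
  show ?thesis
  proof (intro seed.intro seed_axioms.intro)
    show "cluster_data v m n d h dt" by (rule cluster_data_axioms)
    show "qtorus v m (mutL i) (frame m v (mutx i) (mutL i))" by (rule E.qtorus')
  next
    fix k j assume k: "k \<in> {1..n}" and j: "j \<in> {1..m}"
    show "int (d k) dvd mutB i j k"
    proof -
      have "int (d k) dvd posp (B i k)" using dvd[OF k im] by (simp add: posp_def max_def)
      then show ?thesis
        using dvd[OF k j] dvd[OF k im] by (auto simp: mutB_entry[OF i j k] intro: dvd_add dvd_mult)
    qed
  next
    fix k l assume k: "k \<in> {1..m}" and l: "l \<in> {1..n}"
    let ?g = "neg i - unitv i"
    let ?s = "subst_vec i ?g"
    have g_i: "?g i = -1" by (simp add: vec_apply neg_i[OF i])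
    have "(\<Sum>j\<in>{1..m}. mutL i k j * mutB i j l) = bform m (mutL i) (unitv k) (column m (mutB i) l)"
      unfolding bform_unitv_left[OF k] by (intro sum.cong refl) (simp add: column_def)
    also have "\<dots> = (if k = l then - dt l else 0)"
    proof (cases "l = i")
      case True
      have "column m (mutB i) l = - col i"
        using i by (auto simp: fun_eq_iff vec_apply column_def mutB_entry True)
      moreover have "?s (col i) = col i"
        by (rule subst_vec_fixed) (simp add: column_def B_diag[OF i])
      ultimately have "bform m (mutL i) (unitv k) (column m (mutB i) l) = (?s (unitv k)) i * dt i"
        by (simp add: E.form' bform_minus_right form_col[OF i])
      then show ?thesis
        using True g_i by (simp add: subst_vec_unitv unitv_other)
    next
      case False
      let ?a = "col l + smul (posp (B i l)) (col i)"
      have "column m (mutB i) l = ?s ?a"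
        using im B_diag[OF i] False
        by (auto simp: fun_eq_iff subst_vec_def vec_apply column_def neg_column_def mutB_entry[OF i _ l] unitv_def
            algebra_simps)
      then have "bform m (mutL i) (unitv k) (column m (mutB i) l) = bform m L (?s (unitv k)) ?a"
        by (simp add: E.form' subst_vec_involutive[of ?g, OF g_i])
      also have "\<dots> = - (?s (unitv k)) l * dt l - posp (B i l) * (?s (unitv k)) i * dt i"
        by (simp add: bform_linear form_col[OF l] form_col[OF i])
      also have "\<dots> = (if k = l then - dt l else 0)"
      proof (cases "k = i")
        case True
        \<comment> \<open>By skew-symmetry up to \<open>dt\<close>, the contributions of columns
          \<open>l\<close> and \<open>i\<close> cancel.\<close>
        have "posp (B i l) * dt i = posp (- B l i) * dt l"
          using posp_mult[of "dt i" "B i l"] posp_mult[of "dt l" "- B l i"] B_skew[OF i l]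
            dt_pos[OF i] dt_pos[OF l] by simp
        then show ?thesis
          using True False in_m[OF l] neg_i[OF i]
          by (simp add: subst_vec_unitv vec_apply unitv_other neg_column_def)
      next
        case k: False
        then show ?thesis using False by (cases "k = l") (simp_all add: subst_vec_unitv unitv_other)
      qed
      finally show ?thesis .
    qed
    finally show "(\<Sum>j\<in>{1..m}. mutL i k j * mutB i j l) = (if k = l then - dt l else 0)" .
  qed
qed

end

section \<open>The rank two statement for seeds\<close>

context seed
begin

lemma laurent_rank_two:
  assumes i: "i \<in> {1..n}" and k: "k \<in> {1..n}" and ik: "i \<noteq> k"
    and y: "y \<in> laurent m v (frame m v x L)" "y \<in> laurent m v (frame m v (mutx i) (mutL i))"
      "y \<in> laurent m v (frame m v (mutx k) (mutL k))"
    and s: "s = mutate m n v d h k (mut i)"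
  shows "y \<in> laurent m v (frame m v (fst s) (fst (snd s)))"
proof -
  interpret Ei: exchange v m L x i "neg i" "bet i" "\<delta> i" "d i" "h i" "mutx i" "mutL i"
    by (rule exchange[OF i])
  interpret Ek: exchange v m L x k "neg k" "bet k" "\<delta> k" "d k" "h k" "mutx k" "mutL k"
    by (rule exchange[OF k])
  interpret S: seed v m n d h dt "mutx i" "mutL i" "mutB i"
    by (rule mutated_seed[OF i])
  have s': "s = S.mut k" unfolding s by simp
  interpret EW: exchange v m "mutL i" "mutx i" k "S.neg k" "S.bet k" "S.\<delta> k" "d k" "h k" "S.mutx k" "S.mutL k"
    by (rule S.exchange[OF k])
  let ?X = "frame m v x L" and ?X' = "frame m v (mutx i) (mutL i)" and ?Y = "frame m v (mutx k) (mutL k)"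
  let ?W = "frame m v (S.mutx k) (S.mutL k)"
  have square: "square v m L ?X (mutL i) ?X' (mutL k) ?Y (S.mutL k) ?W i (neg i) (bet i) (d i) (h i)
      k (neg k) (bet k) (d k) (h k) (S.neg k) (S.bet k)"
    by (intro square.intro square_axioms.intro Ei.edge Ek.edge EW.edge ik)
  have im: "i \<in> {1..m}" and km: "k \<in> {1..m}" by (rule in_m[OF i], rule in_m[OF k])
  have "y \<in> laurent m v ?W"
  proof (cases "B i k = 0")
    case True
    then have Bki: "B k i = 0" using B_sign(1)[OF i k] by simp
    have "mutB i j k = B j k" if "j \<in> {1..m}" for j
      using True ik by (simp add: mutB_entry[OF i that k])
    then have eq: "S.neg k = neg k" "S.bet k = bet k"
      by (simp_all add: neg_column_def beta_def fun_eq_iff)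
    show ?thesis
    proof (rule square.laurent_W_commuting[OF square _ _ _ _ eq form_bet[OF i] form_bet[OF k] \<delta>_pos[OF k] y])
      show "neg i k = 0" "bet i k = 0" "neg k i = 0" "bet k i = 0"
        using True Bki by (simp_all add: neg_column_def beta_def)
    qed
  next
    case False
    \<comment> \<open>The ends at which the \<open>i\<close>-th relation avoids direction
      \<open>k\<close> and the \<open>k\<close>-th relation avoids direction \<open>i\<close>; they
      are opposite because \<open>B i k\<close> and \<open>B k i\<close> have opposite
      signs.\<close>
    define r1 where "r1 = (if B i k < 0 then 0 else d i)"
    define r2 where "r2 = (if B i k < 0 then d k else 0)"
    let ?w = "\<lambda>r. neg i + smul (int r) (bet i)" and ?w2 = "\<lambda>r. neg k + smul (int r) (bet k)"
    let ?\<tau> = "subst_vec i (?w r1 - unitv i)"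
    note w_i = w_cases[OF i km] and w_k = w_cases[OF k im]
    have w_r1: "?w r1 j = posp (if B i k < 0 then - B j i else B j i)" if "j \<in> {1..m}" for j
    proof (cases "B i k < 0")
      case True
      then show ?thesis using that by (simp add: r1_def vec_apply neg_column_def)
    next
      case False
      have "smul (int (d i)) (bet i) j = B j i"
        using that by (simp add: smul_bet[OF i] column_def)
      then show ?thesis
        using that False posp_diff[of "B j i"] by (simp add: r1_def vec_apply neg_column_def)
    qed
    have "noncommuting_square v m L ?X (mutL i) ?X' (mutL k) ?Y (S.mutL k) ?W i (neg i) (bet i) (d i) (h i)
      k (neg k) (bet k) (d k) (h k) (S.neg k) (S.bet k) r1 r2 ?\<tau>"
    proof (intro noncommuting_square.intro noncommuting_square_axioms.intro square)
      show "r1 = 0 \<or> r1 = d i" "r2 = 0 \<or> r2 = d k" by (simp_all add: r1_def r2_def)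
      show "?w r1 k = 0"
        unfolding w_r1[OF km] using B_sign(2)[OF k i] B_sign(2)[OF i k] False
        by (auto simp: posp_def max_def not_less)
      show "?w r k > 0" if "r \<le> d i" "r \<noteq> r1" for r
      proof (cases "B i k < 0")
        case True
        then have "B k i > 0" using B_sign(2)[OF k i] by simp
        then show ?thesis
          using w_i(1)[of r] w_i(3) that True by (simp add: vec_apply r1_def)
      next
        case False2: False
        then have "B k i < 0" using B_sign(2)[OF i k] False by simp
        then show ?thesis
          using w_i(2)[of r] w_i(4) that False2 by (simp add: vec_apply r1_def mult_neg_neg)
      qed
      show "?w2 r2 i = 0"
        using w_k(1,2)[of r2] False by (cases "B i k < 0") (simp_all add: vec_apply r2_def)
      show "?w2 r i > 0" if "r \<le> d k" "r \<noteq> r2" for r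
      proof (cases "B i k < 0")
        case True
        then show ?thesis
          using w_k(2)[of r] w_k(4) that by (simp add: vec_apply r2_def mult_neg_neg)
      next
        case False2: False
        then show ?thesis
          using w_k(1)[of r] w_k(3) that False by (simp add: vec_apply r2_def)
      qed
      show "?\<tau> c = c + smul (c i) (?w r1 - smul 2 (unitv i))" for c
        by (simp add: subst_vec_def fun_eq_iff vec_apply algebra_simps)
      show "bform m (mutL i) (?\<tau> a) (?\<tau> b) = bform m L a b" for a b
        by (rule Ei.form_tropical)
      show "bform m (mutL i) c (S.bet k) = 0" if "c k = 0" for c
        using that by (simp add: S.form_bet[OF k])
      \<comment> \<open>Multiplied by \<open>d k\<close>, this is the mutation rule for column
        \<open>k\<close>, with the sign in the rule adapted to that of \<open>B i k\<close>.\<close>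
      show "?\<tau> (bet k) = S.bet k"
      proof
        fix j
        show "?\<tau> (bet k) j = S.bet k j"
        proof (cases "j \<in> {1..m}")
          case True
          have "int (d k) * ?\<tau> (bet k) j = ?\<tau> (col k) j"
            by (simp add: smul_bet[OF k, symmetric] subst_vec_def vec_apply algebra_simps)
          also have "\<dots> = mutB i j k"
          proof (cases "j = i")
            case True
            then show ?thesis
              using w_r1[OF im] B_diag[OF i] im
              by (simp add: subst_vec_def vec_apply column_def mutB_entry[OF i im k])
          next
            case False
            have "?\<tau> (col k) j = B j k + B i k * posp (if B i k < 0 then - B j i else B j i)"
              using False True im w_r1[OF True]
              by (simp add: subst_vec_def vec_apply column_def unitv_other)
            also have "\<dots> = mutB i j k"
            proof (cases "B i k < 0")
              case True
              then show ?thesis using False ik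
                by (simp add: mutB_entry[OF i \<open>j \<in> {1..m}\<close> k] posp_def[of "B i k"])
            next
              case False2: False
              then have "B i k * posp (B j i) = B j i * posp (B i k) + posp (- B j i) * B i k"
                using posp_diff[of "B j i"] by (simp add: posp_def[of "B i k"] algebra_simps)
              then show ?thesis using False False2 ik
                by (simp add: mutB_entry[OF i \<open>j \<in> {1..m}\<close> k])
            qed
            finally show ?thesis .
          qed
          also have "\<dots> = int (d k) * S.bet k j"
            using fun_cong[OF S.smul_bet[OF k], of j] True by (simp add: vec_apply column_def)
          finally show ?thesis using d_pos[OF k] by simp
        next
          case False
          then show ?thesis
            using im bet_i[OF k] ik
            by (auto simp: subst_vec_def vec_apply beta_def neg_column_def unitv_def)
        qed
      qed
    qed
    then show ?thesis using y by (rule noncommuting_square.laurent_W_noncommuting)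
  qed
  then show ?thesis unfolding s' .
qed

end

section \<open>Mutation is an involution\<close>

context seed
begin

text \<open>Mutation negates \<open>bet i\<close> and moves \<open>neg i\<close> to the other end of
  the relation, so the second relation runs through the exponents backwards; symmetry of
  \<open>h\<close> restores the coefficients and \<open>exchange_reverse\<close> applies.\<close>

lemma mutate_mutate:
  assumes i: "i \<in> {1..n}" and t: "(x2, L2, B2) = mutate m n v d h i (mut i)"
  shows "x2 = x"
    and "k \<in> {1..m} \<Longrightarrow> l \<in> {1..m} \<Longrightarrow> L2 k l = L k l"
    and "k \<in> {1..m} \<Longrightarrow> l \<in> {1..n} \<Longrightarrow> B2 k l = B k l"
proof -
  interpret E: exchange v m L x i "neg i" "bet i" "\<delta> i" "d i" "h i" "mutx i" "mutL i"
    by (rule exchange[OF i])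
  interpret S: seed v m n d h dt "mutx i" "mutL i" "mutB i"
    by (rule mutated_seed[OF i])
  have t': "x2 = S.mutx i" "L2 = S.mutL i" "B2 = S.mutB i"
    using t[symmetric] by simp_all
  have im: "i \<in> {1..m}" by (rule in_m[OF i])
  have bet: "S.bet i = - bet i"
    using dvd[OF i] by (auto simp: fun_eq_iff vec_apply beta_def mutB_entry[OF i _ i] dvd_neg_div)
  have neg: "S.neg i = E.w (d i)"
  proof
    fix j
    show "S.neg i j = E.w (d i) j"
      unfolding smul_bet[OF i] using posp_diff[of "B j i"]
      by (simp add: vec_apply neg_column_def column_def mutB_entry[OF i _ i])
  qed
  have "x2 i = x i"
  proof -
    have "x2 i = (\<Sum>r\<in>{0..d i}. h i r * E.X' (S.neg i + smul (int r) (S.bet i) - unitv i))"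
      unfolding t' by (rule S.mutx_i[OF i])
    also have "\<dots> = (\<Sum>r\<in>{0..d i}. h i (d i - r) * E.X' (E.w (d i - r) - unitv i))"
    proof (intro sum.cong refl)
      fix r assume r: "r \<in> {0..d i}"
      then have "S.neg i + smul (int r) (S.bet i) - unitv i = E.w (d i - r) - unitv i"
        by (simp add: neg bet fun_eq_iff vec_apply algebra_simps)
      then show "h i r * E.X' (S.neg i + smul (int r) (S.bet i) - unitv i) =
          h i (d i - r) * E.X' (E.w (d i - r) - unitv i)"
        using h_sym[OF i, of r] r by simp
    qed
    also have "\<dots> = (\<Sum>r\<in>{0..d i}. h i r * E.X' (E.w r - unitv i))"
      by (rule sum.reindex_bij_witness[of _ "\<lambda>r. d i - r" "\<lambda>r. d i - r"]) auto
    also have "\<dots> = x i" using E.exchange_reverse E.X_unitv[OF im] by simp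
    finally show ?thesis .
  qed
  moreover have "x2 j = x j" if "j \<noteq> i" for j
    unfolding t' using that S.mutx_other mutx_other by metis
  ultimately show "x2 = x" by (metis ext)
  show "L2 k l = L k l" if kl: "k \<in> {1..m}" "l \<in> {1..m}"
  proof -
    have "L2 k l = bform m (mutL i) (subst_vec i (E.w (d i) - unitv i) (unitv k))
        (subst_vec i (E.w (d i) - unitv i) (unitv l))"
      unfolding t' S.mutL_entry[OF i kl] neg by (simp only: subst_vec_unitv)
    also have "\<dots> = L k l" by (simp only: E.form_tropical bform_unitv_unitv[OF kl])
    finally show ?thesis .
  qed
  show "B2 k l = B k l" if kl: "k \<in> {1..m}" "l \<in> {1..n}"
  proof (cases "k = i \<or> l = i")
    case True
    then show ?thesis unfolding t' S.mutB_entry[OF i kl] mutB_entry[OF i kl] by auto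
  next
    case False
    have "B2 k l = B k l + B k i * (posp (B i l) - posp (- B i l)) - (posp (B k i) - posp (- B k i)) * B i l"
      using False unfolding t' S.mutB_entry[OF i kl] mutB_entry[OF i kl]
        mutB_entry[OF i im kl(2)] mutB_entry[OF i kl(1) i] by (simp add: algebra_simps)
    then show ?thesis by (simp add: posp_diff)
  qed
qed

end

section \<open>Invariance of upper bounds\<close>

context cluster_data
begin

abbreviation "mu \<equiv> mutate m n v d h"

abbreviation good :: "'a qseed \<Rightarrow> bool" where
  "good s \<equiv> seed v m n d h dt (fst s) (fst (snd s)) (snd (snd s))"

definition lau :: "'a qseed \<Rightarrow> 'a set" where
  "lau s = laurent m v (frame m v (fst s) (fst (snd s)))"

definition upper :: "'a qseed \<Rightarrow> 'a set" where
  "upper s = {y \<in> lau s. \<forall>j\<in>{1..n}. y \<in> lau (mu j s)}"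

text \<open>The matrix products in a mutation do not retain entries outside the index ranges, so a
  double mutation restores a seed only up to this relation.\<close>

definition equiv_seed :: "'a qseed \<Rightarrow> 'a qseed \<Rightarrow> bool" where
  "equiv_seed s t \<longleftrightarrow> (\<forall>k\<in>{1..m}. fst s k = fst t k) \<and>
    (\<forall>k\<in>{1..m}. \<forall>l\<in>{1..m}. fst (snd s) k l = fst (snd t) k l) \<and>
    (\<forall>k\<in>{1..m}. \<forall>l\<in>{1..n}. snd (snd s) k l = snd (snd t) k l)"

lemma lau_cong: "equiv_seed s t \<Longrightarrow> lau s = lau t"
proof -
  assume "equiv_seed s t"
  then have "frame m v (fst s) (fst (snd s)) = frame m v (fst t) (fst (snd t))"
    by (intro ext frame_cong) (auto simp: equiv_seed_def)
  then show ?thesis by (simp add: lau_def)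
qed

lemma mutate_cong:
  assumes st: "equiv_seed s t" and i: "i \<in> {1..n}"
  shows "equiv_seed (mu i s) (mu i t)"
proof -
  obtain x L B where s: "s = (x, L, B)" by (cases s) auto
  obtain x' L' B' where t: "t = (x', L', B')" by (cases t) auto
  have x: "x k = x' k" if "k \<in> {1..m}" for k using st that by (simp add: equiv_seed_def s t)
  have L: "L k l = L' k l" if "k \<in> {1..m}" "l \<in> {1..m}" for k l
    using st that by (simp add: equiv_seed_def s t)
  have B: "B k l = B' k l" if "k \<in> {1..m}" "l \<in> {1..n}" for k l
    using st that by (simp add: equiv_seed_def s t)
  have im: "i \<in> {1..m}" using i nm by auto
  have E: "mutE B i k l = mutE B' i k l" if "k \<in> {1..m}" for k l
    using B[OF that i] by (simp add: mutE_def)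
  have F: "mutF B i k l = mutF B' i k l" if "l \<in> {1..n}" for k l
    using B[OF im that] by (simp add: mutF_def)
  show ?thesis
    unfolding equiv_seed_def
  proof (intro conjI ballI)
    fix k assume k: "k \<in> {1..m}"
    show "fst (mu i s) k = fst (mu i t) k"
      unfolding s t mutate_def Let_def using x[OF k]
      by (auto intro!: sum.cong arg_cong2[of _ _ _ _ "(*)"] frame_cong simp: x L B[OF _ i])
    show "fst (snd (mu i s)) k l = fst (snd (mu i t)) k l" if l: "l \<in> {1..m}" for l
      unfolding s t mutate_def Let_def by (auto intro!: sum.cong simp: L E)
    show "snd (snd (mu i s)) k l = snd (snd (mu i t)) k l" if l: "l \<in> {1..n}" for l
      unfolding s t mutate_def Let_def by (auto intro!: sum.cong simp: B E[OF k] F[OF l])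
  qed
qed

lemma good_mutate: "good s \<Longrightarrow> i \<in> {1..n} \<Longrightarrow> good (mu i s)"
  using seed.mutated_seed[of v m n d h dt "fst s" "fst (snd s)" "snd (snd s)" i] by simp

lemma equiv_mutate_mutate:
  assumes "good s" "i \<in> {1..n}" shows "equiv_seed (mu i (mu i s)) s"
proof -
  obtain x2 L2 B2 where t: "mu i (mu i s) = (x2, L2, B2)" by (metis prod_cases3)
  then have t': "(x2, L2, B2) = mu i (mu i (fst s, fst (snd s), snd (snd s)))" by simp
  note mm = seed.mutate_mutate[OF assms t']
  show ?thesis
    unfolding equiv_seed_def t by (intro conjI ballI) (simp_all only: fst_conv snd_conv mm)
qed

lemma upper_cong: "equiv_seed s t \<Longrightarrow> upper s = upper t"
  unfolding upper_def using lau_cong mutate_cong by (metis (no_types, lifting))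

lemma upper_subset:
  assumes s: "good s" and i: "i \<in> {1..n}" shows "upper s \<subseteq> upper (mu i s)"
proof
  fix y assume y: "y \<in> upper s"
  have "y \<in> lau (mu j (mu i s))" if j: "j \<in> {1..n}" for j
  proof (cases "j = i")
    case True
    then show ?thesis
      using y lau_cong[OF equiv_mutate_mutate[OF s i]] by (simp add: upper_def)
  next
    case False
    show ?thesis
      using seed.laurent_rank_two[OF s i j, of y "mu j (mu i s)"] False y i j
      by (simp add: upper_def lau_def)
  qed
  then show "y \<in> upper (mu i s)" using y i by (simp add: upper_def)
qed

text \<open>Involutivity turns the inclusion for \<open>mu i s\<close> into the reverse inclusion
  for \<open>s\<close>.\<close>

lemma upper_mutate:
  assumes s: "good s" and i: "i \<in> {1..n}" shows "upper (mu i s) = upper s"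
  using upper_subset[OF s i] upper_subset[OF good_mutate[OF s i] i]
    upper_cong[OF equiv_mutate_mutate[OF s i]] by simp

lemma mutseq_invariants:
  assumes "good s" "set ks \<subseteq> {1..n}"
  shows "good (mutseq m n v d h ks s) \<and> upper (mutseq m n v d h ks s) = upper s \<and>
    (\<forall>k\<in>{n+1..m}. fst (mutseq m n v d h ks s) k = fst s k)"
  using assms
proof (induction ks arbitrary: s)
  case (Cons i ks)
  then have i: "i \<in> {1..n}" by simp
  have "fst (mu i s) k = fst s k" if "k \<in> {n+1..m}" for k
    using seed.mutx_other[OF Cons.prems(1), of k i] that i by auto
  then show ?case
    using Cons.IH[OF good_mutate[OF Cons.prems(1) i]] Cons.prems upper_mutate[OF Cons.prems(1) i] by auto
qed simp

text \<open>In direction \<open>k\<close> the reverse exchange relation expresses the variable;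
  every other adjacent seed still contains it.\<close>

lemma cluster_variable_upper:
  assumes s: "good s" and k: "k \<in> {1..n}" shows "fst s k \<in> upper s"
proof -
  have km: "k \<in> {1..m}" using k nm by auto
  have lau: "fst t k \<in> lau t" for t :: "'a qseed"
  proof -
    have "frame m v (fst t) (fst (snd t)) (unitv k) \<in> lau t"
      unfolding lau_def using km by (intro tspan_monom vec_on_closed) auto
    then show ?thesis by (simp add: frame_unitv[OF km])
  qed
  have "fst s k \<in> lau (mu j s)" if j: "j \<in> {1..n}" for j
  proof (cases "j = k")
    case True
    interpret S: seed v m n d h dt "fst s" "fst (snd s)" "snd (snd s)" by (rule s)
    have "edge v m (fst (snd s)) (frame m v (fst s) (fst (snd s))) (S.mutL k) (frame m v (S.mutx k) (S.mutL k))
        k (S.neg k) (S.bet k) (d k) (h k)"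
      by (rule exchange.edge[OF S.exchange[OF k]])
    then have "frame m v (fst s) (fst (snd s)) (unitv k) \<in> laurent m v (frame m v (S.mutx k) (S.mutL k))"
      by (rule edge.X'_laurent[OF edge_sym]) (use km in simp_all)
    then show ?thesis by (simp add: lau_def True frame_unitv[OF km])
  next
    case False
    then show ?thesis using lau[of "mu j s"] seed.mutx_other[OF s, of k j] by simp
  qed
  then show ?thesis using lau by (simp add: upper_def)
qed

lemma lau_subset_subring:
  assumes frozen: "\<And>k. k \<in> {n+1..m} \<Longrightarrow> fst s k = x0 k"
  shows "lau s \<subseteq> subring_gen (ZP_gens m n v x0 \<union> fst s ` {1..n} \<union> (\<lambda>k. inverse (fst s k)) ` {1..n})"
    (is "_ \<subseteq> subring_gen ?S")
proof
  fix y assume y: "y \<in> lau s"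
  have v: "v \<in> subring_gen ?S" "inverse v \<in> subring_gen ?S"
    by (auto intro: subring_gen.gen simp: ZP_gens_def)
  have x: "fst s k \<in> subring_gen ?S \<and> inverse (fst s k) \<in> subring_gen ?S" if "k \<in> {1..m}" for k
  proof (cases "k \<in> {1..n}")
    case True
    then show ?thesis by (auto intro: subring_gen.gen)
  next
    case False
    then have "k \<in> {n+1..m}" using that by auto
    then show ?thesis using frozen[of k] by (auto intro!: subring_gen.gen simp: ZP_gens_def)
  qed
  have prod: "set ks \<subseteq> {1..m} \<Longrightarrow> lprod (\<lambda>k. fst s k powi c k) ks \<in> subring_gen ?S" for ks c
    by (induction ks) (use x in \<open>auto intro!: subring_gen.one subring_gen.mult subring_gen_powi\<close>)
  show "y \<in> subring_gen ?S"
  proof (rule tspan_subset_subring[OF y[unfolded lau_def] v])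
    fix c
    have "set [1..<m+1] \<subseteq> {1..m}" by auto
    then show "frame m v (fst s) (fst (snd s)) c \<in> subring_gen ?S"
      unfolding frame_def by (intro subring_gen.mult subring_gen_powi v prod)
  qed
qed

lemma cluster_algebra_subset_upper:
  assumes s0: "good s0"
  shows "gq_cluster_algebra m n v d h s0 \<subseteq> gq_upper_cluster_algebra m n v d h s0"
  unfolding gq_cluster_algebra_def gq_upper_cluster_algebra_def
proof (intro INT_greatest subring_gen_least Un_least subsetI)
  fix t assume t: "t \<in> mut_class m n v d h s0"
  let ?S = "ZP_gens m n v (fst s0) \<union> fst t ` {1..n} \<union> (\<lambda>k. inverse (fst t k)) ` {1..n}"
  have inv: "good s \<and> upper s = upper s0 \<and> (\<forall>k\<in>{n+1..m}. fst s k = fst s0 k)"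
    if "s \<in> mut_class m n v d h s0" for s
    using that mutseq_invariants[OF s0] by (auto simp: mut_class_def)
  show "y \<in> subring_gen ?S" if "y \<in> ZP_gens m n v (fst s0)" for y
    using that by (intro subring_gen.gen) auto
  fix y assume "y \<in> {fst s k | s k. s \<in> mut_class m n v d h s0 \<and> k \<in> {1..n}}"
  then obtain s k where s: "s \<in> mut_class m n v d h s0" "k \<in> {1..n}" "y = fst s k" by blast
  have "y \<in> upper t" using cluster_variable_upper[of s k] inv[OF s(1)] inv[OF t] s by auto
  then have "y \<in> lau t" by (simp add: upper_def)
  then show "y \<in> subring_gen ?S"
    using lau_subset_subring[of t "fst s0"] inv[OF t] by blast
qed

end

section \<open>The initial seed\<close>

context central_unit
begin

text \<open>The initial monomials are assumed independent with integer coefficients and separate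
  powers of \<open>v\<close>, while \<open>qtorus\<close> asks for coefficients in
  \<open>coeff_ring v\<close>; this normal form mediates.\<close>

definition laurent_sum :: "'a \<Rightarrow> bool" where
  "laurent_sum k \<longleftrightarrow> (\<exists>I a. finite I \<and> k = (\<Sum>z\<in>I. of_int (a z) * v powi z))"

lemma laurent_sum_monom: "laurent_sum (of_int b * v powi z)"
  unfolding laurent_sum_def by (rule exI[of _ "{z}"], rule exI[of _ "\<lambda>_. b"]) simp

lemma laurent_sum_add:
  assumes "laurent_sum k" "laurent_sum l" shows "laurent_sum (k + l)"
proof -
  obtain I a where I: "finite I" "k = (\<Sum>z\<in>I. of_int (a z) * v powi z)"
    using assms(1) unfolding laurent_sum_def by blast
  obtain J b where J: "finite J" "l = (\<Sum>z\<in>J. of_int (b z) * v powi z)"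
    using assms(2) unfolding laurent_sum_def by blast
  define e where "e z = (if z \<in> I then a z else 0) + (if z \<in> J then b z else 0)" for z
  have "(\<Sum>z\<in>I \<union> J. of_int (e z) * v powi z) =
      (\<Sum>z\<in>I \<union> J. if z \<in> I then of_int (a z) * v powi z else 0) +
      (\<Sum>z\<in>I \<union> J. if z \<in> J then of_int (b z) * v powi z else 0)"
    unfolding sum.distrib[symmetric] e_def by (intro sum.cong refl) (simp add: distrib_right)
  also have "(\<Sum>z\<in>I \<union> J. if z \<in> I then of_int (a z) * v powi z else 0) = k"
    unfolding I(2) using I(1) J(1) by (intro sum.mono_neutral_cong_right) auto
  also have "(\<Sum>z\<in>I \<union> J. if z \<in> J then of_int (b z) * v powi z else 0) = l"
    unfolding J(2) using I(1) J(1) by (intro sum.mono_neutral_cong_right) auto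
  finally show ?thesis using I(1) J(1) unfolding laurent_sum_def by (metis finite_UnI)
qed

lemma laurent_sum_sum: "(\<And>i. i \<in> A \<Longrightarrow> laurent_sum (f i)) \<Longrightarrow> laurent_sum (sum f A)"
  using laurent_sum_monom[of 0 0]
  by (induction A rule: infinite_finite_induct) (auto intro: laurent_sum_add)

lemma laurent_sum_mult:
  assumes "laurent_sum k" "laurent_sum l" shows "laurent_sum (k * l)"
proof -
  obtain I a where I: "finite I" "k = (\<Sum>z\<in>I. of_int (a z) * v powi z)"
    using assms(1) unfolding laurent_sum_def by blast
  obtain J b where J: "finite J" "l = (\<Sum>z\<in>J. of_int (b z) * v powi z)"
    using assms(2) unfolding laurent_sum_def by blast
  have monom_mult: "(of_int (a z) * v powi z) * (of_int (b w) * v powi w) = of_int (a z * b w) * v powi (z + w)"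
    for z w
  proof -
    have "(of_int (a z) * v powi z) * (of_int (b w) * v powi w) =
        of_int (a z) * (v powi z * of_int (b w)) * v powi w"
      by (simp only: mult.assoc)
    also have "v powi z * of_int (b w) = of_int (b w) * v powi z" by (rule powi_commute)
    also have "of_int (a z) * (of_int (b w) * v powi z) * v powi w = of_int (a z * b w) * v powi (z + w)"
      by (simp only: of_int_mult powi_add[symmetric] mult.assoc)
    finally show ?thesis .
  qed
  have "k * l = (\<Sum>z\<in>I. \<Sum>w\<in>J. of_int (a z * b w) * v powi (z + w))"
    by (simp only: I(2) J(2) sum_product monom_mult)
  then show ?thesis by (simp only:) (intro laurent_sum_sum laurent_sum_monom)
qed

lemma coeff_ring_laurent_sum: "k \<in> coeff_ring v \<Longrightarrow> laurent_sum k"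
  unfolding coeff_ring_def
proof (induction rule: subring_gen.induct)
  case (gen s)
  then show ?case using laurent_sum_monom[of 1 1] laurent_sum_monom[of 1 "-1"]
    by (auto simp: power_int_minus)
next
  case one
  show ?case using laurent_sum_monom[of 1 0] by simp
next
  case (neg a)
  then show ?case using laurent_sum_mult[OF laurent_sum_monom[of "-1" 0]] by simp
qed (auto intro: laurent_sum_add laurent_sum_mult)

end

text \<open>The given basis and the frame built from its values on unit vectors obey the same
  product rule, so they agree on all exponents supported on \<open>{1..m}\<close>, and independence
  is inherited.\<close>

lemma initial_qtorus:
  fixes v :: "'a::division_ring" and X :: "(nat \<Rightarrow> int) \<Rightarrow> 'a"
  assumes v: "v \<noteq> 0" "\<And>y. v * y = y * v"
    and skew: "\<And>k l. k \<in> {1..m} \<Longrightarrow> l \<in> {1..m} \<Longrightarrow> L k l = - L l k"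
    and X_mult: "\<And>c e. vec_on m c \<Longrightarrow> vec_on m e \<Longrightarrow> X c * X e = v powi bform m L c e * X (c + e)"
    and X_indep: "\<And>S a p. finite S \<Longrightarrow> (\<And>p. p \<in> S \<Longrightarrow> vec_on m (snd p)) \<Longrightarrow>
      (\<Sum>p\<in>S. of_int (a p) * v powi (fst p) * X (snd p)) = 0 \<Longrightarrow> p \<in> S \<Longrightarrow> a p = (0::int)"
  shows "qtorus v m L (frame m v (\<lambda>k. X (unitv k)) L)"
proof -
  interpret central_unit v by unfold_locales (use v in auto)
  let ?F = "frame m v (\<lambda>k. X (unitv k)) L"
  have X_nz: "X c \<noteq> 0" if "vec_on m c" for c
    using X_indep[of "{(0, c)}" "\<lambda>_. 1" "(0, c)"] that by auto
  have X_0: "X 0 = 1"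
    using X_mult[of 0 0] X_nz[of 0] by (simp add: bform_linear)
  have F_0: "?F 0 = 1"
    by (simp add: frame_def zero_fun_apply lprod_one)
  have F_mult: "?F c * ?F e = v powi bform m L c e * ?F (c + e)" for c e
  proof (rule frame_mult)
    fix k l assume kl: "k \<in> {1..m}" "l \<in> {1..m}"
    have e: "X (unitv k) * X (unitv l) = v powi L k l * X (unitv k + unitv l)"
      "X (unitv l) * X (unitv k) = v powi L l k * X (unitv k + unitv l)"
      using X_mult[of "unitv k" "unitv l"] X_mult[of "unitv l" "unitv k"] kl
      by (simp_all only: vec_on_closed bform_unitv_unitv add.commute)
    have "2 * L k l + L l k = L k l" using skew[OF kl] by simp
    then show "X (unitv k) * X (unitv l) = v powi (2 * L k l) * (X (unitv l) * X (unitv k))"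
      by (simp only: e powi_add_left)
  next
    show "X (unitv k) \<noteq> 0" if "k \<in> {1..m}" for k using that by (intro X_nz vec_on_closed)
  qed (rule skew)
  have add: "X (c + e) = ?F (c + e)" if "vec_on m c" "vec_on m e" "X c = ?F c" "X e = ?F e" for c e
    using X_mult[of c e] F_mult[of c e] that v(1) by simp
  have neg: "X (- c) = ?F (- c)" if "vec_on m c" "X c = ?F c" for c
  proof -
    have "X c * X (- c) = X c * ?F (- c)"
      using X_mult[of c "- c"] F_mult[of c "- c"] that by (simp add: X_0 F_0)
    then show ?thesis using X_nz[of c] that by simp
  qed
  have smul_nat: "X (smul (int r) c) = ?F (smul (int r) c)" if "vec_on m c" "X c = ?F c" for r c
  proof (induction r)
    case 0
    have "smul (int 0) c = 0" by (simp add: fun_eq_iff vec_apply)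
    then show ?case by (simp only: X_0 F_0)
  next
    case (Suc r)
    have "smul (int (Suc r)) c = c + smul (int r) c" by (simp add: fun_eq_iff vec_apply algebra_simps)
    then show ?case using add[OF that(1) _ that(2) Suc] that(1) by (simp only: vec_on_closed)
  qed
  have smul: "X (smul z c) = ?F (smul z c)" if "vec_on m c" "X c = ?F c" for z c
  proof (cases "z \<ge> 0")
    case True
    then show ?thesis using smul_nat[OF that, of "nat z"] by simp
  next
    case False
    have "smul z c = - smul (int (nat (- z))) c" using False by (simp add: fun_eq_iff vec_apply)
    then show ?thesis using neg[OF _ smul_nat[OF that, of "nat (- z)"]] that(1) by (simp only: vec_on_closed)
  qed
  \<comment> \<open>One coordinate is added at a time: \<open>j\<close> bounds the support of
    \<open>c\<close>, while the frame remains the one in \<open>m\<close> variables.\<close>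
  have XF_aux: "j \<le> m \<Longrightarrow> vec_on j c \<Longrightarrow> X c = ?F c" for j c
  proof (induction j arbitrary: c)
    case 0
    then have "c = 0" by (auto simp: vec_on_def fun_eq_iff zero_fun_apply)
    then show ?case by (simp only: X_0 F_0)
  next
    case (Suc j)
    let ?e = "unitv (Suc j)"
    have p: "vec_on j (proj (Suc j) c)" using Suc.prems(2) by (auto simp: vec_on_def proj_apply)
    have "Suc j \<in> {1..m}" using Suc.prems(1) by simp
    then have e: "vec_on m ?e" "X ?e = ?F ?e" by (auto simp: frame_unitv)
    have "vec_on m (proj (Suc j) c)" using p Suc.prems(1) by (auto simp: vec_on_def)
    then have "X (proj (Suc j) c + smul (c (Suc j)) ?e) = ?F (proj (Suc j) c + smul (c (Suc j)) ?e)"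
      using Suc.IH[OF _ p] Suc.prems(1) e by (intro add smul vec_on_closed) auto
    then show ?case by (simp only: proj_decomp[symmetric])
  qed
  have XF: "?F c = X c" if "vec_on m c" for c using XF_aux[of m c] that by simp
  show ?thesis
  proof unfold_locales
    show "?F c * ?F e = v powi bform m L c e * ?F (c + e)" for c e by (rule F_mult)
    show "L a b = - L b a" if "a \<in> {1..m}" "b \<in> {1..m}" for a b using that by (rule skew)
    fix S and \<kappa> :: "(nat \<Rightarrow> int) \<Rightarrow> 'a" and c0
    assume S: "finite S" and \<kappa>: "\<And>c. c \<in> S \<Longrightarrow> vec_on m c \<and> \<kappa> c \<in> coeff_ring v"
      and sum0: "(\<Sum>c\<in>S. \<kappa> c * ?F c) = 0" and c0: "c0 \<in> S"
    have "\<forall>c\<in>S. \<exists>I a. finite I \<and> \<kappa> c = (\<Sum>z\<in>I. of_int (a z) * v powi z)"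
      using coeff_ring_laurent_sum \<kappa> unfolding laurent_sum_def by blast
    then obtain I a where I: "\<And>c. c \<in> S \<Longrightarrow> finite (I c)"
      "\<And>c. c \<in> S \<Longrightarrow> \<kappa> c = (\<Sum>z\<in>I c. of_int (a c z) * v powi z)"
      by metis
    \<comment> \<open>The coefficient expansions are unfolded into one family indexed by pairs of a
      power of \<open>v\<close> and an exponent, the shape that \<open>X_indep\<close>
      requires.\<close>
    define T where "T = (\<lambda>(c, z). (z, c)) ` Sigma S I"
    have "(\<Sum>p\<in>T. of_int (a (snd p) (fst p)) * v powi (fst p) * X (snd p)) =
        (\<Sum>(c, z)\<in>Sigma S I. of_int (a c z) * v powi z * X c)"
      unfolding T_def by (subst sum.reindex) (auto simp: inj_on_def case_prod_beta)
    also have "\<dots> = (\<Sum>c\<in>S. \<Sum>z\<in>I c. of_int (a c z) * v powi z * X c)"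
      using S I(1) by (subst sum.Sigma) auto
    also have "\<dots> = (\<Sum>c\<in>S. \<kappa> c * ?F c)"
      by (intro sum.cong refl) (simp add: I(2) XF \<kappa> sum_distrib_right)
    finally have "(\<Sum>p\<in>T. of_int (a (snd p) (fst p)) * v powi (fst p) * X (snd p)) = 0"
      by (simp only: sum0)
    moreover have "finite T" using S I(1) by (auto simp: T_def)
    moreover have "vec_on m (snd p)" if "p \<in> T" for p using that \<kappa> by (auto simp: T_def)
    ultimately have "a c0 z = 0" if "z \<in> I c0" for z
      using X_indep[of T "\<lambda>p. a (snd p) (fst p)" "(z, c0)"] that c0 by (force simp: T_def)
    then show "\<kappa> c0 = 0" unfolding I(2)[OF c0] by simp
  qed
qed

theorem theorem3p1:
  fixes m n :: nat
    and v :: "'a::division_ring"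
    and X :: "(nat \<Rightarrow> int) \<Rightarrow> 'a"
    and L B :: "nat \<Rightarrow> nat \<Rightarrow> int"
    and d :: "nat \<Rightarrow> nat"
    and h :: "nat \<Rightarrow> nat \<Rightarrow> 'a"
  assumes mn: "1 \<le> n" "n \<le> m"
    and compat: "compatible m n L B"
    and d_div: "\<forall>k\<in>{1..n}. d k > 0 \<and> (\<forall>j\<in>{1..m}. int (d k) dvd B j k)"
    and h_coeff: "\<forall>k\<in>{1..n}. \<forall>r\<le>d k. h k r \<in> coeff_ring v"
    and h_sym: "\<forall>k\<in>{1..n}. \<forall>r\<le>d k. h k r = h k (d k - r)"
    and h_ends: "\<forall>k\<in>{1..n}. h k 0 = 1 \<and> h k (d k) = 1"
    and v_nz: "v \<noteq> 0"
    and v_central: "\<forall>y. v * y = y * v"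
    and X_mult: "\<forall>c e. vec_on m c \<longrightarrow> vec_on m e \<longrightarrow>
                   X c * X e = v powi (bform m L c e) * X (\<lambda>j. c j + e j)"
    and X_indep: "\<forall>S a. finite S \<longrightarrow> (\<forall>p\<in>S. vec_on m (snd p)) \<longrightarrow>
                   (\<Sum>p\<in>S. of_int (a p) * v powi (fst p) * X (snd p)) = 0 \<longrightarrow>
                   (\<forall>p\<in>S. a p = 0)"
  shows "gq_cluster_algebra m n v d h (\<lambda>k. X (unitv k), L, B)
           \<subseteq> gq_upper_cluster_algebra m n v d h (\<lambda>k. X (unitv k), L, B)"
proof -
  have skew: "L k l = - L l k" if "k \<in> {1..m}" "l \<in> {1..m}" for k l
    using compat that unfolding compatible_def by blast
  obtain dt :: "nat \<Rightarrow> int" where dt: "\<And>k. k \<in> {1..n} \<Longrightarrow> dt k > 0"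
    "\<And>k l. k \<in> {1..m} \<Longrightarrow> l \<in> {1..n} \<Longrightarrow>
      (\<Sum>j\<in>{1..m}. L k j * B j l) = (if k = l then - dt l else 0)"
    using compat unfolding compatible_def by blast
  interpret cluster_data v m n d h dt
  proof
    show "v * y = y * v" for y using v_central by blast
  qed (use v_nz mn d_div dt h_coeff h_sym h_ends in blast)+
  have "qtorus v m L (frame m v (\<lambda>k. X (unitv k)) L)"
  proof (rule initial_qtorus)
    show "X c * X e = v powi bform m L c e * X (c + e)" if "vec_on m c" "vec_on m e" for c e
      using X_mult that unfolding plus_fun_def by blast
    show "v * y = y * v" for y using v_central by blast
    show "L k l = - L l k" if "k \<in> {1..m}" "l \<in> {1..m}" for k l using that by (rule skew)
    show "a p = 0" if "finite S" "\<And>p. p \<in> S \<Longrightarrow> vec_on m (snd p)"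
      "(\<Sum>p\<in>S. of_int (a p) * v powi (fst p) * X (snd p)) = 0" "p \<in> S" for S a p
      using X_indep that by blast
  qed (rule v_nz)
  then have "seed v m n d h dt (\<lambda>k. X (unitv k)) L B"
    by (intro seed.intro seed_axioms.intro cluster_data_axioms) (use dt d_div in blast)+
  then show ?thesis by (intro cluster_algebra_subset_upper) simp
qed

end
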